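(* Let $\mathbb{F}_q$ be a finite field, let $F/\mathbb{F}_q$ be an algebraic function field with full constant field $\mathbb{F}_q$, let $\mathcal{C}$ be the set of places of $F$, and let $\mathcal{S}\subsetneq\mathcal{C}$ be a nonempty proper subset (either $\mathcal{S}$ or $\mathcal{C}\setminus\mathcal{S}$ may be infinite). Let $H=\bigcap_{P\in\mathcal{S}}\mathcal{O}_P$ be the holomorphy ring of $\mathcal{S}$ and let $m\ge 2$ be an integer. Then the density $\mathbb{D}(U)$ of the set $$U=\{(f_1,\dots,f_m)\in H^m \mid f_1,\dots,f_m \text{ generate the unit ideal of } H\}$$ exists and equals $\dfrac{1}{Z_H(q^{-m})}$, where $Z_H(T)=\prod_{P\in\mathcal{S}}\left(1-T^{\deg P}\right)^{-1}$.
   Context: $\mathcal{O}_P$ denotes the valuation ring of the place $P$ and $v_P$ its valuation. For a divisor $D$ of $F$, the Riemann–Roch space is $\mathcal{L}(D)=\{f\in F\mid v_P(f)+v_P(D)\ge 0 \ \forall P\in\mathcal{C}\}\cup\{0\}$, a finite-dimensional $\mathbb{F}_q$-vector space. Let $\mathcal{D}$ be the set of divisors $D\ge 0$ of $F$ whose support is contained in $\mathcal{C}\setminus\mathcal{S}$; it is a directed set under the usual partial order $\le$ of divisors, and $H=\bigcup_{D\in\mathcal{D}}\mathcal{L}(D)$. For $L\subseteq H^m$, the superior and inferior densities are $$\overline{\mathbb{D}}(L)=\limsup_{D\in\mathcal{D}}\frac{|L\cap\mathcal{L}(D)^m|}{|\mathcal{L}(D)^m|},\qquad \underline{\mathbb{D}}(L)=\liminf_{D\in\mathcal{D}}\frac{|L\cap\mathcal{L}(D)^m|}{|\mathcal{L}(D)^m|},$$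 where the limits are taken in the sense of Moore–Smith convergence of the net $D\mapsto |L\cap\mathcal{L}(D)^m|/|\mathcal{L}(D)^m|$ indexed by the directed set $\mathcal{D}$. If $\overline{\mathbb{D}}(L)=\underline{\mathbb{D}}(L)$, this common value is the density $\mathbb{D}(L)$. *)

theory Defs
  imports
    "HOL-Analysis.Analysis"
    "HOL-Computational_Algebra.Polynomial"
begin

text \<open>The function field is the whole type \<open>'f::field\<close>; constant fields, valuation rings,
  places and holomorphy rings are subsets of it.\<close>

definition is_subring :: "'f::field set \<Rightarrow> bool" where
  "is_subring R \<longleftrightarrow> 0 \<in> R \<and> 1 \<in> R \<and>
     (\<forall>x\<in>R. \<forall>y\<in>R. x + y \<in> R \<and> x * y \<in> R) \<and> (\<forall>x\<in>R. - x \<in> R)"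

definition is_subfield :: "'f::field set \<Rightarrow> bool" where
  "is_subfield K \<longleftrightarrow> is_subring K \<and> (\<forall>x\<in>K. inverse x \<in> K)"

definition adjoin :: "'f::field set \<Rightarrow> 'f \<Rightarrow> 'f set" where
  "adjoin K x = \<Inter>{E. is_subfield E \<and> K \<subseteq> E \<and> x \<in> E}"

definition algebraic_over :: "'f::field set \<Rightarrow> 'f \<Rightarrow> bool" where
  "algebraic_over K x \<longleftrightarrow> (\<exists>p. p \<noteq> 0 \<and> (\<forall>i. coeff p i \<in> K) \<and> poly p x = 0)"

text \<open>For \<open>K\<close>-subspaces \<open>W \<subseteq> V\<close> of \<open>'f\<close>: the residue classes of \<open>b 0, \<dots>, b (n - 1)\<close>
  form a \<open>K\<close>-basis of \<open>V / W\<close>.\<close>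

definition quotient_basis ::
    "'f::field set \<Rightarrow> 'f set \<Rightarrow> 'f set \<Rightarrow> nat \<Rightarrow> (nat \<Rightarrow> 'f) \<Rightarrow> bool" where
  "quotient_basis K V W n b \<longleftrightarrow>
     (\<forall>i<n. b i \<in> V) \<and>
     (\<forall>v\<in>V. \<exists>c. (\<forall>i<n. c i \<in> K) \<and> v - (\<Sum>i<n. c i * b i) \<in> W) \<and>
     (\<forall>c. (\<forall>i<n. c i \<in> K) \<and> (\<Sum>i<n. c i * b i) \<in> W \<longrightarrow> (\<forall>i<n. c i = 0))"

definition quotient_dim :: "'f::field set \<Rightarrow> 'f set \<Rightarrow> 'f set \<Rightarrow> nat" where
  "quotient_dim K V W = (THE n. \<exists>b. quotient_basis K V W n b)"

definition finite_extension_of :: "'f::field set \<Rightarrow> bool" where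
  "finite_extension_of E \<longleftrightarrow> (\<exists>n b. quotient_basis E (UNIV :: 'f set) {0} n b)"

text \<open>Algebraic function field of one variable over \<open>K\<close>.\<close>

definition function_field_over :: "'f::field set \<Rightarrow> bool" where
  "function_field_over K \<longleftrightarrow>
     is_subfield K \<and> (\<exists>x. \<not> algebraic_over K x \<and> finite_extension_of (adjoin K x))"

definition full_constant_field :: "'f::field set \<Rightarrow> bool" where
  "full_constant_field K \<longleftrightarrow> {x. algebraic_over K x} = K"

definition valuation_ring :: "'f::field set \<Rightarrow> 'f set \<Rightarrow> bool" where
  "valuation_ring K R \<longleftrightarrow>
     is_subring R \<and> K \<subset> R \<and> R \<subset> UNIV \<and> (\<forall>z. z \<in> R \<or> inverse z \<in> R)"

definition units_in :: "'f::field set \<Rightarrow> 'f set" where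
  "units_in R = {u \<in> R. u \<noteq> 0 \<and> inverse u \<in> R}"

text \<open>The maximal ideal of a valuation ring is its set of non-units; a place is such an ideal.\<close>

definition places :: "'f::field set \<Rightarrow> 'f set set" where
  "places K = {P. \<exists>R. valuation_ring K R \<and> P = R - units_in R}"

definition place_ring :: "'f::field set \<Rightarrow> 'f set \<Rightarrow> 'f set" where
  "place_ring K P = (THE R. valuation_ring K R \<and> P = R - units_in R)"

text \<open>The unique \<open>n\<close> with \<open>z = t\<^sup>n u\<close>, where \<open>t\<close> is a generator of \<open>P\<close> and \<open>u\<close> a unit of the
  valuation ring; only meaningful for \<open>z \<noteq> 0\<close>.\<close>

definition place_val :: "'f::field set \<Rightarrow> 'f set \<Rightarrow> 'f \<Rightarrow> int" where
  "place_val K P z = (THE n. \<exists>t u. P = (\<lambda>x. t * x) ` place_ring K P \<and>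
     u \<in> units_in (place_ring K P) \<and> z = t powi n * u)"

definition place_degree :: "'f::field set \<Rightarrow> 'f set \<Rightarrow> nat" where
  "place_degree K P = quotient_dim K (place_ring K P) P"

text \<open>Divisors are finitely supported functions on places, extended by 0 to all subsets of \<open>'f\<close>,
  so that the pointwise order of functions is the order of divisors.\<close>

definition divisors :: "'f::field set \<Rightarrow> ('f set \<Rightarrow> int) set" where
  "divisors K = {D. finite {P. D P \<noteq> 0} \<and> {P. D P \<noteq> 0} \<subseteq> places K}"

definition riemann_roch_space :: "'f::field set \<Rightarrow> ('f set \<Rightarrow> int) \<Rightarrow> 'f set" where
  "riemann_roch_space K D = {f. \<forall>P\<in>places K. place_val K P f + D P \<ge> 0} \<union> {0}"

definition holomorphy_ring :: "'f::field set \<Rightarrow> 'f set set \<Rightarrow> 'f set" where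
  "holomorphy_ring K S = (\<Inter>P\<in>S. place_ring K P)"

definition effective_divisors_off ::
    "'f::field set \<Rightarrow> 'f set set \<Rightarrow> ('f set \<Rightarrow> int) set" where
  "effective_divisors_off K S =
     {D \<in> divisors K. (\<forall>P. 0 \<le> D P) \<and> {P. D P \<noteq> 0} \<subseteq> places K - S}"

text \<open>The filter of tails of the directed set \<open>A\<close>: limits along it are Moore--Smith limits of nets
  indexed by \<open>A\<close>.\<close>

definition net_filter :: "'i::order set \<Rightarrow> 'i filter" where
  "net_filter A = (INF D\<in>A. principal {E \<in> A. D \<le> E})"

text \<open>\<open>m\<close>-tuples over \<open>X\<close> are the elements of \<open>{..<m} \<rightarrow>\<^sub>E X\<close>.\<close>

definition rr_proportion ::
    "'f::field set \<Rightarrow> nat \<Rightarrow> (nat \<Rightarrow> 'f) set \<Rightarrow> ('f set \<Rightarrow> int) \<Rightarrow> real" where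
  "rr_proportion K m L D =
     real (card (L \<inter> ({..<m} \<rightarrow>\<^sub>E riemann_roch_space K D))) /
     real (card ({..<m} \<rightarrow>\<^sub>E riemann_roch_space K D))"

definition upper_density ::
    "'f::field set \<Rightarrow> 'f set set \<Rightarrow> nat \<Rightarrow> (nat \<Rightarrow> 'f) set \<Rightarrow> ereal" where
  "upper_density K S m L =
     Limsup (net_filter (effective_divisors_off K S)) (\<lambda>D. ereal (rr_proportion K m L D))"

definition lower_density ::
    "'f::field set \<Rightarrow> 'f set set \<Rightarrow> nat \<Rightarrow> (nat \<Rightarrow> 'f) set \<Rightarrow> ereal" where
  "lower_density K S m L =
     Liminf (net_filter (effective_divisors_off K S)) (\<lambda>D. ereal (rr_proportion K m L D))"

definition has_density ::
    "'f::field set \<Rightarrow> 'f set set \<Rightarrow> nat \<Rightarrow> (nat \<Rightarrow> 'f) set \<Rightarrow> real \<Rightarrow> bool" where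
  "has_density K S m L d \<longleftrightarrow> upper_density K S m L = ereal d \<and> lower_density K S m L = ereal d"

definition generated_ideal :: "'f::field set \<Rightarrow> nat \<Rightarrow> (nat \<Rightarrow> 'f) \<Rightarrow> 'f set" where
  "generated_ideal R m f = {\<Sum>i<m. h i * f i | h. \<forall>i<m. h i \<in> R}"

definition unimodular_tuples :: "'f::field set \<Rightarrow> nat \<Rightarrow> (nat \<Rightarrow> 'f) set" where
  "unimodular_tuples R m = {f \<in> {..<m} \<rightarrow>\<^sub>E R. generated_ideal R m f = R}"

text \<open>Unordered infinite products, the multiplicative analogue of \<^const>\<open>infsum\<close>.\<close>

definition has_infprod :: "('i \<Rightarrow> real) \<Rightarrow> 'i set \<Rightarrow> real \<Rightarrow> bool" where
  "has_infprod f A p \<longleftrightarrow> (prod f \<longlongrightarrow> p) (finite_subsets_at_top A)"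

definition infprod :: "('i \<Rightarrow> real) \<Rightarrow> 'i set \<Rightarrow> real" where
  "infprod f A = Lim (finite_subsets_at_top A) (prod f)"

definition zeta_factor :: "'f::field set \<Rightarrow> real \<Rightarrow> 'f set \<Rightarrow> real" where
  "zeta_factor K T P = inverse (1 - T ^ place_degree K P)"

definition holomorphy_zeta :: "'f::field set \<Rightarrow> 'f set set \<Rightarrow> real \<Rightarrow> real" where
  "holomorphy_zeta K S T = infprod (zeta_factor K T) S"

end

theory Submission imports Defs begin

text \<open>
  A tuple over \<open>H\<close> is unimodular iff no place of \<open>S\<close> contains all its entries: a proper ideal of \<open>H\<close>
  lies in some place \<open>P\<close> whose valuation ring contains \<open>H\<close>, and \<open>P \<in> S\<close> because for \<open>P \<notin> S\<close> there is an
  element of \<open>H\<close> with its only pole at \<open>P\<close>.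

  By Riemann's theorem \<open>dim L(D) = deg D + 1 - g\<close> once \<open>deg D\<close> is large. For a finite \<open>T \<subseteq> S\<close>,
  inclusion--exclusion over the spaces \<open>L(D - \<Sum>P)\<close> then shows that the proportion of tuples over \<open>L(D)\<close>
  that vanish at no place of \<open>T\<close> is exactly \<open>\<Prod>P\<in>T. 1 - q^(-m deg P)\<close>. The nonzero tuples vanishing
  at some \<open>P \<in> S - T\<close> make up a proportion of at most \<open>q^(m g) q^(-m deg P)\<close>, uniformly in \<open>D\<close>, and
  the series \<open>\<Sum>P. q^(-m deg P)\<close> converges for \<open>m \<ge> 2\<close>.

  Since \<open>K\<close> is finite, dimensions are compared by counting elements. For a nonconstant \<open>z\<close>, the degrees of
  the zero and pole divisors both equal \<open>[F : K(z)]\<close>: weak approximation bounds the zeros from above, and the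
  growth of \<open>L(l (z)\<^sub>\<infinity> + C)\<close> in \<open>l\<close> bounds the poles from below.
\<close>

section \<open>Linear algebra over the constant field\<close>

text \<open>A valuation ring is only assumed to be a proper subring of \<open>F\<close> that
  strictly contains \<open>K\<close> and contains \<open>z\<close> or \<open>inverse z\<close> for
  every \<open>z\<close>, so discreteness and the finiteness of residue fields have to be derived.
  The tool is \<open>[F : K(z)]\<close>, encoded as the greatest size of a family independent over
  \<open>K(z)\<close>: a family that is independent modulo \<open>z A\<close> is independent over
  \<open>K(z)\<close>, which bounds the dimension of every quotient \<open>A / z A\<close>.

  Riemann's theorem enters in two strengths. The exact count at finitely many places needs equality,
  hence large degree. The tail must be bounded at all places at once, also at those of degree far
  above \<open>deg D\<close>. There a nonzero tuple vanishing at \<open>P\<close> makes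
  \<open>L(D - P)\<close> nonzero, so \<open>dim L(D - P) \<le> deg D - deg P + 1\<close> in every
  degree; comparing this with \<open>dim L(D) \<ge> deg D + 1 - g\<close> costs the factor
  \<open>q^(m g)\<close>. The zero tuple vanishes everywhere, but its proportion tends to 0, because
  a place outside \<open>S\<close> lets \<open>deg D\<close> grow without bound.\<close>

locale finite_constants =
  fixes K :: "'f::field set"
  assumes finite_K: "finite K" and subfield_K: "is_subfield K"
begin

lemma K_0 [simp]: "0 \<in> K" and K_1 [simp]: "1 \<in> K"
  and K_add: "\<And>x y. x \<in> K \<Longrightarrow> y \<in> K \<Longrightarrow> x + y \<in> K"
  and K_mult: "\<And>x y. x \<in> K \<Longrightarrow> y \<in> K \<Longrightarrow> x * y \<in> K"
  and K_minus: "\<And>x. x \<in> K \<Longrightarrow> - x \<in> K"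
  and K_inverse: "\<And>x. x \<in> K \<Longrightarrow> inverse x \<in> K"
  using subfield_K unfolding is_subfield_def is_subring_def by blast+

lemma K_diff: "x \<in> K \<Longrightarrow> y \<in> K \<Longrightarrow> x - y \<in> K"
  using K_add[of x "- y"] K_minus by simp

abbreviation q :: nat where "q \<equiv> card K"

lemma q_ge_2: "q \<ge> 2"
proof -
  have "card {0, 1 :: 'f} \<le> q"
    using finite_K by (intro card_mono) auto
  thus ?thesis by simp
qed

definition ksub :: "'f set \<Rightarrow> bool" where
  "ksub V \<longleftrightarrow> 0 \<in> V \<and> (\<forall>x\<in>V. \<forall>y\<in>V. x + y \<in> V) \<and> (\<forall>c\<in>K. \<forall>x\<in>V. c * x \<in> V)"

lemma ksub_0: "ksub V \<Longrightarrow> 0 \<in> V"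
  and ksub_add: "ksub V \<Longrightarrow> x \<in> V \<Longrightarrow> y \<in> V \<Longrightarrow> x + y \<in> V"
  and ksub_scale: "ksub V \<Longrightarrow> c \<in> K \<Longrightarrow> x \<in> V \<Longrightarrow> c * x \<in> V"
  by (auto simp: ksub_def)

lemma ksub_minus: "ksub V \<Longrightarrow> x \<in> V \<Longrightarrow> - x \<in> V"
  using ksub_scale[of V "-1" x] K_minus[OF K_1] by simp

lemma ksub_diff: "ksub V \<Longrightarrow> x \<in> V \<Longrightarrow> y \<in> V \<Longrightarrow> x - y \<in> V"
  using ksub_add[of V x "- y"] ksub_minus[of V y] by simp

lemma ksub_sum: "ksub V \<Longrightarrow> (\<And>i. i \<in> I \<Longrightarrow> g i \<in> V) \<Longrightarrow> sum g I \<in> V"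
  by (induction I rule: infinite_finite_induct) (auto simp: ksub_0 ksub_add)

lemma ksub_zero [simp]: "ksub {0}"
  by (auto simp: ksub_def)

lemma ksub_scaled:
  assumes "ksub V"
  shows "ksub ((\<lambda>x. a * x) ` V)"
proof -
  have "a * x + a * y \<in> (\<lambda>x. a * x) ` V" if "x \<in> V" "y \<in> V" for x y
    using imageI[OF ksub_add[OF assms that], of "\<lambda>x. a * x"] by (simp add: distrib_left)
  moreover have "c * (a * x) \<in> (\<lambda>x. a * x) ` V" if "c \<in> K" "x \<in> V" for c x
    using imageI[OF ksub_scale[OF assms that], of "\<lambda>x. a * x"] by (simp add: mult.left_commute)
  moreover have "0 \<in> (\<lambda>x. a * x) ` V"
    using imageI[OF ksub_0[OF assms], of "\<lambda>x. a * x"] by simp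
  ultimately show ?thesis unfolding ksub_def by blast
qed

text \<open>The independence clause of \<open>quotient_basis\<close> by itself, for families that
  are not known to span.\<close>

definition indep_mod :: "'f set \<Rightarrow> nat \<Rightarrow> (nat \<Rightarrow> 'f) \<Rightarrow> bool" where
  "indep_mod W n b \<longleftrightarrow>
     (\<forall>c. (\<forall>i<n. c i \<in> K) \<and> (\<Sum>i<n. c i * b i) \<in> W \<longrightarrow> (\<forall>i<n. c i = 0))"

lemma quotient_basis_iff:
  "quotient_basis K V W n b \<longleftrightarrow> (\<forall>i<n. b i \<in> V) \<and>
     (\<forall>v\<in>V. \<exists>c. (\<forall>i<n. c i \<in> K) \<and> v - (\<Sum>i<n. c i * b i) \<in> W) \<and> indep_mod W n b"
  by (simp add: quotient_basis_def indep_mod_def)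

lemma indep_modD:
  "indep_mod W n b \<Longrightarrow> (\<And>i. i < n \<Longrightarrow> c i \<in> K) \<Longrightarrow> (\<Sum>i<n. c i * b i) \<in> W \<Longrightarrow> i < n \<Longrightarrow> c i = 0"
  unfolding indep_mod_def by blast

text \<open>In a relation involving \<open>v\<close>, a nonzero coefficient of \<open>v\<close>
  could be divided out, which would put \<open>v\<close> into the span of the \<open>b i\<close>
  modulo \<open>W\<close>. So this coefficient is 0 and the independence of \<open>b\<close>
  applies.\<close>

lemma indep_mod_extend:
  assumes W: "ksub W" and b: "indep_mod W n b"
    and v: "\<And>c. (\<And>i. i < n \<Longrightarrow> c i \<in> K) \<Longrightarrow> v - (\<Sum>i<n. c i * b i) \<notin> W"
  shows "indep_mod W (Suc n) (b(n := v))"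
  unfolding indep_mod_def
proof (intro allI impI, elim conjE)
  fix c i assume c: "\<forall>i<Suc n. c i \<in> K"
    and s: "(\<Sum>i<Suc n. c i * (b(n := v)) i) \<in> W" and i: "i < Suc n"
  have s': "(\<Sum>i<n. c i * b i) + c n * v \<in> W"
    using s by simp
  have cn: "c n = 0"
  proof (rule ccontr)
    assume nz: "c n \<noteq> 0"
    have "inverse (c n) * ((\<Sum>i<n. c i * b i) + c n * v) \<in> W"
      by (rule ksub_scale[OF W _ s']) (use c in \<open>auto intro: K_inverse\<close>)
    moreover have "inverse (c n) * ((\<Sum>i<n. c i * b i) + c n * v)
        = v - (\<Sum>i<n. (- inverse (c n) * c i) * b i)"
      using nz by (simp add: algebra_simps sum_distrib_left sum_negf)
    moreover have "- inverse (c n) * c i \<in> K" if "i < n" for i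
      using c that by (intro K_mult K_minus K_inverse) auto
    ultimately show False using v[of "\<lambda>i. - inverse (c n) * c i"] by simp
  qed
  show "c i = 0"
    using indep_modD[OF b, of c i] c s' cn i by (cases "i = n") auto
qed

text \<open>An independent family of greatest length spans, since otherwise it could be extended.
  The bound \<open>N\<close> stands in for finite dimensionality and makes the greatest length
  exist.\<close>

lemma quotient_basis_exists:
  assumes V: "ksub V" and W: "ksub W"
    and bound: "\<And>n b. (\<And>i. i < n \<Longrightarrow> b i \<in> V) \<Longrightarrow> indep_mod W n b \<Longrightarrow> n \<le> N"
  shows "\<exists>n b. n \<le> N \<and> quotient_basis K V W n b"
proof -
  let ?P = "\<lambda>n. \<exists>b. (\<forall>i<n. b i \<in> V) \<and> indep_mod W n b"
  have P0: "?P 0" by (auto simp: indep_mod_def)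
  have PN: "\<And>n. ?P n \<Longrightarrow> n \<le> N" using bound by blast
  define n where "n = (GREATEST n. ?P n)"
  have Pn: "?P n" unfolding n_def using GreatestI_nat[of ?P, OF P0 PN] by blast
  have max: "k \<le> n" if "?P k" for k
    unfolding n_def using Greatest_le_nat[of ?P, OF that PN] by blast
  from Pn obtain b where b: "\<forall>i<n. b i \<in> V" "indep_mod W n b" by blast
  have "\<exists>c. (\<forall>i<n. c i \<in> K) \<and> v - (\<Sum>i<n. c i * b i) \<in> W" if v: "v \<in> V" for v
  proof (rule ccontr)
    assume "\<not> ?thesis"
    hence "indep_mod W (Suc n) (b(n := v))"
      by (intro indep_mod_extend W b) auto
    moreover have "\<forall>i<Suc n. (b(n := v)) i \<in> V" using b v by auto
    ultimately have "?P (Suc n)" by blast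
    from max[OF this] show False by simp
  qed
  thus ?thesis using PN[OF Pn] b unfolding quotient_basis_iff by blast
qed

abbreviation coefs :: "nat \<Rightarrow> (nat \<Rightarrow> 'f) set" where
  "coefs n \<equiv> {..<n} \<rightarrow>\<^sub>E K"

lemma card_coefs: "card (coefs n) = q ^ n" and finite_coefs: "finite (coefs n)"
  using finite_K by (simp_all add: card_PiE finite_PiE)

lemma coefs_spanning:
  assumes "quotient_basis K V W n b" "v \<in> V"
  obtains c where "c \<in> coefs n" "v - (\<Sum>i<n. c i * b i) \<in> W"
proof -
  obtain c where c: "\<forall>i<n. c i \<in> K" "v - (\<Sum>i<n. c i * b i) \<in> W"
    using assms unfolding quotient_basis_iff by blast
  show ?thesis
    by (rule that[of "restrict c {..<n}"]) (use c in auto)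
qed

lemma coefs_eqI:
  assumes "indep_mod W n b" "c \<in> coefs n" "d \<in> coefs n"
    and "(\<Sum>i<n. c i * b i) - (\<Sum>i<n. d i * b i) \<in> W"
  shows "c = d"
proof
  fix i
  have "(\<Sum>i<n. (c i - d i) * b i) \<in> W"
    using assms(4) by (simp add: left_diff_distrib sum_subtractf)
  moreover have "c i - d i \<in> K" if "i < n" for i
    using assms(2,3) that by (intro K_diff) (auto simp: PiE_iff)
  ultimately have "i < n \<Longrightarrow> c i - d i = 0"
    using indep_modD[OF assms(1), of "\<lambda>i. c i - d i" i] by blast
  thus "c i = d i" using PiE_arb[OF assms(2)] PiE_arb[OF assms(3)] by (cases "i < n") auto
qed

text \<open>Counting takes the place of the exchange lemma: expanding combinations of the
  \<open>b i\<close> in the basis \<open>b'\<close> gives an injection of \<open>q ^ n\<close>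
  coefficient vectors into \<open>q ^ k\<close>.\<close>

lemma quotient_basis_le:
  assumes W: "ksub W" and b: "indep_mod W n b" "\<And>i. i < n \<Longrightarrow> b i \<in> V" and V: "ksub V"
    and b': "quotient_basis K V W k b'"
  shows "n \<le> k"
proof -
  have "\<exists>d\<in>coefs k. (\<Sum>i<n. c i * b i) - (\<Sum>i<k. d i * b' i) \<in> W" if "c \<in> coefs n" for c
  proof -
    have "(\<Sum>i<n. c i * b i) \<in> V"
      using that b(2) by (intro ksub_sum[OF V] ksub_scale[OF V]) auto
    from coefs_spanning[OF b' this] show ?thesis by blast
  qed
  then obtain h where h: "\<And>c. c \<in> coefs n \<Longrightarrow> h c \<in> coefs k"
    "\<And>c. c \<in> coefs n \<Longrightarrow> (\<Sum>i<n. c i * b i) - (\<Sum>i<k. h c i * b' i) \<in> W"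
    by metis
  have "inj_on h (coefs n)"
  proof (rule inj_onI)
    fix c d assume cd: "c \<in> coefs n" "d \<in> coefs n" and eq: "h c = h d"
    show "c = d"
      by (rule coefs_eqI[OF b(1) cd])
        (use ksub_diff[OF W h(2)[OF cd(1)] h(2)[OF cd(2)]] eq in simp)
  qed
  hence "card (coefs n) \<le> card (coefs k)"
    using h(1) by (intro card_inj_on_le[of h]) (auto simp: finite_coefs)
  hence "q ^ n \<le> q ^ k" by (simp only: card_coefs)
  thus ?thesis using q_ge_2 by simp
qed

lemma quotient_dim_eq:
  assumes "ksub V" "ksub W" and b: "quotient_basis K V W n b"
  shows "quotient_dim K V W = n"
  unfolding quotient_dim_def
proof (rule the_equality)
  show "\<exists>b. quotient_basis K V W n b" using b by blast
next
  fix k assume "\<exists>b'. quotient_basis K V W k b'"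
  then obtain b' where b': "quotient_basis K V W k b'" by blast
  show "k = n"
    using quotient_basis_le[OF assms(2) _ _ assms(1) b, of k b']
      quotient_basis_le[OF assms(2) _ _ assms(1) b', of n b] b b'
    unfolding quotient_basis_iff by force
qed

lemma card_quotient_basis:
  assumes V: "ksub V" and W: "ksub W" and WV: "W \<subseteq> V" and b: "quotient_basis K V W n b"
    and fin: "finite W"
  shows "finite V" "card V = q ^ n * card W"
proof -
  define h where "h = (\<lambda>(c, w). (\<Sum>i<n. c i * b i) + w)"
  have inj: "inj_on h (coefs n \<times> W)"
  proof (rule inj_onI, clarify)
    fix c w d v assume A: "c \<in> coefs n" "w \<in> W" "d \<in> coefs n" "v \<in> W" "h (c, w) = h (d, v)"
    have "(\<Sum>i<n. c i * b i) - (\<Sum>i<n. d i * b i) = v - w"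
      using A(5) by (simp add: h_def algebra_simps)
    hence "c = d"
      using A b by (intro coefs_eqI[of W n b c d]) (auto simp: quotient_basis_iff ksub_diff[OF W])
    thus "c = d \<and> w = v" using A(5) by (simp add: h_def)
  qed
  have img: "h ` (coefs n \<times> W) = V"
  proof (intro equalityI subsetI)
    fix v assume "v \<in> h ` (coefs n \<times> W)"
    then obtain c w where "c \<in> coefs n" "w \<in> W" "v = (\<Sum>i<n. c i * b i) + w"
      by (auto simp: h_def)
    thus "v \<in> V" using b WV unfolding quotient_basis_iff
      by (auto intro!: ksub_add[OF V] ksub_sum[OF V] ksub_scale[OF V])
  next
    fix v assume "v \<in> V"
    from coefs_spanning[OF b this] obtain c
      where "c \<in> coefs n" "v - (\<Sum>i<n. c i * b i) \<in> W" .
    thus "v \<in> h ` (coefs n \<times> W)"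
      by (intro image_eqI[of _ _ "(c, v - (\<Sum>i<n. c i * b i))"]) (auto simp: h_def)
  qed
  show "finite V" using img fin finite_coefs[of n] by (metis finite_SigmaI finite_imageI)
  show "card V = q ^ n * card W"
    using card_image[OF inj] by (simp add: img card_cartesian_product card_coefs)
qed

lemma card_finite_subspace:
  assumes V: "ksub V" and fin: "finite V"
  shows "card V = q ^ quotient_dim K V {0}"
proof -
  have "\<exists>n b. n \<le> card V \<and> quotient_basis K V {0} n b"
  proof (rule quotient_basis_exists[OF V])
    fix n b assume b: "\<And>i. i < n \<Longrightarrow> b i \<in> V" "indep_mod {0} n b"
    have "inj_on (\<lambda>c. \<Sum>i<n. c i * b i) (coefs n)"
      by (rule inj_onI) (use coefs_eqI[OF b(2)] in auto)
    hence "card (coefs n) \<le> card V"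
      by (rule card_inj_on_le) (auto intro!: ksub_sum[OF V] ksub_scale[OF V] b fin)
    hence "q ^ n \<le> card V" by (simp only: card_coefs)
    \<comment> \<open>This turns the count into the bound on the length that
      \<open>quotient_basis_exists\<close> asks for.\<close>
    moreover have "n < q ^ n" using q_ge_2 by (intro power_gt_expt) simp
    ultimately show "n \<le> card V" by simp
  qed simp
  then obtain n b where b: "quotient_basis K V {0} n b" by blast
  have n: "quotient_dim K V {0} = n" by (rule quotient_dim_eq[OF V _ b]) simp
  show "card V = q ^ quotient_dim K V {0}"
    using card_quotient_basis(2)[OF V _ _ b] V n by (simp add: ksub_0)
qed

text \<open>The two bases are concatenated: an element is expanded modulo \<open>W\<close>, and the
  remainder, which lies in \<open>W\<close>, is expanded modulo \<open>X\<close>.\<close>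

lemma quotient_basis_trans:
  assumes V: "ksub V" and W: "ksub W" and X: "ksub X" and sub: "X \<subseteq> W" "W \<subseteq> V"
    and b: "quotient_basis K V W n b" and b': "quotient_basis K W X k b'"
  shows "\<exists>b''. quotient_basis K V X (n + k) b''"
proof -
  define d where "d = (\<lambda>i. if i < n then b i else b' (i - n))"
  have split: "(\<Sum>i<n + k. c i * d i) = (\<Sum>i<n. c i * b i) + (\<Sum>i<k. c (n + i) * b' i)" for c
  proof -
    have "(\<Sum>i<n + k. c i * d i) = (\<Sum>i<n. c i * d i) + (\<Sum>i<k. c (n + i) * d (n + i))"
      by (induction k) (simp_all add: add.assoc)
    thus ?thesis by (simp add: d_def)
  qed
  have 1: "d i \<in> V" if "i < n + k" for i
  proof (cases "i < n")
    case True thus ?thesis using b by (auto simp: d_def quotient_basis_iff)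
  next
    case False
    hence "b' (i - n) \<in> W" using b' that by (auto simp: quotient_basis_iff)
    thus ?thesis using False sub by (auto simp: d_def)
  qed
  have 2: "\<exists>c. (\<forall>i<n + k. c i \<in> K) \<and> v - (\<Sum>i<n + k. c i * d i) \<in> X" if "v \<in> V" for v
  proof -
    obtain c where c: "c \<in> coefs n" "v - (\<Sum>i<n. c i * b i) \<in> W"
      using coefs_spanning[OF b \<open>v \<in> V\<close>] .
    obtain c' where c': "c' \<in> coefs k" "v - (\<Sum>i<n. c i * b i) - (\<Sum>i<k. c' i * b' i) \<in> X"
      using coefs_spanning[OF b' c(2)] .
    let ?c = "\<lambda>i. if i < n then c i else c' (i - n)"
    have "\<forall>i<n + k. ?c i \<in> K" using c(1) c'(1) by (auto simp: PiE_iff)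
    moreover have "v - (\<Sum>i<n + k. ?c i * d i) \<in> X" using c'(2) by (simp add: split diff_diff_eq)
    ultimately show ?thesis by (intro exI[of _ ?c] conjI)
  qed
  have 3: "indep_mod X (n + k) d"
    unfolding indep_mod_def
  proof (intro allI impI, elim conjE)
    fix c i assume c: "\<forall>i<n + k. c i \<in> K" and s: "(\<Sum>i<n + k. c i * d i) \<in> X" and i: "i < n + k"
    let ?s' = "\<Sum>i<k. c (n + i) * b' i"
    have s'W: "?s' \<in> W" using b' c
      by (intro ksub_sum[OF W] ksub_scale[OF W]) (auto simp: quotient_basis_iff)
    have "(\<Sum>i<n. c i * b i) \<in> W"
      using ksub_diff[OF W subsetD[OF sub(1) s] s'W] by (simp add: split)
    hence c0: "c i = 0" if "i < n" for i
      using b c that by (intro indep_modD[of W n b c]) (auto simp: quotient_basis_iff)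
    hence "?s' \<in> X" using s by (simp add: split)
    hence c1: "c (n + i) = 0" if "i < k" for i
      using b' c that by (intro indep_modD[of X k b' "\<lambda>i. c (n + i)"]) (auto simp: quotient_basis_iff)
    show "c i = 0" using c0[of i] c1[of "i - n"] i by (cases "i < n") auto
  qed
  show ?thesis using 1 2 3 unfolding quotient_basis_iff by blast
qed

lemma quotient_basis_scale:
  assumes "a \<noteq> 0" and b: "quotient_basis K V W n b"
  shows "quotient_basis K ((\<lambda>x. a * x) ` V) ((\<lambda>x. a * x) ` W) n (\<lambda>i. a * b i)"
proof -
  have s: "(\<Sum>i<n. c i * (a * b i)) = a * (\<Sum>i<n. c i * b i)" for c
    by (simp add: sum_distrib_left mult.left_commute)
  have m: "a * x \<in> (\<lambda>x. a * x) ` W \<longleftrightarrow> x \<in> W" for x using assms(1) by auto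
  have "\<exists>c. (\<forall>i<n. c i \<in> K) \<and> a * v - (\<Sum>i<n. c i * (a * b i)) \<in> (\<lambda>x. a * x) ` W"
    if "v \<in> V" for v
  proof -
    obtain c where c: "c \<in> coefs n" "v - (\<Sum>i<n. c i * b i) \<in> W"
      using coefs_spanning[OF b \<open>v \<in> V\<close>] .
    thus ?thesis
      by (intro exI[of _ c]) (auto simp: s m simp flip: right_diff_distrib)
  qed
  moreover have "indep_mod ((\<lambda>x. a * x) ` W) n (\<lambda>i. a * b i)"
    using b unfolding quotient_basis_iff indep_mod_def s m by blast
  ultimately show ?thesis
    using b unfolding quotient_basis_iff by blast
qed

section \<open>Independence over a rational subfield\<close>

text \<open>Linear independence of the family \<open>y\<close> over \<open>K(z)\<close>, for transcendental \<open>z\<close>.\<close>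

definition zindep :: "'f \<Rightarrow> 'i set \<Rightarrow> ('i \<Rightarrow> 'f) \<Rightarrow> bool" where
  "zindep z I y \<longleftrightarrow> (\<forall>l c. (\<forall>i\<in>I. \<forall>j\<le>l. c i j \<in> K) \<and>
     (\<Sum>i\<in>I. \<Sum>j\<le>l. c i j * (z ^ j * y i)) = 0 \<longrightarrow> (\<forall>i\<in>I. \<forall>j\<le>l. c i j = 0))"

lemma zindepD:
  assumes "zindep z I y" "\<And>i j. i \<in> I \<Longrightarrow> j \<le> l \<Longrightarrow> c i j \<in> K"
    and "(\<Sum>i\<in>I. \<Sum>j\<le>l. c i j * (z ^ j * y i)) = 0" "i \<in> I" "j \<le> (l::nat)"
  shows "c i j = 0"
  using assms unfolding zindep_def by blast

text \<open>Independence over \<open>K(z)\<close> becomes a count: distinct coefficient vectors give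
  distinct \<open>K\<close>-combinations of the \<open>card I * Suc l\<close> products
  \<open>z ^ j * y i\<close>. The factor \<open>a\<close> clears denominators before the
  combinations are placed in a finite space.\<close>

lemma zindep_card_le:
  assumes z: "zindep z I y" and I: "finite I" and a: "a \<noteq> 0" and V: "ksub V" "finite V"
    and mem: "\<And>i j. i \<in> I \<Longrightarrow> j \<le> (l::nat) \<Longrightarrow> a * (z ^ j * y i) \<in> V"
  shows "q ^ (card I * Suc l) \<le> card V"
proof -
  let ?C = "(I \<times> {..l}) \<rightarrow>\<^sub>E K"
  define h where "h = (\<lambda>c. a * (\<Sum>i\<in>I. \<Sum>j\<le>l. c (i, j) * (z ^ j * y i)))"
  have "inj_on h ?C"
  proof (rule inj_onI)
    fix c d assume c: "c \<in> ?C" and d: "d \<in> ?C" and eq: "h c = h d"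
    have "(\<Sum>i\<in>I. \<Sum>j\<le>l. (c (i, j) - d (i, j)) * (z ^ j * y i)) = 0"
      using eq a by (simp add: h_def left_diff_distrib sum_subtractf)
    moreover have "c (i, j) - d (i, j) \<in> K" if "i \<in> I" "j \<le> l" for i j
      using c d that by (intro K_diff) (auto simp: PiE_iff)
    ultimately have "c (i, j) - d (i, j) = 0" if "i \<in> I" "j \<le> l" for i j
      using zindepD[OF z, of l "\<lambda>i j. c (i, j) - d (i, j)"] that by blast
    thus "c = d" using c d by (intro PiE_ext[of c _ _ d]) auto
  qed
  moreover have "h ` ?C \<subseteq> V"
  proof clarify
    fix c assume c: "c \<in> ?C"
    have "h c = (\<Sum>i\<in>I. \<Sum>j\<le>l. c (i, j) * (a * (z ^ j * y i)))"
      by (simp add: h_def sum_distrib_left mult.left_commute)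
    also have "\<dots> \<in> V"
      using c by (intro ksub_sum[OF V(1)] ksub_scale[OF V(1)] mem) (auto simp: PiE_iff)
    finally show "h c \<in> V" .
  qed
  ultimately have "card ?C \<le> card V" using V(2) card_inj_on_le by blast
  moreover have "card ?C = q ^ (card I * Suc l)"
    using I by (simp add: card_PiE card_cartesian_product)
  ultimately show ?thesis by simp
qed

lemma zindep_reindex:
  assumes h: "inj_on h J" and z: "zindep z (h ` J) y"
  shows "zindep z J (y \<circ> h)"
  unfolding zindep_def
proof (intro allI impI ballI, elim conjE)
  fix l :: nat and c i j assume c: "\<forall>i\<in>J. \<forall>j\<le>l. c i j \<in> K"
    and s: "(\<Sum>i\<in>J. \<Sum>j\<le>l. c i j * (z ^ j * (y \<circ> h) i)) = 0" and i: "i \<in> J" and j: "j \<le> l"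
  let ?c = "\<lambda>i. c (inv_into J h i)"
  have "(\<Sum>i\<in>h ` J. \<Sum>j\<le>l. ?c i j * (z ^ j * y i)) = 0"
    using s by (simp add: sum.reindex[OF h] inv_into_f_f[OF h])
  moreover have "?c i j \<in> K" if "i \<in> h ` J" "j \<le> l" for i j
    using c that by (auto simp: inv_into_f_f[OF h])
  ultimately have "?c (h i) j = 0"
    by (intro zindepD[OF z, of l ?c]) (use i j in auto)
  thus "c i j = 0" using i by (simp add: inv_into_f_f[OF h])
qed

text \<open>A relation between the \<open>y i\<close> with polynomial coefficients can be divided by a power of \<open>z\<close>
  until some constant coefficient is nonzero; modulo \<open>z A\<close> only the constant coefficients remain.\<close>

lemma zindep_if_indep_mod_scaled:
  assumes A: "ksub A" and z: "z \<noteq> 0" and zA: "\<And>x. x \<in> A \<Longrightarrow> z * x \<in> A"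
    and y: "\<And>i. i \<in> I \<Longrightarrow> y i \<in> A"
    and ind: "\<And>c i. (\<And>i. i \<in> I \<Longrightarrow> c i \<in> K) \<Longrightarrow> (\<Sum>i\<in>I. c i * y i) \<in> (\<lambda>x. z * x) ` A \<Longrightarrow>
      i \<in> I \<Longrightarrow> c i = 0"
  shows "zindep z I y"
  unfolding zindep_def
proof (intro allI impI, elim conjE)
  fix l :: nat and c assume c: "\<forall>i\<in>I. \<forall>j\<le>l. c i j \<in> K"
    and s: "(\<Sum>i\<in>I. \<Sum>j\<le>l. c i j * (z ^ j * y i)) = 0"
  have zp: "z ^ j * x \<in> A" if "x \<in> A" for j x
    using that by (induction j) (auto simp: mult.assoc intro: zA)
  \<comment> \<open>Strong induction on the power of \<open>z\<close>: when all coefficients below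
    \<open>j\<close> vanish, \<open>z ^ j\<close> cancels, and the sum of the
    \<open>c i j * y i\<close> is \<open>z\<close> times an element of \<open>A\<close>.\<close>
  have "j \<le> l \<Longrightarrow> \<forall>i\<in>I. c i j = 0" for j
  proof (induction j rule: less_induct)
    case (less j)
    have split: "(\<Sum>k\<le>l. c i k * (z ^ k * y i)) =
        z ^ j * (c i j * y i + z * (\<Sum>k\<in>{j<..l}. c i k * (z ^ (k - Suc j) * y i)))"
      if i: "i \<in> I" for i
    proof -
      have "(\<Sum>k\<le>l. c i k * (z ^ k * y i)) = (\<Sum>k\<in>{j..l}. c i k * (z ^ k * y i))"
        using less i by (intro sum.mono_neutral_right) auto
      also have "{j..l} = insert j {j<..l}" using less.prems by auto
      also have "(\<Sum>k\<in>insert j {j<..l}. c i k * (z ^ k * y i)) =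
          c i j * (z ^ j * y i) + (\<Sum>k\<in>{j<..l}. c i k * (z ^ k * y i))"
        by simp
      also have "(\<Sum>k\<in>{j<..l}. c i k * (z ^ k * y i)) =
          (\<Sum>k\<in>{j<..l}. z ^ j * (z * (c i k * (z ^ (k - Suc j) * y i))))"
      proof (intro sum.cong refl)
        fix k assume "k \<in> {j<..l}"
        hence "z ^ k = z ^ (j + (Suc (k - Suc j)))" by simp
        also have "\<dots> = z ^ j * (z * z ^ (k - Suc j))" by (simp only: power_add power_Suc)
        finally show "c i k * (z ^ k * y i) = z ^ j * (z * (c i k * (z ^ (k - Suc j) * y i)))"
          by (simp only: mult_ac)
      qed
      finally show ?thesis by (simp add: sum_distrib_left algebra_simps)
    qed
    let ?r = "\<Sum>i\<in>I. \<Sum>k\<in>{j<..l}. c i k * (z ^ (k - Suc j) * y i)"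
    have "0 = (\<Sum>i\<in>I. z ^ j * (c i j * y i + z * (\<Sum>k\<in>{j<..l}. c i k * (z ^ (k - Suc j) * y i))))"
      by (subst s[symmetric]) (intro sum.cong refl split)
    also have "\<dots> = z ^ j * ((\<Sum>i\<in>I. c i j * y i) + z * ?r)"
      by (simp add: sum_distrib_left sum.distrib distrib_left)
    finally have "(\<Sum>i\<in>I. c i j * y i) = z * (- ?r)"
      using z by (simp add: eq_neg_iff_add_eq_0)
    moreover have "?r \<in> A"
      using c by (intro ksub_sum[OF A] ksub_scale[OF A] zp y) auto
    ultimately have "(\<Sum>i\<in>I. c i j * y i) \<in> (\<lambda>x. z * x) ` A"
      using ksub_minus[OF A] by blast
    thus ?case using ind[of "\<lambda>i. c i j"] c less.prems by blast
  qed
  thus "\<forall>i\<in>I. \<forall>j\<le>l. c i j = 0" by blast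
qed

section \<open>Polynomials of bounded degree in \<open>x\<close>, and the finiteness of
  \<open>[F : K(z)]\<close>\<close>

definition polyvals :: "'f \<Rightarrow> nat \<Rightarrow> 'f set" where
  "polyvals x e = {poly p x | p. (\<forall>i. coeff p i \<in> K) \<and> degree p \<le> e}"

lemma polyvals_const: "a \<in> K \<Longrightarrow> a \<in> polyvals x e"
  unfolding polyvals_def by (intro CollectI exI[of _ "[:a:]"]) (auto simp: coeff_pCons split: nat.split)

lemma polyvals_add: "a \<in> polyvals x e \<Longrightarrow> b \<in> polyvals x e \<Longrightarrow> a + b \<in> polyvals x e"
proof -
  assume "a \<in> polyvals x e" "b \<in> polyvals x e"
  then obtain p r where "a = poly p x" "b = poly r x" "\<forall>i. coeff p i \<in> K" "\<forall>i. coeff r i \<in> K"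
    "degree p \<le> e" "degree r \<le> e"
    unfolding polyvals_def by blast
  thus ?thesis unfolding polyvals_def
    by (intro CollectI exI[of _ "p + r"]) (auto intro: K_add degree_add_le)
qed

lemma polyvals_mult:
  assumes "a \<in> polyvals x d" "b \<in> polyvals x e"
  shows "a * b \<in> polyvals x (d + e)"
proof -
  obtain p r where "a = poly p x" "b = poly r x" and K: "\<forall>i. coeff p i \<in> K" "\<forall>i. coeff r i \<in> K"
    and "degree p \<le> d" "degree r \<le> e"
    using assms unfolding polyvals_def by blast
  moreover have "ksub K" by (auto simp: ksub_def intro: K_add K_mult)
  hence "coeff (p * r) i \<in> K" for i
    using K by (auto simp: coeff_mult intro!: ksub_sum K_mult)
  ultimately show ?thesis unfolding polyvals_def
    by (intro CollectI exI[of _ "p * r"]) (auto intro: order.trans[OF degree_mult_le])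
qed

lemma ksub_polyvals: "ksub (polyvals x e)"
  using polyvals_mult[OF polyvals_const[of _ x 0], of _ _ e]
  by (auto simp: ksub_def intro: polyvals_const polyvals_add)

lemma finite_polyvals: "finite (polyvals x e)" and card_polyvals_le: "card (polyvals x e) \<le> q ^ Suc e"
proof -
  have sub: "polyvals x e \<subseteq> (\<lambda>c. \<Sum>i<Suc e. c i * x ^ i) ` coefs (Suc e)"
  proof
    fix a assume "a \<in> polyvals x e"
    then obtain p where p: "a = poly p x" "\<forall>i. coeff p i \<in> K" "degree p \<le> e"
      unfolding polyvals_def by blast
    have "a = (\<Sum>i\<le>e. coeff p i * x ^ i)"
      unfolding p(1) poly_altdef using p(3)
      by (intro sum.mono_neutral_left) (auto simp: coeff_eq_0)
    also have "\<dots> = (\<Sum>i<Suc e. restrict (coeff p) {..<Suc e} i * x ^ i)"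
      by (intro sum.cong) auto
    finally show "a \<in> (\<lambda>c. \<Sum>i<Suc e. c i * x ^ i) ` coefs (Suc e)"
      by (rule image_eqI[where x = "restrict (coeff p) {..<Suc e}"]) (use p(2) in auto)
  qed
  show "finite (polyvals x e)" by (rule finite_subset[OF sub]) (intro finite_imageI finite_coefs)
  have "card (polyvals x e) \<le> card (coefs (Suc e))"
    by (rule surj_card_le[OF finite_coefs sub])
  thus "card (polyvals x e) \<le> q ^ Suc e" by (simp only: card_coefs)
qed

text \<open>Since \<open>adjoin\<close> is an intersection of subfields, it suffices that the
  quotients of polynomial values form a subfield containing \<open>K\<close> and \<open>x\<close>.
  Numerator and denominator share one degree bound, so that a single number controls both.\<close>

lemma adjoin_fraction:
  assumes "y \<in> adjoin K x"
  obtains d e where "d \<in> polyvals x e" "d \<noteq> 0" "d * y \<in> polyvals x e"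
proof -
  define E where "E = {y. \<exists>e. \<exists>d\<in>polyvals x e. d \<noteq> 0 \<and> d * y \<in> polyvals x e}"
  have E_I: "y \<in> E" if "d \<in> polyvals x e" "d \<noteq> 0" "d * y \<in> polyvals x e" for d e y
    using that unfolding E_def by blast
  have KE: "K \<subseteq> E"
    by (auto intro!: E_I[of 1 0] polyvals_const)
  have xE: "x \<in> E"
    by (rule E_I[of 1 1], rule polyvals_const, simp_all, unfold polyvals_def)
      (intro CollectI exI[of _ "[:0, 1:]"], auto simp: coeff_pCons split: nat.split)
  have "is_subfield E"
    unfolding is_subfield_def is_subring_def
  proof (intro conjI ballI)
    show "0 \<in> E" "1 \<in> E" using KE by auto
    fix y assume "y \<in> E"
    then obtain d e where y: "d \<in> polyvals x e" "d \<noteq> 0" "d * y \<in> polyvals x e"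
      unfolding E_def by blast
    show "- y \<in> E"
      using y ksub_minus[OF ksub_polyvals y(3)] by (intro E_I[of d e]) auto
    show "inverse y \<in> E"
    proof (cases "y = 0")
      case False
      thus ?thesis using y by (intro E_I[of "d * y" e]) (auto simp: mult.assoc)
    qed (use KE in auto)
    fix y' assume "y' \<in> E"
    then obtain d' e' where y': "d' \<in> polyvals x e'" "d' \<noteq> 0" "d' * y' \<in> polyvals x e'"
      unfolding E_def by blast
    have dd': "d * d' \<in> polyvals x (e + e')" "d * d' \<noteq> 0"
      using y y' by (auto intro: polyvals_mult)
    have "(d * y) * d' + d * (d' * y') \<in> polyvals x (e + e')"
      by (intro polyvals_add polyvals_mult y y')
    also have "(d * y) * d' + d * (d' * y') = d * d' * (y + y')" by (simp add: algebra_simps)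
    finally show "y + y' \<in> E" by (rule E_I[OF dd'])
    have "(d * y) * (d' * y') \<in> polyvals x (e + e')"
      by (intro polyvals_mult y y')
    also have "(d * y) * (d' * y') = d * d' * (y * y')" by (simp add: algebra_simps)
    finally show "y * y' \<in> E" by (rule E_I[OF dd'])
  qed
  hence "y \<in> E" using assms KE xE unfolding adjoin_def by blast
  thus ?thesis using that unfolding E_def by blast
qed

text \<open>Abstract in the filtration \<open>M\<close>, so that it serves both for scalars in
  \<open>K(x)\<close> and for elements of \<open>F\<close> given by their coordinates over
  \<open>K(x)\<close>.\<close>

lemma common_denominator:
  assumes Y: "finite Y"
    and M: "\<And>a b u v. u \<in> polyvals x a \<Longrightarrow> v \<in> M b \<Longrightarrow> u * v \<in> M (a + b)"
    and den: "\<And>y. y \<in> Y \<Longrightarrow> \<exists>e. \<exists>d\<in>polyvals x e. d \<noteq> 0 \<and> d * y \<in> M e"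
  shows "\<exists>e. \<exists>d\<in>polyvals x e. d \<noteq> 0 \<and> (\<forall>y\<in>Y. d * y \<in> M e)"
  using Y den
proof (induction Y)
  case empty
  show ?case by (intro exI[of _ 0] bexI[of _ 1] polyvals_const) auto
next
  case (insert y Y)
  obtain e d where d: "d \<in> polyvals x e" "d \<noteq> 0" "\<forall>y\<in>Y. d * y \<in> M e"
    using insert.IH[OF insert.prems] by auto
  obtain e' d' where d': "d' \<in> polyvals x e'" "d' \<noteq> 0" "d' * y \<in> M e'"
    using insert.prems[of y] by auto
  have "d * d' * y \<in> M (e + e')" using M[OF d(1) d'(3)] by (simp add: mult.assoc)
  moreover have "d * d' * u \<in> M (e + e')" if "u \<in> Y" for u
  proof -
    have "d' * (d * u) \<in> M (e' + e)" using d(3) that by (intro M d'(1)) auto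
    thus ?thesis by (simp only: add.commute[of e] mult.commute[of d] mult.assoc)
  qed
  ultimately have "\<forall>u\<in>insert y Y. d * d' * u \<in> M (e + e')" by blast
  moreover have "d * d' \<noteq> 0" using d d' by simp
  ultimately show ?case
    using polyvals_mult[OF d(1) d'(1)] by blast
qed

text \<open>Multiplication by \<open>z\<close> raises the degree in \<open>x\<close> of the coordinates by a bounded amount, so
  the \<open>K\<close>-span of the \<open>z ^ j * y i\<close> with \<open>j \<le> l\<close> has dimension at most linear in \<open>l\<close>, with a
  slope that does not depend on the \<open>y i\<close>.\<close>

lemma zindep_bounded:
  assumes "finite_extension_of (adjoin K x)"
  shows "\<exists>N. \<forall>n y. zindep z {..<n::nat} y \<longrightarrow> n \<le> N"
proof -
  obtain r b where b: "quotient_basis (adjoin K x) UNIV {0} r b"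
    using assms unfolding finite_extension_of_def by blast
  define B where "B e = (\<lambda>g. \<Sum>k<r. g k * b k) ` ({..<r} \<rightarrow>\<^sub>E polyvals x e)" for e
  have BI: "(\<Sum>k<r. g k * b k) \<in> B e" if "\<And>k. k < r \<Longrightarrow> g k \<in> polyvals x e" for g e
    unfolding B_def using that by (intro image_eqI[of _ _ "restrict g {..<r}"]) auto
  have BE: "\<exists>g. v = (\<Sum>k<r. g k * b k) \<and> (\<forall>k<r. g k \<in> polyvals x e)" if "v \<in> B e" for v e
    using that unfolding B_def by auto
  have B_fin: "finite (B e)" for e
    unfolding B_def by (intro finite_imageI finite_PiE finite_polyvals) auto
  have B_card: "card (B e) \<le> q ^ (r * Suc e)" for e
  proof -
    have "card (B e) \<le> card ({..<r} \<rightarrow>\<^sub>E polyvals x e)"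
      unfolding B_def by (intro card_image_le finite_PiE finite_polyvals) auto
    also have "\<dots> = card (polyvals x e) ^ r" by (simp add: card_PiE)
    also have "\<dots> \<le> (q ^ Suc e) ^ r" by (intro power_mono card_polyvals_le) auto
    also have "\<dots> = q ^ (r * Suc e)" by (simp only: power_mult[symmetric] mult.commute)
    finally show ?thesis .
  qed
  have B_mult: "u * v \<in> B (a + e)" if u: "u \<in> polyvals x a" and v: "v \<in> B e" for u v a e
  proof -
    obtain g where g: "v = (\<Sum>k<r. g k * b k)" "\<forall>k<r. g k \<in> polyvals x e" using BE[OF v] by blast
    have "u * v = (\<Sum>k<r. (u * g k) * b k)" by (simp add: g(1) sum_distrib_left mult.assoc)
    thus ?thesis using g u by (auto intro!: BI polyvals_mult)
  qed
  have B_ksub: "ksub (B e)" for e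
    unfolding ksub_def
  proof (intro conjI ballI)
    show "0 \<in> B e" using BI[of "\<lambda>_. 0" e] polyvals_const by simp
    show "c * v \<in> B e" if "c \<in> K" "v \<in> B e" for c v
      using B_mult[OF polyvals_const[of c x 0] that(2)] that by simp
    fix u v assume u: "u \<in> B e" and v: "v \<in> B e"
    obtain g where g: "u = (\<Sum>k<r. g k * b k)" "\<forall>k<r. g k \<in> polyvals x e" using BE[OF u] by blast
    obtain g' where g': "v = (\<Sum>k<r. g' k * b k)" "\<forall>k<r. g' k \<in> polyvals x e" using BE[OF v] by blast
    have "u + v = (\<Sum>k<r. (g k + g' k) * b k)"
      by (simp add: g g' sum.distrib distrib_right)
    thus "u + v \<in> B e" using g g' by (auto intro!: BI polyvals_add)
  qed
  have den: "\<exists>e. \<exists>d\<in>polyvals x e. d \<noteq> 0 \<and> d * y \<in> B e" for y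
  proof -
    obtain c where c: "\<forall>i<r. c i \<in> adjoin K x" "y = (\<Sum>i<r. c i * b i)"
      using b unfolding quotient_basis_def by (metis UNIV_I eq_iff_diff_eq_0 singletonD)
    have "\<exists>e. \<exists>d\<in>polyvals x e. d \<noteq> 0 \<and> (\<forall>y\<in>c ` {..<r}. d * y \<in> polyvals x e)"
    proof (rule common_denominator, simp, erule (1) polyvals_mult)
      fix v assume "v \<in> c ` {..<r}"
      hence "v \<in> adjoin K x" using c(1) by auto
      from adjoin_fraction[OF this] show "\<exists>e. \<exists>d\<in>polyvals x e. d \<noteq> 0 \<and> d * v \<in> polyvals x e" by metis
    qed
    then obtain e d where d: "d \<in> polyvals x e" "d \<noteq> 0" "\<forall>i<r. d * c i \<in> polyvals x e" by auto
    have "d * y = (\<Sum>i<r. (d * c i) * b i)" by (simp add: c(2) sum_distrib_left mult.assoc)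
    thus ?thesis using d by (auto intro!: exI[of _ e] bexI[of _ d] BI)
  qed
  \<comment> \<open>Clearing the denominators of the \<open>z * b k\<close> fixes, before any family
    \<open>y\<close> is given, how far multiplication by \<open>d * z\<close> raises degrees. This
    \<open>e\<close> yields the bound \<open>r * e\<close>.\<close>
  have "\<exists>e. \<exists>d\<in>polyvals x e. d \<noteq> 0 \<and> (\<forall>y\<in>(\<lambda>k. z * b k) ` {..<r}. d * y \<in> B e)"
    by (rule common_denominator, simp, erule (1) B_mult, rule den)
  then obtain e d where d: "d \<in> polyvals x e" "d \<noteq> 0" "\<And>k. k < r \<Longrightarrow> d * (z * b k) \<in> B e" by auto
  have step: "d * (z * v) \<in> B (a + e)" if v: "v \<in> B a" for v a
  proof -
    obtain g where g: "v = (\<Sum>k<r. g k * b k)" "\<forall>k<r. g k \<in> polyvals x a" using BE[OF v] by blast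
    have "d * (z * v) = (\<Sum>k<r. g k * (d * (z * b k)))"
      by (simp add: g(1) sum_distrib_left mult_ac)
    thus ?thesis using g d by (auto intro!: ksub_sum[OF B_ksub] B_mult)
  qed
  have "n \<le> r * e" if z: "zindep z {..<n} y" for n y
  proof (rule ccontr)
    assume "\<not> n \<le> r * e"
    have "\<exists>e. \<exists>d\<in>polyvals x e. d \<noteq> 0 \<and> (\<forall>y\<in>y ` {..<n}. d * y \<in> B e)"
      by (rule common_denominator, simp, erule (1) B_mult, rule den)
    then obtain e' d' where d': "d' \<in> polyvals x e'" "d' \<noteq> 0" "\<And>k. k < n \<Longrightarrow> d' * y k \<in> B e'" by auto
    \<comment> \<open>The extra \<open>i\<close> factors equalise the multipliers: for
      \<open>i = l - j\<close> every \<open>z ^ j * y k\<close> is scaled by the same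
      \<open>d ^ l * d'\<close>.\<close>
    have mem: "d ^ (i + j) * d' * (z ^ j * y k) \<in> B (e' + (i + j) * e)" if k: "k < n" for i j k
    proof (induction i)
      case 0
      show ?case
      proof (induction j)
        case 0
        show ?case using d'(3)[OF k] by simp
      next
        case (Suc j)
        from step[OF Suc] show ?case by (simp add: algebra_simps)
      qed
    next
      case (Suc i)
      from B_mult[OF d(1) Suc] show ?case by (simp add: algebra_simps)
    qed
    \<comment> \<open>With this choice \<open>r * Suc (e' + l * e)\<close> equals
      \<open>l + r * e * l\<close>, which is less than \<open>Suc (r * e) * Suc l\<close>.\<close>
    define l where "l = r * Suc e'"
    have "q ^ (card {..<n} * Suc l) \<le> card (B (e' + l * e))"
    proof (rule zindep_card_le[OF z])
      fix i j assume "i \<in> {..<n}" "j \<le> l"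
      thus "d ^ l * d' * (z ^ j * y i) \<in> B (e' + l * e)" using mem[of i "l - j" j] by simp
    qed (use d d' B_ksub B_fin in auto)
    also note B_card
    finally have "n * Suc l \<le> r * Suc (e' + l * e)" using q_ge_2 by simp
    moreover have "Suc (r * e) * Suc l \<le> n * Suc l"
      using \<open>\<not> n \<le> r * e\<close> by (intro mult_right_mono) auto
    ultimately have "Suc (r * e) * Suc l \<le> r * Suc (e' + l * e)" by (rule order.trans[rotated])
    thus False unfolding l_def by (simp add: algebra_simps)
  qed
  thus ?thesis by blast
qed

text \<open>The degree \<open>[F : K(z)]\<close> for transcendental \<open>z\<close>; 0 for algebraic \<open>z\<close>.\<close>

definition zdim :: "'f \<Rightarrow> nat" where
  "zdim z = (GREATEST n. \<exists>y. zindep z {..<n::nat} y)"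

end

locale function_field = finite_constants K for K :: "'f::field set" +
  assumes ff: "function_field_over K" and full: "full_constant_field K"
begin

lemma zdim_exists: "\<exists>y. zindep z {..<zdim z} y"
  and zindep_le_zdim_nat: "zindep z {..<n::nat} y' \<Longrightarrow> n \<le> zdim z"
proof -
  obtain x where "finite_extension_of (adjoin K x)" using ff unfolding function_field_over_def by blast
  from zindep_bounded[OF this, of z] obtain N
    where "\<forall>n y. zindep z {..<n::nat} y \<longrightarrow> n \<le> N" by blast
  hence N: "\<And>n. \<exists>y. zindep z {..<n::nat} y \<Longrightarrow> n \<le> N" by blast
  have 0: "\<exists>y. zindep z {..<0::nat} y" by (auto simp: zindep_def)
  show "\<exists>y. zindep z {..<zdim z} y"
    unfolding zdim_def using GreatestI_nat[of "\<lambda>n. \<exists>y. zindep z {..<n::nat} y", OF 0 N] by blast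
  show "n \<le> zdim z" if "zindep z {..<n} y'"
    unfolding zdim_def using Greatest_le_nat[of "\<lambda>n. \<exists>y. zindep z {..<n::nat} y" n N] that N by blast
qed

lemma zindep_le_zdim:
  assumes "finite I" "zindep z I y"
  shows "card I \<le> zdim z"
proof -
  obtain h where h: "bij_betw h {..<card I} I"
    using ex_bij_betw_nat_finite[OF assms(1)] by (auto simp: lessThan_atLeast0)
  have "zindep z {..<card I} (y \<circ> h)"
    using assms h by (intro zindep_reindex) (auto simp: bij_betw_def)
  thus ?thesis by (rule zindep_le_zdim_nat)
qed

lemma algebraic_iff: "algebraic_over K x \<longleftrightarrow> x \<in> K"
  using full unfolding full_constant_field_def by blast

text \<open>As \<open>K\<close> is the full constant field, a nonconstant \<open>z\<close> is
  transcendental.\<close>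

lemma zindep_one:
  assumes "z \<notin> K"
  shows "zindep z {..<Suc 0} (\<lambda>_. 1)"
  unfolding zindep_def
proof (intro allI impI, elim conjE)
  fix l :: nat and c :: "nat \<Rightarrow> nat \<Rightarrow> 'f"
  assume c: "\<forall>i\<in>{..<Suc 0}. \<forall>j\<le>l. c i j \<in> K"
    and s: "(\<Sum>i<Suc 0. \<Sum>j\<le>l. c i j * (z ^ j * 1)) = 0"
  define p where "p = (\<Sum>j\<le>l. monom (c 0 j) j)"
  have cp: "coeff p j = (if j \<le> l then c 0 j else 0)" for j
    by (simp add: p_def coeff_sum)
  have "poly p z = 0" using s by (simp add: p_def poly_sum poly_monom)
  moreover have "\<forall>j. coeff p j \<in> K" using c by (auto simp: cp)
  moreover have "\<not> algebraic_over K z" using assms algebraic_iff by blast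
  ultimately have "p = 0" unfolding algebraic_over_def by blast
  hence "c 0 j = 0" if "j \<le> l" for j using cp[of j] that by simp
  thus "\<forall>i\<in>{..<Suc 0}. \<forall>j\<le>l. c i j = 0" by simp
qed

lemma zdim_pos: "z \<notin> K \<Longrightarrow> zdim z > 0"
  using zindep_le_zdim_nat[OF zindep_one] by fastforce

lemma exists_nonconstant: "\<exists>z. z \<notin> K"
  using ff algebraic_iff unfolding function_field_over_def by blast

end

section \<open>Valuation rings\<close>

lemma subring_0: "is_subring R \<Longrightarrow> 0 \<in> R"
  and subring_1: "is_subring R \<Longrightarrow> 1 \<in> R"
  and subring_add: "is_subring R \<Longrightarrow> x \<in> R \<Longrightarrow> y \<in> R \<Longrightarrow> x + y \<in> R"
  and subring_mult: "is_subring R \<Longrightarrow> x \<in> R \<Longrightarrow> y \<in> R \<Longrightarrow> x * y \<in> R"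
  and subring_minus: "is_subring R \<Longrightarrow> x \<in> R \<Longrightarrow> - x \<in> R"
  by (simp_all add: is_subring_def)

lemma subring_diff: "is_subring R \<Longrightarrow> x \<in> R \<Longrightarrow> y \<in> R \<Longrightarrow> x - y \<in> R"
  using subring_add[of R x "- y"] subring_minus[of R y] by simp

lemma subring_sum: "is_subring R \<Longrightarrow> (\<And>i. i \<in> I \<Longrightarrow> g i \<in> R) \<Longrightarrow> sum g I \<in> R"
  by (induction I rule: infinite_finite_induct) (auto simp: subring_0 subring_add)

lemma subring_power: "is_subring R \<Longrightarrow> x \<in> R \<Longrightarrow> x ^ n \<in> R"
  by (induction n) (auto simp: subring_1 subring_mult)

lemma generated_ideal_add:
  assumes "is_subring R" "a \<in> generated_ideal R m f" "b \<in> generated_ideal R m f"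
  shows "a + b \<in> generated_ideal R m f"
proof -
  obtain g h where "a = (\<Sum>i<m. g i * f i)" "b = (\<Sum>i<m. h i * f i)"
    "\<forall>i<m. g i \<in> R" "\<forall>i<m. h i \<in> R"
    using assms unfolding generated_ideal_def by blast
  thus ?thesis unfolding generated_ideal_def
    by (intro CollectI exI[of _ "\<lambda>i. g i + h i"])
      (auto simp: sum.distrib distrib_right subring_add[OF assms(1)])
qed

lemma generated_ideal_mult:
  assumes "is_subring R" "c \<in> R" "b \<in> generated_ideal R m f"
  shows "c * b \<in> generated_ideal R m f"
proof -
  obtain h where "b = (\<Sum>i<m. h i * f i)" "\<forall>i<m. h i \<in> R"
    using assms unfolding generated_ideal_def by blast
  thus ?thesis unfolding generated_ideal_def
    by (intro CollectI exI[of _ "\<lambda>i. c * h i"])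
      (auto simp: sum_distrib_left mult.assoc subring_mult[OF assms(1,2)])
qed

lemma generated_ideal_subset:
  assumes "is_subring R" "\<And>i. i < m \<Longrightarrow> f i \<in> R"
  shows "generated_ideal R m f \<subseteq> R"
  using assms unfolding generated_ideal_def by (auto intro!: subring_sum subring_mult)

lemma generated_ideal_generator:
  assumes "is_subring R" "k < m"
  shows "f k \<in> generated_ideal R m f"
  unfolding generated_ideal_def
  by (intro CollectI exI[of _ "\<lambda>i. if i = k then 1 else 0"])
    (use assms in \<open>auto simp: subring_0 subring_1 if_distrib[of "\<lambda>x. x * _"] cong: if_cong\<close>)

lemma generated_ideal_0:
  assumes "is_subring R" shows "0 \<in> generated_ideal R m f"
  unfolding generated_ideal_def
  by (intro CollectI exI[of _ "\<lambda>_. 0"]) (auto simp: subring_0[OF assms])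

lemma generated_ideal_sum:
  assumes "is_subring R" "\<And>i. i \<in> I \<Longrightarrow> g i \<in> generated_ideal R m f"
  shows "sum g I \<in> generated_ideal R m f"
  using assms(2)
  by (induction I rule: infinite_finite_induct)
    (auto simp: generated_ideal_0[OF assms(1)] generated_ideal_add[OF assms(1)])

section \<open>Extension of a subring to a valuation ring\<close>

lemma subring_adjoin:
  assumes R: "is_subring R"
  shows "is_subring {poly p y | p. \<forall>i. coeff p i \<in> R}" (is "is_subring ?A")
    and "R \<subseteq> {poly p y | p. \<forall>i. coeff p i \<in> R}"
    and "y \<in> {poly p y | p. \<forall>i. coeff p i \<in> R}"
proof -
  show sub: "R \<subseteq> ?A"
  proof
    fix a assume "a \<in> R"
    thus "a \<in> ?A" using subring_0[OF R]
      by (intro CollectI exI[of _ "[:a:]"]) (auto simp: coeff_pCons split: nat.split)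
  qed
  show "y \<in> ?A" using subring_0[OF R] subring_1[OF R]
    by (intro CollectI exI[of _ "[:0, 1:]"]) (auto simp: coeff_pCons split: nat.split)
  show "is_subring ?A"
    unfolding is_subring_def
  proof (intro conjI ballI)
    show "0 \<in> ?A" "1 \<in> ?A" using sub subring_0[OF R] subring_1[OF R] by blast+
    fix a assume "a \<in> ?A"
    then obtain p where p: "a = poly p y" "\<forall>i. coeff p i \<in> R" by blast
    show "- a \<in> ?A" using p subring_minus[OF R] by (intro CollectI exI[of _ "- p"]) auto
    fix b assume "b \<in> ?A"
    then obtain r where r: "b = poly r y" "\<forall>i. coeff r i \<in> R" by blast
    show "a + b \<in> ?A" using p r subring_add[OF R] by (intro CollectI exI[of _ "p + r"]) auto
    show "a * b \<in> ?A" using p r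
      by (intro CollectI exI[of _ "p * r"])
        (auto simp: coeff_mult intro!: subring_sum[OF R] subring_mult[OF R])
  qed
qed

text \<open>Zorn's lemma applies because an expression of 1 by the \<open>f i\<close> has finitely
  many coefficients, which in the union of a chain already lie in one member.\<close>

lemma maximal_subring_avoiding:
  assumes R0: "is_subring R0" and f: "1 \<notin> generated_ideal R0 m f"
  obtains R where "is_subring R" "R0 \<subseteq> R" "1 \<notin> generated_ideal R m f"
    "\<And>R'. is_subring R' \<Longrightarrow> R \<subseteq> R' \<Longrightarrow> 1 \<notin> generated_ideal R' m f \<Longrightarrow> R' = R"
proof -
  define A where "A = {R. is_subring R \<and> R0 \<subseteq> R \<and> 1 \<notin> generated_ideal R m f}"
  have "\<exists>M\<in>A. \<forall>X\<in>A. M \<subseteq> X \<longrightarrow> X = M"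
  proof (rule subset_Zorn_nonempty)
    show "A \<noteq> {}" using R0 f unfolding A_def by blast
    fix C assume C: "C \<noteq> {}" "subset.chain A C"
    have CA: "C \<subseteq> A" using C unfolding subset.chain_def by blast
    have dir: "\<exists>R\<in>C. X \<subseteq> R" if "finite X" "X \<subseteq> \<Union>C" for X
      using finite_subset_Union_chain[OF that C] by blast
    have "1 \<notin> generated_ideal (\<Union>C) m f"
    proof
      assume "1 \<in> generated_ideal (\<Union>C) m f"
      then obtain h where h: "1 = (\<Sum>i<m. h i * f i)" "\<forall>i<m. h i \<in> \<Union>C"
        unfolding generated_ideal_def by blast
      have "\<exists>R\<in>C. h ` {..<m} \<subseteq> R" by (rule dir) (use h(2) in auto)
      then obtain R where "R \<in> C" "h ` {..<m} \<subseteq> R" by blast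
      moreover from this have "1 \<in> generated_ideal R m f"
        unfolding generated_ideal_def using h(1) by blast
      ultimately show False using CA unfolding A_def by blast
    qed
    moreover have "is_subring (\<Union>C)"
      unfolding is_subring_def
    proof (intro conjI ballI)
      have sr: "is_subring R" if "R \<in> C" for R using CA that unfolding A_def by blast
      show "0 \<in> \<Union>C" "1 \<in> \<Union>C" using C(1) sr subring_0 subring_1 by blast+
      fix x assume x: "x \<in> \<Union>C"
      show "- x \<in> \<Union>C" using x sr subring_minus by blast
      fix y assume y: "y \<in> \<Union>C"
      obtain R where "R \<in> C" "{x, y} \<subseteq> R" using dir[of "{x, y}"] x y by auto
      thus "x + y \<in> \<Union>C" "x * y \<in> \<Union>C"
        using sr subring_add[of R x y] subring_mult[of R x y] by auto
    qed
    moreover have "R0 \<subseteq> \<Union>C" using C(1) CA unfolding A_def by blast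
    ultimately show "\<Union>C \<in> A" unfolding A_def by blast
  qed
  then obtain R where R: "R \<in> A" "\<forall>X\<in>A. R \<subseteq> X \<longrightarrow> X = R" by blast
  show ?thesis
    by (rule that[of R]) (use R in \<open>auto simp: A_def\<close>)
qed

text \<open>Chevalley's extension theorem: a subring that is maximal among those in which the \<open>f i\<close> do not
  generate the unit ideal is a valuation ring.\<close>

lemma valuation_ring_extension:
  assumes R0: "is_subring R0" and f: "1 \<notin> generated_ideal R0 m f"
    and f_R0: "\<And>i. i < m \<Longrightarrow> f i \<in> R0"
  obtains R where "is_subring R" "R0 \<subseteq> R" "1 \<notin> generated_ideal R m f"
    "\<And>z. z \<in> R \<or> inverse z \<in> R"
proof -
  obtain R where R: "is_subring R" "R0 \<subseteq> R" and J1: "1 \<notin> generated_ideal R m f"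
    and max: "\<And>R'. is_subring R' \<Longrightarrow> R \<subseteq> R' \<Longrightarrow> 1 \<notin> generated_ideal R' m f \<Longrightarrow> R' = R"
    using maximal_subring_avoiding[OF R0 f] by metis
  define J where "J = generated_ideal R m f"
  note J_add = generated_ideal_add[OF R(1), of _ m f, folded J_def]
  note J_mult = generated_ideal_mult[OF R(1), of _ _ m f, folded J_def]
  note J_sum = generated_ideal_sum[OF R(1), of _ _ m f, folded J_def]
  have J_minus: "- a \<in> J" if "a \<in> J" for a
    using J_mult[of "-1" a] that subring_minus[OF R(1) subring_1[OF R(1)]] by simp
  have JR: "J \<subseteq> R"
    unfolding J_def using generated_ideal_subset[OF R(1), of m f] f_R0 R(2) by blast
  have J1: "1 \<notin> J" using J1 by (simp add: J_def)
  \<comment> \<open>By maximality the \<open>f i\<close> generate the unit ideal of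
    \<open>R[y]\<close>; collecting powers of \<open>y\<close> gives a polynomial with coefficients
    in \<open>J\<close>.\<close>
  have adj: "\<exists>p. (\<forall>i. coeff p i \<in> J) \<and> poly p y = 1" if y: "y \<notin> R" for y
  proof -
    let ?A = "{poly p y | p. \<forall>i. coeff p i \<in> R}"
    have "1 \<in> generated_ideal ?A m f"
      using max[OF subring_adjoin(1,2)[OF R(1)]] subring_adjoin(3)[OF R(1), of y] y by blast
    then obtain h where h: "1 = (\<Sum>i<m. h i * f i)" "\<forall>i<m. h i \<in> ?A"
      unfolding generated_ideal_def by blast
    from h(2) have "\<forall>i<m. \<exists>p. h i = poly p y \<and> (\<forall>j. coeff p j \<in> R)" by blast
    then obtain p where p: "\<And>i. i < m \<Longrightarrow> h i = poly (p i) y" "\<And>i j. i < m \<Longrightarrow> coeff (p i) j \<in> R"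
      by metis
    have "poly (\<Sum>i<m. smult (f i) (p i)) y = 1"
      unfolding h(1) poly_sum using p(1) by (intro sum.cong) (auto simp: mult.commute)
    moreover have "coeff (\<Sum>i<m. smult (f i) (p i)) j \<in> J" for j
      unfolding coeff_sum
    proof (intro J_sum)
      fix i assume "i \<in> {..<m}"
      hence "coeff (p i) j * f i \<in> J"
        using p(2) generated_ideal_generator[OF R(1), of i m f] unfolding J_def[symmetric]
        by (intro J_mult) auto
      thus "coeff (smult (f i) (p i)) j \<in> J" by (simp add: mult.commute)
    qed
    ultimately show ?thesis by blast
  qed
  \<comment> \<open>Otherwise the relation for \<open>inverse (1 - b)\<close>, multiplied by a power
    of \<open>1 - b\<close>, puts that power into \<open>J\<close>, although it is congruent to 1
    modulo \<open>J\<close>.\<close>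
  have unit: "inverse (1 - b) \<in> R" if b: "b \<in> J" for b
  proof (rule ccontr)
    have b': "1 - b \<in> R" using b JR subring_diff[OF R(1) subring_1[OF R(1)]] by blast
    assume "inverse (1 - b) \<notin> R"
    from adj[OF this] obtain p where p: "\<forall>i. coeff p i \<in> J" "poly p (inverse (1 - b)) = 1" by blast
    let ?n = "degree p"
    have b1: "1 - b \<noteq> 0" using b J1 by auto
    have "(1 - b) ^ ?n = (1 - b) ^ ?n * poly p (inverse (1 - b))" using p by simp
    also have "\<dots> = (\<Sum>i\<le>?n. (1 - b) ^ (?n - i) * coeff p i)"
      unfolding poly_altdef sum_distrib_left
      by (intro sum.cong refl) (use b1 in \<open>simp add: power_diff field_simps power_inverse\<close>)
    also have "\<dots> \<in> J"
      using p by (intro J_sum J_mult subring_power[OF R(1)] b') auto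
    finally have 1: "(1 - b) ^ ?n \<in> J" .
    have 2: "1 - (1 - b) ^ n \<in> J" for n
    proof (induction n)
      case 0 show ?case using generated_ideal_0[OF R(1)] by (simp add: J_def)
    next
      case (Suc n)
      have "(1 - (1 - b) ^ n) + (1 - b) ^ n * b \<in> J"
        by (intro J_add Suc J_mult subring_power[OF R(1)] b b')
      thus ?case by (simp add: algebra_simps)
    qed
    from J_add[OF 1 2[of ?n]] J1 show False by simp
  qed
  \<comment> \<open>Since \<open>1 - coeff r 0\<close> is invertible in \<open>R\<close>, the
    relation for \<open>inverse y\<close> writes 1 as a combination of negative powers of
    \<open>y\<close>. Multiplying the leading term of \<open>p\<close> by this combination lowers
    its degree.\<close>
  have reduce: "\<exists>p'. (\<forall>i. coeff p' i \<in> J) \<and> poly p' y = 1 \<and> degree p' < degree p"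
    if p: "\<forall>i. coeff p i \<in> J" "poly p y = 1"
      and r: "\<forall>i. coeff r i \<in> J" "poly r (inverse y) = 1"
      and le: "degree r \<le> degree p" and y: "y \<noteq> 0" for p r y
  proof -
    let ?n = "degree p" and ?l = "degree r"
    have n: "?n > 0"
    proof (rule ccontr)
      assume "\<not> ?n > 0"
      hence "poly p y = coeff p 0" by (simp add: poly_altdef)
      thus False using p J1 by metis
    qed
    define u where "u = inverse (1 - coeff r 0)"
    have u: "u \<in> R" unfolding u_def using r by (intro unit) auto
    have u1: "u * (1 - coeff r 0) = 1"
    proof -
      have "coeff r 0 \<noteq> 1" using r J1 by metis
      thus ?thesis by (simp add: u_def)
    qed
    have "1 = coeff r 0 + (\<Sum>j\<in>{0<..?l}. coeff r j * inverse y ^ j)"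
    proof -
      have "1 = (\<Sum>j\<le>?l. coeff r j * inverse y ^ j)" using r(2) by (simp add: poly_altdef)
      also have "{..?l} = insert 0 {0<..?l}" by auto
      finally show ?thesis by simp
    qed
    hence "1 - coeff r 0 = (\<Sum>j\<in>{0<..?l}. coeff r j * inverse y ^ j)"
      by (metis add_diff_cancel_left')
    hence "u * (1 - coeff r 0) = u * (\<Sum>j\<in>{0<..?l}. coeff r j * inverse y ^ j)"
      by (rule arg_cong)
    hence one: "1 = u * (\<Sum>j\<in>{0<..?l}. coeff r j * inverse y ^ j)" by (simp only: u1)
    define p' where "p' = p - monom (coeff p ?n) ?n
        + (\<Sum>j\<in>{0<..?l}. monom (u * coeff p ?n * coeff r j) (?n - j))"
    have "poly p' y = poly p y - coeff p ?n * y ^ ?n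
        + (\<Sum>j\<in>{0<..?l}. u * coeff p ?n * coeff r j * y ^ (?n - j))"
      by (simp add: p'_def poly_sum poly_monom)
    also have "(\<Sum>j\<in>{0<..?l}. u * coeff p ?n * coeff r j * y ^ (?n - j)) =
        coeff p ?n * y ^ ?n * (u * (\<Sum>j\<in>{0<..?l}. coeff r j * inverse y ^ j))"
      unfolding sum_distrib_left
      by (intro sum.cong refl) (use y le in \<open>simp add: power_diff field_simps power_inverse\<close>)
    also have "\<dots> = coeff p ?n * y ^ ?n" by (simp only: one[symmetric] mult_1_right)
    finally have py: "poly p' y = 1" using p(2) by simp
    have coeff_p': "coeff p' i = (if i = ?n then 0 else coeff p i) +
        (\<Sum>j\<in>{0<..?l}. if ?n - j = i then u * coeff p ?n * coeff r j else 0)" for i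
      by (simp add: p'_def coeff_sum)
    have J0: "0 \<in> J" using generated_ideal_0[OF R(1)] by (simp add: J_def)
    have "coeff p' i \<in> J" for i
      unfolding coeff_p' using p r u J0
      by (intro J_add J_sum) (auto intro!: J_mult subring_mult[OF R(1)] subsetD[OF JR])
    moreover have "coeff p' i = 0" if "i \<ge> ?n" for i
      unfolding coeff_p' using that n by (auto intro!: sum.neutral simp: coeff_eq_0)
    hence "degree p' < ?n" using n by (intro degree_lessI) auto
    ultimately show ?thesis using py by blast
  qed
  \<comment> \<open>Infinite descent on the sum of the degrees; exchanging \<open>y\<close> and
    \<open>inverse y\<close> covers the case in which \<open>r\<close> has the larger
    degree.\<close>
  have no_pair: False
    if "\<forall>i. coeff p i \<in> J" "poly p y = 1" "\<forall>i. coeff r i \<in> J" "poly r (inverse y) = 1" "y \<noteq> 0"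
    for p r y
    using that
  proof (induction "degree p + degree r" arbitrary: p r y rule: less_induct)
    case less
    show False
    proof (cases "degree r \<le> degree p")
      case True
      then obtain p' where "\<forall>i. coeff p' i \<in> J" "poly p' y = 1" "degree p' < degree p"
        using reduce[of p y r] less.prems by blast
      thus False using less.hyps[of p' r y] less.prems by simp
    next
      case False
      then obtain r' where "\<forall>i. coeff r' i \<in> J" "poly r' (inverse y) = 1" "degree r' < degree r"
        using reduce[of r "inverse y" p] less.prems by auto
      thus False using less.hyps[of p r' y] less.prems by simp
    qed
  qed
  have "y \<in> R \<or> inverse y \<in> R" for y
    using adj[of y] adj[of "inverse y"] no_pair subring_0[OF R(1)] by (cases "y = 0") blast+
  thus ?thesis using that R J1 unfolding J_def by blast
qed

section \<open>Places and valuations\<close>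

context function_field
begin

text \<open>The ring can be recovered from the place: a nonzero \<open>x\<close> lies in the ring
  iff \<open>inverse x\<close> is not in the place. Hence the \<open>THE\<close> in
  \<open>place_ring\<close> is well defined.\<close>

lemma place_ring_eq:
  assumes "valuation_ring K R"
  shows "place_ring K (R - units_in R) = R"
  unfolding place_ring_def
proof (rule the_equality)
  fix R' assume R': "valuation_ring K R' \<and> R - units_in R = R' - units_in R'"
  have char: "X = {x. x = 0 \<or> inverse x \<notin> X - units_in X}" if "valuation_ring K X" for X
  proof -
    have "0 \<in> X" "\<And>x. x \<in> X \<or> inverse x \<in> X"
      using that unfolding valuation_ring_def is_subring_def by blast+
    thus ?thesis unfolding units_in_def by auto
  qed
  show "R' = R" using char[of R] char[of R'] R' assms by simp
qed (use assms in simp)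

lemma place_ring_valuation:
  assumes "P \<in> places K"
  shows "valuation_ring K (place_ring K P)" "P = place_ring K P - units_in (place_ring K P)"
  using assms place_ring_eq unfolding places_def by auto

abbreviation VR :: "'f set \<Rightarrow> 'f set" where "VR P \<equiv> place_ring K P"

context
  fixes P assumes P: "P \<in> places K"
begin

lemma VR_subring: "is_subring (VR P)"
  and K_subset_VR: "K \<subseteq> VR P"
  and VR_total: "z \<in> VR P \<or> inverse z \<in> VR P"
  and VR_not_UNIV: "VR P \<noteq> UNIV"
  using place_ring_valuation(1)[OF P] unfolding valuation_ring_def by auto

lemma place_subset_VR: "P \<subseteq> VR P" and zero_in_place: "0 \<in> P"
  and one_notin_place: "1 \<notin> P"
proof -
  have "x \<in> P \<longleftrightarrow> x \<in> VR P \<and> (x = 0 \<or> inverse x \<notin> VR P)" for x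
    using place_ring_valuation(2)[OF P] unfolding units_in_def by blast
  thus "P \<subseteq> VR P" "0 \<in> P" "1 \<notin> P"
    using subring_0[OF VR_subring] subring_1[OF VR_subring] by auto
qed

lemma in_place_iff: "x \<noteq> 0 \<Longrightarrow> x \<in> P \<longleftrightarrow> inverse x \<notin> VR P"
  using place_ring_valuation(2)[OF P] VR_total[of x] unfolding units_in_def by blast

lemma in_units_iff: "u \<in> units_in (VR P) \<longleftrightarrow> u \<in> VR P \<and> u \<notin> P"
  using place_ring_valuation(2)[OF P] unfolding units_in_def by blast

lemma place_mult:
  assumes "a \<in> VR P" "x \<in> P"
  shows "a * x \<in> P"
proof (cases "a * x = 0")
  case False
  hence nz: "a \<noteq> 0" "x \<noteq> 0" by auto
  have "inverse (a * x) \<notin> VR P"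
  proof
    assume "inverse (a * x) \<in> VR P"
    hence "a * inverse (a * x) \<in> VR P" by (rule subring_mult[OF VR_subring assms(1)])
    moreover have "a * inverse (a * x) = inverse x" using nz by (simp add: field_simps)
    ultimately show False using assms(2) in_place_iff[OF nz(2)] by metis
  qed
  thus ?thesis using in_place_iff[of "a * x"] False by simp
qed (auto simp: zero_in_place)

text \<open>Of two nonzero elements one divides the other in the valuation ring, so the sum is a
  multiple of one of them.\<close>

lemma place_add:
  assumes "x \<in> P" "y \<in> P"
  shows "x + y \<in> P"
proof -
  have *: "x + y \<in> P" if "x \<in> P" "y \<in> P" "y \<noteq> 0" "x / y \<in> VR P" for x y
  proof -
    have "(x / y + 1) * y \<in> P"
      using that by (intro place_mult subring_add[OF VR_subring] subring_1[OF VR_subring])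
    thus ?thesis using that by (simp add: distrib_right)
  qed
  show ?thesis
  proof (cases "x = 0 \<or> y = 0")
    case False
    thus ?thesis using *[of x y] *[of y x] VR_total[of "x / y"] assms
      by (auto simp: add.commute)
  qed (use assms in auto)
qed

lemma place_minus: "x \<in> P \<Longrightarrow> - x \<in> P"
  using place_mult[OF subring_minus[OF VR_subring subring_1[OF VR_subring]]] by fastforce

lemma place_diff: "x \<in> P \<Longrightarrow> y \<in> P \<Longrightarrow> x - y \<in> P"
  using place_add[of x "- y"] place_minus by simp

lemma place_prime:
  assumes "x \<in> VR P" "y \<in> VR P" "x * y \<in> P"
  shows "x \<in> P \<or> y \<in> P"
proof (rule ccontr)
  assume n: "\<not> ?thesis"
  hence nz: "x \<noteq> 0" "y \<noteq> 0" using zero_in_place by auto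
  hence "inverse x \<in> VR P" "inverse y \<in> VR P" using n in_place_iff by auto
  hence "inverse x * inverse y * (x * y) \<in> P"
    by (intro place_mult subring_mult[OF VR_subring] assms)
  thus False using nz one_notin_place by (simp add: field_simps)
qed

section \<open>Discreteness of the valuation at a place\<close>

lemma ksub_VR: "ksub (VR P)" and ksub_place: "ksub P"
  unfolding ksub_def using VR_subring K_subset_VR place_add place_mult zero_in_place
  by (auto simp: is_subring_def)

lemma VR_indep_le_zdim:
  assumes "z \<in> VR P" "z \<noteq> 0" "\<And>i. i < n \<Longrightarrow> b i \<in> VR P" "indep_mod ((\<lambda>x. z * x) ` VR P) n b"
  shows "n \<le> zdim z"
proof (rule zindep_le_zdim_nat, rule zindep_if_indep_mod_scaled[of _ z _ b, OF ksub_VR assms(2)])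
  show "z * x \<in> VR P" if "x \<in> VR P" for x using subring_mult[OF VR_subring assms(1) that] .
qed (use assms indep_modD[OF assms(4)] in auto)

lemma VR_quotient_basis_scaled:
  assumes "z \<in> VR P" "z \<noteq> 0"
  shows "\<exists>n b. n \<le> zdim z \<and> quotient_basis K (VR P) ((\<lambda>x. z * x) ` VR P) n b"
  by (rule quotient_basis_exists[OF ksub_VR ksub_scaled[OF ksub_VR]])
    (use VR_indep_le_zdim[OF assms] in blast)

lemma place_nontrivial: "\<exists>x\<in>P. x \<noteq> 0"
proof -
  obtain y where "y \<notin> VR P" using VR_not_UNIV by blast
  moreover from this have "y \<noteq> 0" using subring_0[OF VR_subring] by auto
  ultimately have "inverse y \<in> P" "inverse y \<noteq> 0" using in_place_iff[of "inverse y"] by auto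
  thus ?thesis by blast
qed

text \<open>The generator is a nonzero \<open>t \<in> P\<close> for which \<open>VR P\<close> modulo
  \<open>t\<close> has least dimension. If some \<open>y \<in> P\<close> were not a multiple of
  \<open>t\<close>, then \<open>t\<close> would be a multiple of \<open>y\<close>, and a basis of
  \<open>VR P\<close> modulo \<open>y\<close>, enlarged by \<open>y\<close> itself, would be
  independent modulo \<open>t\<close>; so \<open>y\<close> would give a smaller dimension.\<close>

lemma uniformizer_exists: "\<exists>t. t \<noteq> 0 \<and> P = (\<lambda>x. t * x) ` VR P"
proof -
  let ?d = "\<lambda>z. quotient_dim K (VR P) ((\<lambda>x. z * x) ` VR P)"
  obtain t where t: "t \<in> P" "t \<noteq> 0" and min: "\<And>y. y \<in> P \<Longrightarrow> y \<noteq> 0 \<Longrightarrow> ?d t \<le> ?d y"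
    using ex_has_least_nat[of "\<lambda>z. z \<in> P \<and> z \<noteq> 0" _ ?d] place_nontrivial by blast
  have "y \<in> (\<lambda>x. t * x) ` VR P" if y: "y \<in> P" for y
  proof (rule ccontr)
    assume yT: "y \<notin> (\<lambda>x. t * x) ` VR P"
    let ?T = "(\<lambda>x. t * x) ` VR P" and ?Y = "(\<lambda>x. y * x) ` VR P"
    have y0: "y \<noteq> 0" using yT subring_0[OF VR_subring] by (auto simp: image_iff)
    have "y / t \<notin> VR P" using yT t by (auto simp: image_iff)
    hence ty: "t / y \<in> VR P" using VR_total[of "y / t"] by simp
    have sub: "?T \<subseteq> ?Y"
    proof clarify
      fix a assume a: "a \<in> VR P"
      have "t * a = y * (t / y * a)" using y0 by simp
      thus "t * a \<in> ?Y" using subring_mult[OF VR_subring ty a] by blast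
    qed
    have VRm: "t \<in> VR P" "y \<in> VR P" using t y place_subset_VR by auto
    obtain n b where b: "quotient_basis K (VR P) ?Y n b"
      using VR_quotient_basis_scaled[OF VRm(2) y0] by blast
    obtain n' b' where b': "quotient_basis K (VR P) ?T n' b'"
      using VR_quotient_basis_scaled[OF VRm(1) t(2)] by blast
    have "Suc n \<le> n'"
    proof (rule quotient_basis_le[OF _ _ _ ksub_VR b'])
      show "indep_mod ?T (Suc n) (b(n := y))"
        unfolding indep_mod_def
      proof (intro allI impI, elim conjE)
        fix c i assume c: "\<forall>i<Suc n. c i \<in> K"
          and s: "(\<Sum>i<Suc n. c i * (b(n := y)) i) \<in> ?T" and i: "i < Suc n"
        have s': "(\<Sum>i<n. c i * b i) + c n * y \<in> ?T" using s by simp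
        have "c n \<in> VR P" using c K_subset_VR by auto
        hence "c n * y \<in> ?Y" by (auto simp: mult.commute)
        from ksub_diff[OF ksub_scaled[OF ksub_VR] subsetD[OF sub s'] this]
        have "(\<Sum>i<n. c i * b i) \<in> ?Y" by simp
        hence c0: "c i = 0" if "i < n" for i
          using b c that indep_modD[of ?Y n b c i] by (auto simp: quotient_basis_iff)
        hence cy: "c n * y \<in> ?T" using s' by simp
        have "c n = 0"
        proof (rule ccontr)
          assume "c n \<noteq> 0"
          moreover have "inverse (c n) * (c n * y) \<in> ?T"
            using c by (intro ksub_scale[OF ksub_scaled[OF ksub_VR] _ cy] K_inverse) auto
          moreover have "inverse (c n) * (c n * y) = y" using \<open>c n \<noteq> 0\<close> by simp
          ultimately show False using yT by metis
        qed
        thus "c i = 0" using c0 i by (cases "i = n") auto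
      qed
      show "(b(n := y)) i \<in> VR P" if "i < Suc n" for i
        using b VRm that by (auto simp: quotient_basis_iff less_Suc_eq)
    qed (rule ksub_scaled[OF ksub_VR])
    moreover have "?d y = n" "?d t = n'"
      using quotient_dim_eq[OF ksub_VR ksub_scaled[OF ksub_VR] b]
        quotient_dim_eq[OF ksub_VR ksub_scaled[OF ksub_VR] b'] by auto
    ultimately show False using min[OF y y0] by simp
  qed
  moreover have "t * x \<in> P" if "x \<in> VR P" for x using place_mult[OF that t(1)] by (simp add: mult.commute)
  ultimately have "P = (\<lambda>x. t * x) ` VR P" by blast
  thus ?thesis using t by blast
qed

definition unif :: "'f" where "unif = (SOME t. t \<noteq> 0 \<and> P = (\<lambda>x. t * x) ` VR P)"

lemma unif_nz: "unif \<noteq> 0" and unif_eq: "P = (\<lambda>x. unif * x) ` VR P"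
  using someI_ex[OF uniformizer_exists] unfolding unif_def by auto

lemma unif_in: "unif \<in> P"
  by (subst unif_eq) (use subring_1[OF VR_subring] in \<open>auto simp: image_iff\<close>)

lemma units_1: "1 \<in> units_in (VR P)"
  and units_mult: "u \<in> units_in (VR P) \<Longrightarrow> v \<in> units_in (VR P) \<Longrightarrow> u * v \<in> units_in (VR P)"
  and units_inverse: "u \<in> units_in (VR P) \<Longrightarrow> inverse u \<in> units_in (VR P)"
  using VR_subring by (auto simp: units_in_def is_subring_def)

lemma units_powi: "u \<in> units_in (VR P) \<Longrightarrow> u powi n \<in> units_in (VR P)"
proof -
  assume u: "u \<in> units_in (VR P)"
  have "u ^ k \<in> units_in (VR P)" for k
    using u by (induction k) (auto intro: units_1 units_mult)
  thus ?thesis using units_inverse by (auto simp: power_int_def power_inverse)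
qed

lemma residue_basis: "\<exists>b. quotient_basis K (VR P) P (place_degree K P) b"
  and place_degree_pos: "place_degree K P > 0"
proof -
  obtain n b where b: "quotient_basis K (VR P) P n b"
    using VR_quotient_basis_scaled[OF subsetD[OF place_subset_VR unif_in] unif_nz] unif_eq by auto
  have n: "place_degree K P = n"
    unfolding place_degree_def by (rule quotient_dim_eq[OF ksub_VR ksub_place b])
  show "\<exists>b. quotient_basis K (VR P) P (place_degree K P) b" using b n by blast
  show "place_degree K P > 0"
  proof (rule ccontr)
    assume "\<not> ?thesis"
    hence "quotient_basis K (VR P) P 0 b" using b n by simp
    from coefs_spanning[OF this subring_1[OF VR_subring]] one_notin_place show False by auto
  qed
qed

text \<open>The form of \<open>pw\<close> that can be used before \<open>place_val\<close> is known
  to be well defined.\<close>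

definition scaled_ring :: "int \<Rightarrow> 'f set" where
  "scaled_ring n = (\<lambda>x. unif powi n * x) ` VR P"

lemma scaled_ring_step_basis:
  "\<exists>b. quotient_basis K (scaled_ring n) (scaled_ring (n + 1)) (place_degree K P) b"
proof -
  obtain b where b: "quotient_basis K (VR P) P (place_degree K P) b" using residue_basis by blast
  have "(\<lambda>x. unif powi n * x) ` P = scaled_ring (n + 1)"
    by (subst unif_eq) (simp add: scaled_ring_def image_image power_int_add unif_nz mult.assoc)
  thus ?thesis using quotient_basis_scale[OF _ b, of "unif powi n"] unif_nz
    by (auto simp: scaled_ring_def)
qed

lemma scaled_ring_ksub: "ksub (scaled_ring n)"
  unfolding scaled_ring_def by (rule ksub_scaled[OF ksub_VR])

lemma scaled_ring_mono: "n \<le> k \<Longrightarrow> scaled_ring k \<subseteq> scaled_ring n"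
proof
  fix x assume nk: "n \<le> k" and "x \<in> scaled_ring k"
  then obtain a where a: "a \<in> VR P" "x = unif powi k * a" by (auto simp: scaled_ring_def)
  have "unif powi k = unif powi (n + int (nat (k - n)))" using nk by simp
  also have "\<dots> = unif powi n * unif ^ nat (k - n)"
    using unif_nz by (simp only: power_int_add power_int_of_nat simp_thms)
  finally have "x = unif powi n * (unif ^ nat (k - n) * a)" using a by (simp add: mult.assoc)
  moreover have "unif ^ nat (k - n) * a \<in> VR P"
    using a place_subset_VR unif_in by (intro subring_mult[OF VR_subring] subring_power[OF VR_subring]) auto
  ultimately show "x \<in> scaled_ring n" by (auto simp: scaled_ring_def)
qed

lemma scaled_ring_0: "scaled_ring 0 = VR P" by (simp add: scaled_ring_def)

lemma scaled_ring_basis: "\<exists>b. quotient_basis K (VR P) (scaled_ring (int k)) (k * place_degree K P) b"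
proof (induction k)
  case 0
  show ?case using subring_0[OF VR_subring] subring_1[OF VR_subring]
    by (auto simp: quotient_basis_def scaled_ring_0)
next
  case (Suc k)
  then obtain b where b: "quotient_basis K (VR P) (scaled_ring (int k)) (k * place_degree K P) b" by blast
  obtain b' where b': "quotient_basis K (scaled_ring (int k)) (scaled_ring (int k + 1)) (place_degree K P) b'"
    using scaled_ring_step_basis by blast
  have "\<exists>b''. quotient_basis K (VR P) (scaled_ring (int k + 1)) (k * place_degree K P + place_degree K P) b''"
    using scaled_ring_mono[of 0 "int k"] scaled_ring_0
    by (intro quotient_basis_trans[OF ksub_VR scaled_ring_ksub scaled_ring_ksub _ _ b b'] scaled_ring_mono) auto
  thus ?case by (simp add: add.commute)
qed

text \<open>If \<open>z\<close> lies in \<open>scaled_ring (int k)\<close>, a basis of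
  \<open>VR P\<close> modulo this ideal is independent modulo \<open>z\<close>, hence
  \<open>k * place_degree K P \<le> zdim z\<close>. So there is a largest such \<open>k\<close>, and
  its cofactor is a unit, as otherwise one more uniformizer could be split off.\<close>

lemma factorization_VR:
  assumes z: "z \<in> VR P" "z \<noteq> 0"
  shows "\<exists>k. \<exists>u\<in>units_in (VR P). z = unif ^ k * u"
proof -
  let ?Q = "\<lambda>k. z \<in> scaled_ring (int k)"
  have bound: "k \<le> zdim z" if "?Q k" for k
  proof -
    obtain b where b: "quotient_basis K (VR P) (scaled_ring (int k)) (k * place_degree K P) b"
      using scaled_ring_basis by blast
    have zk: "z \<in> scaled_ring (int k)" by (rule that)
    have "(\<lambda>x. z * x) ` VR P \<subseteq> scaled_ring (int k)"
    proof clarify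
      fix x assume x: "x \<in> VR P"
      obtain a where a: "a \<in> VR P" "z = unif powi int k * a" using zk unfolding scaled_ring_def by blast
      have "z * x = unif powi int k * (a * x)" by (simp add: a)
      thus "z * x \<in> scaled_ring (int k)"
        unfolding scaled_ring_def using subring_mult[OF VR_subring a(1) x] by blast
    qed
    hence "indep_mod ((\<lambda>x. z * x) ` VR P) (k * place_degree K P) b"
      using b unfolding quotient_basis_iff indep_mod_def by blast
    hence "k * place_degree K P \<le> zdim z"
      using b by (intro VR_indep_le_zdim[OF z]) (auto simp: quotient_basis_iff)
    moreover have "k * 1 \<le> k * place_degree K P"
      using place_degree_pos by (intro mult_left_mono) auto
    ultimately show ?thesis by linarith
  qed
  define k where "k = (GREATEST k. ?Q k)"
  have Q0: "?Q 0" using z by (simp add: scaled_ring_0)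
  have "?Q k" unfolding k_def by (rule GreatestI_nat[of ?Q, OF Q0 bound])
  then obtain u where u: "u \<in> VR P" "z = unif ^ k * u" by (auto simp: scaled_ring_def)
  have "u \<notin> P"
  proof
    assume "u \<in> P"
    then obtain a where "a \<in> VR P" "u = unif * a" using unif_eq by blast
    hence "z = unif powi (int (Suc k)) * a"
      unfolding power_int_of_nat by (simp add: u mult_ac)
    hence "?Q (Suc k)" using \<open>a \<in> VR P\<close> unfolding scaled_ring_def by blast
    hence "Suc k \<le> k" unfolding k_def by (rule Greatest_le_nat[of ?Q, OF _ bound])
    thus False by simp
  qed
  thus ?thesis using u in_units_iff by blast
qed

lemma factorization:
  assumes "z \<noteq> 0"
  shows "\<exists>n. \<exists>u\<in>units_in (VR P). z = unif powi n * u"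
proof (cases "z \<in> VR P")
  case True
  then obtain k u where "u \<in> units_in (VR P)" "z = unif ^ k * u"
    using factorization_VR assms by blast
  thus ?thesis by (intro exI[of _ "int k"]) auto
next
  case False
  hence "inverse z \<in> VR P" using VR_total by blast
  then obtain k u where u: "u \<in> units_in (VR P)" "inverse z = unif ^ k * u"
    using factorization_VR[of "inverse z"] assms by auto
  have "z = inverse (unif ^ k * u)" using u(2) by (metis inverse_inverse_eq)
  also have "\<dots> = unif powi (- int k) * inverse u" by (simp add: power_int_minus)
  finally show ?thesis using units_inverse[OF u(1)] by blast
qed

lemma unif_power_unit:
  assumes "unif powi n \<in> units_in (VR P)"
  shows "n = 0"
proof -
  have pos: False if "unif ^ Suc k \<in> units_in (VR P)" for k
  proof -
    have "unif ^ k * unif \<in> P"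
      using unif_in place_subset_VR by (intro place_mult subring_power[OF VR_subring]) auto
    thus False using that in_units_iff by (simp add: mult.commute)
  qed
  show ?thesis
  proof (rule ccontr)
    assume "n \<noteq> 0"
    then obtain k where "n = int (Suc k) \<or> n = - int (Suc k)"
      by (metis int_cases2 not0_implies_Suc of_nat_0 neg_equal_0_iff_equal)
    thus False
    proof
      assume "n = int (Suc k)"
      thus False using pos[of k] assms by (metis power_int_of_nat)
    next
      assume n: "n = - int (Suc k)"
      from units_inverse[OF assms] have "unif ^ Suc k \<in> units_in (VR P)"
        unfolding n power_int_minus power_int_of_nat by (simp only: inverse_inverse_eq)
      thus False using pos by blast
    qed
  qed
qed

text \<open>Since \<open>place_val\<close> admits every generator of the place, uniqueness of the
  exponent involves comparing generators: two of them differ by a unit, and no nonzero power of the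
  uniformizer is a unit.\<close>

lemma place_val_eqI:
  assumes "u \<in> units_in (VR P)" "z = unif powi n * u"
  shows "place_val K P z = n"
  unfolding place_val_def
proof (rule the_equality)
  show "\<exists>t u. P = (\<lambda>x. t * x) ` VR P \<and> u \<in> units_in (VR P) \<and> z = t powi n * u"
    using assms unif_eq by blast
next
  fix k assume "\<exists>t u. P = (\<lambda>x. t * x) ` VR P \<and> u \<in> units_in (VR P) \<and> z = t powi k * u"
  then obtain t v where t: "P = (\<lambda>x. t * x) ` VR P" and v: "v \<in> units_in (VR P)" "z = t powi k * v"
    by blast
  have "t \<in> P" using t subring_1[OF VR_subring] by (metis image_eqI mult.right_neutral)
  then obtain a where a: "a \<in> VR P" "t = unif * a" using unif_eq by blast
  obtain c where c: "c \<in> VR P" "unif = t * c" using unif_in t by blast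
  have "unif * (a * c) = unif * 1" using a(2) c(2) by (simp flip: mult.assoc)
  hence ac: "a * c = 1" using unif_nz mult_left_cancel by blast
  hence "inverse a = c" using inverse_unique by blast
  hence ua: "a \<in> units_in (VR P)" using a c ac unfolding units_in_def by auto
  have nz: "a \<noteq> 0" "v \<noteq> 0" "u \<noteq> 0" using ac v(1) assms(1) unfolding units_in_def by auto
  have "unif powi n * u = unif powi k * (a powi k * v)"
    using assms(2) v(2) a(2) by (simp add: power_int_mult_distrib mult.assoc)
  hence "unif powi (n - k) = a powi k * v * inverse u"
    using unif_nz nz by (simp add: power_int_diff field_simps)
  also have "\<dots> \<in> units_in (VR P)"
    by (intro units_mult units_powi units_inverse ua v assms)
  finally show "k = n" using unif_power_unit[of "n - k"] by simp
qed

lemma place_val_factorization: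
  assumes "z \<noteq> 0"
  shows "\<exists>u\<in>units_in (VR P). z = unif powi place_val K P z * u"
proof -
  obtain n u where u: "u \<in> units_in (VR P)" "z = unif powi n * u"
    using factorization[OF assms] by blast
  have "place_val K P z = n" by (rule place_val_eqI[OF u])
  thus ?thesis using u by blast
qed

lemma place_val_mult:
  assumes "x \<noteq> 0" "y \<noteq> 0"
  shows "place_val K P (x * y) = place_val K P x + place_val K P y"
proof -
  obtain u where u: "u \<in> units_in (VR P)" "x = unif powi place_val K P x * u"
    using place_val_factorization[OF assms(1)] by blast
  obtain v where v: "v \<in> units_in (VR P)" "y = unif powi place_val K P y * v"
    using place_val_factorization[OF assms(2)] by blast
  have "x * y = (unif powi place_val K P x * u) * (unif powi place_val K P y * v)"
    by (rule arg_cong2[OF u(2) v(2)])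
  also have "\<dots> = unif powi (place_val K P x + place_val K P y) * (u * v)"
    by (simp only: power_int_add unif_nz mult_ac simp_thms)
  finally show ?thesis using place_val_eqI[OF units_mult[OF u(1) v(1)]] by blast
qed

text \<open>The elements of order at least \<open>n\<close> at the place. Zero is added by hand
  because \<open>place_val\<close> is meaningful only for nonzero arguments.\<close>

definition pw :: "int \<Rightarrow> 'f set" where
  "pw n = {x. x = 0 \<or> n \<le> place_val K P x}"

lemma pw_eq_scaled_ring: "pw n = scaled_ring n"
proof (intro equalityI subsetI)
  fix x assume x: "x \<in> pw n"
  show "x \<in> scaled_ring n"
  proof (cases "x = 0")
    case True thus ?thesis using ksub_0[OF scaled_ring_ksub] by simp
  next
    case False
    then obtain u where u: "u \<in> units_in (VR P)" "x = unif powi place_val K P x * u"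
      using place_val_factorization by blast
    hence "x \<in> scaled_ring (place_val K P x)" unfolding scaled_ring_def units_in_def by blast
    thus ?thesis using scaled_ring_mono x False unfolding pw_def by blast
  qed
next
  fix x assume "x \<in> scaled_ring n"
  then obtain a where a: "a \<in> VR P" "x = unif powi n * a" by (auto simp: scaled_ring_def)
  show "x \<in> pw n"
  proof (cases "a = 0")
    case False
    then obtain k u where u: "u \<in> units_in (VR P)" "a = unif ^ k * u" using factorization_VR a by blast
    hence "x = unif powi (n + int k) * u" using a unif_nz by (simp add: power_int_add mult.assoc)
    thus ?thesis using place_val_eqI[OF u(1)] by (simp add: pw_def)
  qed (use a in \<open>simp add: pw_def\<close>)
qed

lemma pw_0: "pw 0 = VR P" by (simp add: pw_eq_scaled_ring scaled_ring_0)

lemma pw_1: "pw 1 = P"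
  by (subst (2) unif_eq) (simp add: pw_eq_scaled_ring scaled_ring_def)

lemma ksub_pw: "ksub (pw n)" by (simp add: pw_eq_scaled_ring scaled_ring_ksub)

lemma pw_antimono: "n \<le> k \<Longrightarrow> pw k \<subseteq> pw n" by (auto simp: pw_def)

lemma pw_mult: "x \<in> pw a \<Longrightarrow> y \<in> pw b \<Longrightarrow> x * y \<in> pw (a + b)"
  using place_val_mult[of x y] by (cases "x = 0 \<or> y = 0") (auto simp: pw_def)

lemma pw_power: "x \<in> pw a \<Longrightarrow> x ^ n \<in> pw (int n * a)"
proof (induction n)
  case 0
  show ?case using subring_1[OF VR_subring] by (simp add: pw_0)
next
  case (Suc n)
  thus ?case using pw_mult[of x a "x ^ n" "int n * a"] by (simp add: algebra_simps)
qed

lemma pw_step_basis: "\<exists>b. quotient_basis K (pw n) (pw (n + 1)) (place_degree K P) b"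
  by (simp add: pw_eq_scaled_ring scaled_ring_step_basis)

lemma pw_basis: "\<exists>b. quotient_basis K (VR P) (pw (int k)) (k * place_degree K P) b"
  by (simp add: pw_eq_scaled_ring scaled_ring_basis)

lemma mult_in_pw_iff:
  "a \<noteq> 0 \<Longrightarrow> a * x \<in> pw n \<longleftrightarrow> x \<in> pw (n - place_val K P a)"
  using place_val_mult[of a x] by (cases "x = 0") (auto simp: pw_def)

lemma scaled_VR_eq_pw: "z \<noteq> 0 \<Longrightarrow> (\<lambda>x. z * x) ` VR P = pw (place_val K P z)"
proof (intro equalityI subsetI)
  fix y assume z: "z \<noteq> 0" and "y \<in> pw (place_val K P z)"
  hence "z * (y / z) \<in> pw (place_val K P z)" by simp
  hence "y / z \<in> VR P" using z mult_in_pw_iff[of z "y / z"] by (simp add: pw_0)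
  thus "y \<in> (\<lambda>x. z * x) ` VR P" using z by (intro image_eqI[of _ _ "y / z"]) auto
next
  fix y assume z: "z \<noteq> 0" and "y \<in> (\<lambda>x. z * x) ` VR P"
  thus "y \<in> pw (place_val K P z)" by (auto simp: mult_in_pw_iff pw_0)
qed

lemma place_val_constant: "c \<in> K \<Longrightarrow> c \<noteq> 0 \<Longrightarrow> place_val K P c = 0"
  using K_subset_VR K_inverse[of c] by (intro place_val_eqI[of c]) (auto simp: units_in_def)

lemma place_val_inverse: "x \<noteq> 0 \<Longrightarrow> place_val K P (inverse x) = - place_val K P x"
  using place_val_mult[of x "inverse x"] place_val_constant[of 1] by simp

lemma place_val_pos_iff: "x \<noteq> 0 \<Longrightarrow> place_val K P x > 0 \<longleftrightarrow> x \<in> P"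
  using pw_1 unfolding pw_def by force

end

section \<open>Weak approximation\<close>

text \<open>An inclusion \<open>VR P \<subseteq> VR Q\<close> forces \<open>P = Q\<close>. The
  inverse of the uniformizer of \<open>P\<close> is not in \<open>VR Q\<close>, since otherwise
  \<open>VR Q\<close> would be everything; this gives \<open>P \<subseteq> Q\<close>, and the
  reverse inclusion follows by passing to inverses.\<close>

lemma VR_not_subset:
  assumes P: "P \<in> places K" and Q: "Q \<in> places K" and "P \<noteq> Q"
  shows "\<exists>a. a \<in> VR P \<and> a \<notin> VR Q"
proof (rule ccontr)
  assume "\<not> ?thesis"
  hence sub: "VR P \<subseteq> VR Q" by blast
  let ?t = "unif P"
  have tQ: "?t \<in> VR Q" using sub unif_in[OF P] place_subset_VR[OF P] by blast
  have "inverse ?t \<notin> VR Q"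
  proof
    assume inv: "inverse ?t \<in> VR Q"
    have "z \<in> VR Q" for z
    proof (cases "z = 0")
      case False
      then obtain n u where u: "u \<in> units_in (VR P)" "z = ?t powi n * u" using factorization[OF P] by blast
      have "?t powi n \<in> VR Q"
        using tQ inv by (auto simp: power_int_def power_inverse intro: subring_power[OF VR_subring[OF Q]])
          (metis inv power_inverse subring_power[OF VR_subring[OF Q]])
      moreover have "u \<in> VR Q" using u(1) sub unfolding units_in_def by blast
      ultimately show ?thesis using u(2) subring_mult[OF VR_subring[OF Q]] by blast
    qed (simp add: subring_0[OF VR_subring[OF Q]])
    thus False using VR_not_UNIV[OF Q] by blast
  qed
  hence t: "?t \<in> Q" using in_place_iff[OF Q unif_nz[OF P]] by blast
  have "P \<subseteq> Q"
  proof
    fix x assume "x \<in> P"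
    then obtain a where "a \<in> VR P" "x = ?t * a" using unif_eq[OF P] by blast
    thus "x \<in> Q" using place_mult[OF Q _ t, of a] sub by (auto simp: mult.commute)
  qed
  moreover have "Q \<subseteq> P"
  proof
    fix x assume "x \<in> Q"
    thus "x \<in> P" using in_place_iff[OF Q, of x] in_place_iff[OF P, of x] sub zero_in_place[OF P]
      by (cases "x = 0") auto
  qed
  ultimately show False using \<open>P \<noteq> Q\<close> by blast
qed

lemma separating_element:
  assumes P: "P \<in> places K" and Q: "Q \<in> places K" and "P \<noteq> Q"
  shows "\<exists>c. c \<noteq> 0 \<and> c \<in> P \<and> inverse c \<in> Q"
proof -
  obtain a b where a: "a \<in> VR P" "a \<notin> VR Q" and b: "b \<in> VR Q" "b \<notin> VR P"
    using VR_not_subset assms by metis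
  have nz: "a \<noteq> 0" "b \<noteq> 0"
    using a b subring_0[OF VR_subring[OF P]] subring_0[OF VR_subring[OF Q]] by auto
  have "inverse b \<in> P" "inverse a \<in> Q"
    using in_place_iff[OF P, of "inverse b"] in_place_iff[OF Q, of "inverse a"] a b nz by auto
  from place_mult[OF P a(1) this(1)] place_mult[OF Q b(1) this(2)]
  show ?thesis using nz by (intro exI[of _ "a * inverse b"]) (auto simp: mult.commute)
qed

text \<open>Pigeonhole in the finite residue field: two powers of \<open>c\<close> have the same
  residue coordinates, and the smaller power cancels because \<open>P\<close> is prime.\<close>

lemma power_residue_one:
  assumes P: "P \<in> places K" and c: "c \<in> VR P" "c \<notin> P"
  shows "\<exists>k>0. c ^ k - 1 \<in> P"
proof -
  obtain b where b: "quotient_basis K (VR P) P (place_degree K P) b" using residue_basis[OF P] by blast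
  let ?n = "place_degree K P"
  note pow = subring_power[OF VR_subring[OF P] c(1)]
  have "\<forall>i. \<exists>d. d \<in> coefs ?n \<and> c ^ i - (\<Sum>j<?n. d j * b j) \<in> P"
    using coefs_spanning[OF b pow] by metis
  then obtain h where h: "\<And>i. h i \<in> coefs ?n" "\<And>i. c ^ i - (\<Sum>j<?n. h i j * b j) \<in> P" by metis
  have "\<not> inj h"
  proof
    assume "inj h"
    moreover have "finite (range h)" 
      by (rule finite_subset[OF _ finite_coefs[of ?n]]) (rule image_subsetI, rule h(1))
    ultimately show False using finite_imageD by blast
  qed
  then obtain i j where "h i = h j" "i \<noteq> j" unfolding inj_def by blast
  then obtain i j where ij: "h i = h j" "i < j" by (metis linorder_neqE_nat)
  have "c ^ j - c ^ i \<in> P"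
    using place_diff[OF P h(2)[of j] h(2)[of i]] ij(1) by simp
  also have "c ^ j - c ^ i = c ^ i * (c ^ (j - i) - 1)"
    using ij(2) by (simp add: right_diff_distrib flip: power_add)
  finally have "c ^ i \<in> P \<or> c ^ (j - i) - 1 \<in> P"
    using pow subring_1[OF VR_subring[OF P]]
    by (intro place_prime[OF P] subring_diff[OF VR_subring[OF P]]) auto
  moreover have "c ^ i \<notin> P"
  proof (induction i)
    case 0 show ?case using one_notin_place[OF P] by simp
  next
    case (Suc i) thus ?case using place_prime[OF P c(1) pow[of i]] c(2) by auto
  qed
  ultimately show ?thesis using ij(2) by (intro exI[of _ "j - i"]) auto
qed

lemma power_minus_one_dvd:
  assumes P: "P \<in> places K" and c: "c \<in> VR P" "c - 1 \<in> P"
  shows "c ^ l - 1 \<in> P"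
proof (induction l)
  case 0 show ?case using zero_in_place[OF P] by simp
next
  case (Suc l)
  have "c * (c ^ l - 1) + (c - 1) \<in> P" by (intro place_add[OF P] place_mult[OF P] c Suc)
  thus ?case by (simp add: algebra_simps)
qed

lemma common_power_residue_one:
  assumes T: "finite T" "T \<subseteq> places K"
  shows "\<exists>k>0. \<forall>P\<in>T. c \<in> VR P \<longrightarrow> c \<notin> P \<longrightarrow> c ^ k - 1 \<in> P"
  using T
proof (induction T)
  case empty show ?case by auto
next
  case (insert P T)
  then obtain k where k: "k > 0" "\<forall>P\<in>T. c \<in> VR P \<longrightarrow> c \<notin> P \<longrightarrow> c ^ k - 1 \<in> P" by auto
  have P: "P \<in> places K" and T: "T \<subseteq> places K" using insert.prems by auto
  show ?case
  proof (cases "c \<in> VR P \<and> c \<notin> P")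
    case True
    then obtain l where l: "l > 0" "c ^ l - 1 \<in> P" using power_residue_one[OF P] by blast
    have "c ^ (k * l) - 1 \<in> R" if R: "R \<in> insert P T" "c \<in> VR R" "c \<notin> R" for R
    proof (cases "R = P")
      case True
      have "(c ^ l) ^ k - 1 \<in> P"
        using R True by (intro power_minus_one_dvd[OF P _ l(2)] subring_power[OF VR_subring[OF P]]) auto
      thus ?thesis using True by (simp add: mult.commute flip: power_mult)
    next
      case False
      hence Rp: "R \<in> places K" and ck: "c ^ k - 1 \<in> R" using R k T by auto
      have "(c ^ k) ^ l - 1 \<in> R"
        using R by (intro power_minus_one_dvd[OF Rp _ ck] subring_power[OF VR_subring[OF Rp]]) auto
      thus ?thesis by (simp flip: power_mult)
    qed
    thus ?thesis using k(1) l(1) by (intro exI[of _ "k * l"]) auto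
  next
    case False
    thus ?thesis using k by (intro exI[of _ k]) auto
  qed
qed

lemma inverse_one_plus_place:
  assumes P: "P \<in> places K" and x: "x \<in> P"
  shows "1 + x \<noteq> 0" "inverse (1 + x) \<in> VR P" "inverse (1 + x) - 1 \<in> P"
proof -
  have n: "1 + x \<notin> P" using place_diff[OF P _ x, of "1 + x"] one_notin_place[OF P] by auto
  thus nz: "1 + x \<noteq> 0" using zero_in_place[OF P] by metis
  show inv: "inverse (1 + x) \<in> VR P" using in_place_iff[OF P nz] n by blast
  have "inverse (1 + x) - 1 = - (inverse (1 + x) * x)" using nz by (simp add: field_simps)
  thus "inverse (1 + x) - 1 \<in> P" using place_minus[OF P place_mult[OF P inv x]] by simp
qed

text \<open>If \<open>c\<close> vanishes at \<open>P\<close> and has a pole at \<open>Q\<close>, then \<open>inverse (1 - c ^ k + c ^ (2 * k))\<close> is 1 at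
  \<open>P\<close> and vanishes at \<open>Q\<close>. It is also 1 at every place where \<open>c\<close> is a unit, provided \<open>c ^ k\<close> is 1
  there; such a \<open>k\<close> exists because residue fields are finite.\<close>

lemma approx_one_zero:
  assumes T: "finite T" "T \<subseteq> places K" and P: "P \<in> T" and Q: "Q \<in> T" and "P \<noteq> Q"
  shows "\<exists>w. (\<forall>R\<in>T. w \<in> VR R) \<and> w - 1 \<in> P \<and> w \<in> Q"
proof -
  have "P \<in> places K" "Q \<in> places K" using T P Q by auto
  from separating_element[OF this \<open>P \<noteq> Q\<close>]
  obtain c where c: "c \<noteq> 0" "c \<in> P" "inverse c \<in> Q" by blast
  obtain k where "k > 0" "\<forall>R\<in>T. c \<in> VR R \<longrightarrow> c \<notin> R \<longrightarrow> c ^ k - 1 \<in> R"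
    using common_power_residue_one[OF T, of c] by blast
  hence k: "k > 0" "\<And>R. R \<in> T \<Longrightarrow> c \<in> VR R \<Longrightarrow> c \<notin> R \<Longrightarrow> c ^ k - 1 \<in> R" by blast+
  define w where "w = inverse (1 + c ^ k * (c ^ k - 1))"
  have pw: "x ^ k \<in> R" if "x \<in> R" "R \<in> places K" for x R
  proof -
    have "x ^ (k - 1) * x \<in> R"
      using that place_subset_VR by (intro place_mult subring_power[OF VR_subring]) auto
    thus ?thesis using k(1) by (metis power_minus_mult)
  qed
  have vanish: "x ^ k * (x ^ k - 1) \<in> R" if "x \<in> R" "R \<in> places K" for x R
  proof -
    have "x \<in> VR R" using that place_subset_VR by blast
    hence "(x ^ k - 1) * x ^ k \<in> R"
      using that by (intro place_mult pw subring_diff[OF VR_subring] subring_power[OF VR_subring]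
          subring_1[OF VR_subring])
    thus ?thesis by (simp add: mult.commute)
  qed
  have reg: "w \<in> VR R" if R: "R \<in> T" "c \<in> VR R" for R
  proof -
    have Rp: "R \<in> places K" using R T by blast
    have "c ^ k * (c ^ k - 1) \<in> R"
    proof (cases "c \<in> R")
      case False
      thus ?thesis using k(2)[OF R False] R
        by (intro place_mult[OF Rp] subring_power[OF VR_subring[OF Rp]]) auto
    qed (rule vanish[OF _ Rp])
    thus ?thesis unfolding w_def using inverse_one_plus_place[OF Rp] by blast
  qed
  have pole: "w \<in> R" if R: "R \<in> T" "inverse c \<in> R" for R
  proof -
    have Rp: "R \<in> places K" using R T by blast
    let ?e = "inverse c"
    \<comment> \<open>The polynomial \<open>1 - X + X ^ 2\<close> is palindromic: pulling out
      \<open>c ^ k * c ^ k\<close> leaves the same expression in \<open>inverse c\<close>, which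
      reduces a pole of \<open>c\<close> to a zero of \<open>inverse c\<close>.\<close>
    have "1 + c ^ k * (c ^ k - 1) = c ^ k * c ^ k * (1 + ?e ^ k * (?e ^ k - 1))"
      using c(1) by (simp add: power_inverse field_simps)
    hence "w = inverse (1 + ?e ^ k * (?e ^ k - 1)) * ?e ^ k * ?e ^ k"
      using c(1) by (simp add: w_def power_inverse)
    also have "\<dots> \<in> R"
      using place_subset_VR[OF Rp] pw[OF R(2) Rp]
      by (intro place_mult[OF Rp] subring_mult[OF VR_subring[OF Rp]]
          inverse_one_plus_place(2)[OF Rp] vanish[OF R(2) Rp]) auto
    finally show ?thesis .
  qed
  have "w \<in> VR R" if R: "R \<in> T" for R
  proof (cases "c \<in> VR R")
    case False
    have Rp: "R \<in> places K" using R T by blast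
    hence "inverse c \<in> R" using in_place_iff[of R "inverse c"] False c(1) by simp
    thus ?thesis using pole[OF R] place_subset_VR[OF Rp] by blast
  qed (rule reg[OF R])
  moreover have "w - 1 \<in> P"
    unfolding w_def using c T P by (intro inverse_one_plus_place(3) vanish) auto
  ultimately show ?thesis using pole[OF Q c(3)] by blast
qed

lemma approx_one_zeros:
  assumes T: "finite T" "T \<subseteq> places K" and P: "P \<in> T"
  shows "\<exists>w. (\<forall>R\<in>T. w \<in> VR R) \<and> w - 1 \<in> P \<and> (\<forall>Q\<in>T - {P}. w \<in> Q)"
proof -
  have Pp: "P \<in> places K" using T P by blast
  have "\<exists>w. (\<forall>R\<in>T. w \<in> VR R) \<and> w - 1 \<in> P \<and> (\<forall>Q\<in>T'. w \<in> Q)" if "finite T'" "T' \<subseteq> T - {P}" for T'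
    using that
  proof (induction T')
    case empty
    show ?case using T subring_1[OF VR_subring] zero_in_place[OF Pp] by (intro exI[of _ 1]) auto
  next
    case (insert Q T')
    then obtain w where w: "\<forall>R\<in>T. w \<in> VR R" "w - 1 \<in> P" "\<forall>Q\<in>T'. w \<in> Q" by auto
    obtain v where v: "\<forall>R\<in>T. v \<in> VR R" "v - 1 \<in> P" "v \<in> Q"
      using approx_one_zero[OF T P, of Q] insert.prems by auto
    have "\<forall>R\<in>T. v * w \<in> VR R" using v w T subring_mult[OF VR_subring] by blast
    moreover have "v * (w - 1) + (v - 1) \<in> P"
      using v w P by (intro place_add[OF Pp] place_mult[OF Pp]) auto
    hence "v * w - 1 \<in> P" by (simp add: algebra_simps)
    moreover have "v * w \<in> R" if R: "R \<in> insert Q T'" for R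
    proof -
      have RT: "R \<in> T" using R insert.prems by blast
      hence Rp: "R \<in> places K" using T by blast
      show ?thesis
      proof (cases "R = Q")
        case True
        have "w * v \<in> R" using True v w RT by (intro place_mult[OF Rp]) auto
        thus ?thesis by (simp add: mult.commute)
      next
        case False
        thus ?thesis using R v w RT by (intro place_mult[OF Rp]) auto
      qed
    qed
    ultimately show ?case by blast
  qed
  from this[of "T - {P}"] T show ?thesis by auto
qed

lemma approx_one_zeros_power:
  assumes T: "finite T" "T \<subseteq> places K" and P: "P \<in> T"
  shows "\<exists>w. w - 1 \<in> pw P (int n) \<and> (\<forall>Q\<in>T - {P}. w \<in> pw Q (int n))"
proof -
  obtain v where v: "\<forall>R\<in>T. v \<in> VR R" "v - 1 \<in> P" "\<forall>Q\<in>T - {P}. v \<in> Q"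
    using approx_one_zeros[OF T P] by blast
  \<comment> \<open>At \<open>P\<close> the element \<open>1 - v ^ n\<close> vanishes, so its
    \<open>n\<close>-th power has order at least \<open>n\<close>; at the other places
    \<open>w\<close> is a multiple of \<open>v ^ n\<close>.\<close>
  define w where "w = 1 - (1 - v ^ n) ^ n"
  have Pp: "P \<in> places K" using T P by blast
  have "v ^ n - 1 \<in> P" using v P by (intro power_minus_one_dvd[OF Pp]) auto
  hence "1 - v ^ n \<in> pw P 1" using place_minus[OF Pp] pw_1[OF Pp] by fastforce
  hence "(1 - v ^ n) ^ n \<in> pw P (int n)" using pw_power[OF Pp, of "1 - v ^ n" 1 n] by simp
  hence 1: "w - 1 \<in> pw P (int n)" using ksub_minus[OF ksub_pw[OF Pp]] by (simp add: w_def)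
  have 2: "w \<in> pw Q (int n)" if Q: "Q \<in> T - {P}" for Q
  proof -
    have Qp: "Q \<in> places K" using Q T by blast
    have vQ: "v \<in> VR Q" using v Q by blast
    have "v ^ n \<in> pw Q (int n)" using pw_power[OF Qp, of v 1 n] v Q pw_1[OF Qp] by auto
    moreover have "(\<Sum>i<n. (1 - v ^ n) ^ i) \<in> pw Q 0"
      unfolding pw_0[OF Qp]
      by (intro subring_sum[OF VR_subring[OF Qp]] subring_power[OF VR_subring[OF Qp]]
          subring_diff[OF VR_subring[OF Qp]] subring_1[OF VR_subring[OF Qp]] vQ)
    ultimately have "v ^ n * (\<Sum>i<n. (1 - v ^ n) ^ i) \<in> pw Q (int n + 0)" by (rule pw_mult[OF Qp])
    also have "v ^ n * (\<Sum>i<n. (1 - v ^ n) ^ i) = w"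
      unfolding w_def one_diff_power_eq[of "1 - v ^ n" n] by simp
    finally show ?thesis by simp
  qed
  show ?thesis using 1 2 by blast
qed

theorem weak_approximation:
  assumes T: "finite T" "T \<subseteq> places K"
  shows "\<exists>x. \<forall>P\<in>T. x - y P \<in> pw P n"
proof -
  \<comment> \<open>One precision for all pairs of places: it absorbs \<open>n\<close> and the pole
    order of every \<open>y P\<close> at every place of \<open>T\<close>.\<close>
  define M where "M = nat (\<Sum>P\<in>T. \<Sum>Q\<in>T. \<bar>n - place_val K Q (y P)\<bar>)"
  have M: "int M + place_val K Q (y P) \<ge> n" if "P \<in> T" "Q \<in> T" for P Q
  proof -
    have "\<bar>n - place_val K Q (y P)\<bar> \<le> (\<Sum>Q\<in>T. \<bar>n - place_val K Q (y P)\<bar>)"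
      using T that by (intro member_le_sum) auto
    also have "\<dots> \<le> (\<Sum>P\<in>T. \<Sum>Q\<in>T. \<bar>n - place_val K Q (y P)\<bar>)"
      using T that by (intro member_le_sum[of P T "\<lambda>P. \<Sum>Q\<in>T. \<bar>n - place_val K Q (y P)\<bar>"])
        (auto intro: sum_nonneg)
    finally show ?thesis unfolding M_def by linarith
  qed
  have "\<forall>P\<in>T. \<exists>w. w - 1 \<in> pw P (int M) \<and> (\<forall>Q\<in>T - {P}. w \<in> pw Q (int M))"
    using approx_one_zeros_power[OF T] by blast
  then obtain w where w: "\<And>P. P \<in> T \<Longrightarrow> w P - 1 \<in> pw P (int M)"
    "\<And>P Q. P \<in> T \<Longrightarrow> Q \<in> T \<Longrightarrow> P \<noteq> Q \<Longrightarrow> w P \<in> pw Q (int M)"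
    by (metis DiffI singletonD)
  have mem: "y P * a \<in> pw Q n" if "P \<in> T" "Q \<in> T" "a \<in> pw Q (int M)" for P Q a
  proof (cases "y P = 0")
    case True
    have "Q \<in> places K" using T that by blast
    thus ?thesis using True ksub_0[OF ksub_pw] by simp
  next
    case False
    have "Q \<in> places K" using T that by blast
    thus ?thesis using mult_in_pw_iff[of Q "y P" a n] False that M[of P Q]
        pw_antimono[of Q "n - place_val K Q (y P)" "int M"] by auto
  qed
  have "(\<Sum>Q\<in>T. y Q * w Q) - y P \<in> pw P n" if P: "P \<in> T" for P
  proof -
    have Pp: "P \<in> places K" using T P by blast
    have "(\<Sum>Q\<in>T. y Q * w Q) - y P = y P * (w P - 1) + (\<Sum>Q\<in>T - {P}. y Q * w Q)"
      using T P by (simp add: sum.remove algebra_simps)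
    also have "\<dots> \<in> pw P n"
      using P w by (intro ksub_add[OF ksub_pw[OF Pp]] ksub_sum[OF ksub_pw[OF Pp]] mem) auto
    finally show ?thesis .
  qed
  thus ?thesis by blast
qed

text \<open>Bases of \<open>VR P\<close> modulo \<open>z\<close>, for all \<open>P \<in> T\<close>,
  are lifted by weak approximation to elements that are close to the basis element at
  \<open>P\<close> and close to 0 at the rest of \<open>T\<close>. In the ring \<open>A\<close> of
  elements regular on \<open>T\<close> the lifts are jointly independent modulo \<open>z A\<close>,
  hence over \<open>K(z)\<close>.\<close>

theorem sum_zeros_le_zdim:
  assumes z: "z \<noteq> 0" and T: "finite T" "T \<subseteq> {P \<in> places K. z \<in> P}"
  shows "(\<Sum>P\<in>T. nat (place_val K P z) * place_degree K P) \<le> zdim z"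
proof -
  let ?e = "\<lambda>P. place_val K P z"
  let ?d = "\<lambda>P. nat (?e P) * place_degree K P"
  have Tp: "T \<subseteq> places K" using T by blast
  have e: "?e P > 0" if "P \<in> T" for P using that T place_val_pos_iff[of P z] z by blast
  have "\<forall>P\<in>T. \<exists>b. quotient_basis K (VR P) (pw P (?e P)) (?d P) b"
  proof
    fix P assume P: "P \<in> T"
    from pw_basis[of P "nat (?e P)"] P Tp e[OF P]
    show "\<exists>b. quotient_basis K (VR P) (pw P (?e P)) (?d P) b" by auto
  qed
  then obtain b where b: "\<And>P. P \<in> T \<Longrightarrow> quotient_basis K (VR P) (pw P (?e P)) (?d P) (b P)" by metis
  define N where "N = (\<Sum>P\<in>T. ?e P)"
  have N: "?e P \<le> N" if "P \<in> T" for P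
    unfolding N_def using e T(1) that by (intro member_le_sum) (auto simp: less_imp_le)
  have "\<forall>P\<in>T. \<forall>i. \<exists>x. \<forall>Q\<in>T. x - (if Q = P then b P i else 0) \<in> pw Q N"
  proof (intro ballI allI)
    fix P i
    show "\<exists>x. \<forall>Q\<in>T. x - (if Q = P then b P i else 0) \<in> pw Q N"
      by (rule weak_approximation[OF T(1) Tp])
  qed
  then obtain y where y: "\<And>P Q i. P \<in> T \<Longrightarrow> Q \<in> T \<Longrightarrow> y P i - (if Q = P then b P i else 0) \<in> pw Q N"
    by metis
  have y': "y P i - (if Q = P then b P i else 0) \<in> pw Q (?e Q)" if "P \<in> T" "Q \<in> T" for P Q i
    using y[OF that] pw_antimono[of Q "?e Q" N] N[OF that(2)] Tp that by blast
  define A where "A = {x. \<forall>Q\<in>T. x \<in> VR Q}"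
  let ?I = "SIGMA P:T. {..<?d P}"
  have "zindep z ?I (\<lambda>(P, i). y P i)"
  proof (rule zindep_if_indep_mod_scaled[OF _ z])
    show "ksub A"
      using Tp ksub_VR unfolding A_def ksub_def by blast
    show "z * x \<in> A" if "x \<in> A" for x
      using that T place_subset_VR unfolding A_def by (blast intro: subring_mult[OF VR_subring])
    show "(case j of (P, i) \<Rightarrow> y P i) \<in> A" if jI: "j \<in> ?I" for j
    proof -
      obtain P i where j: "j = (P, i)" "P \<in> T" "i < ?d P" using jI by auto
      have "y P i \<in> VR Q" if Q: "Q \<in> T" for Q
      proof -
        have Qp: "Q \<in> places K" using Q Tp by blast
        have "y P i - (if Q = P then b P i else 0) \<in> VR Q"
          using subsetD[OF pw_antimono[OF Qp less_imp_le[OF e[OF Q]]] y'[OF j(2) Q, of i]]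
          unfolding pw_0[OF Qp] .
        moreover have "(if Q = P then b P i else 0) \<in> VR Q"
          using b[OF Q] j subring_0[OF VR_subring[OF Qp]] by (auto simp: quotient_basis_iff)
        ultimately show ?thesis using subring_add[OF VR_subring[OF Qp]] by fastforce
      qed
      thus ?thesis by (simp add: A_def j)
    qed
    fix c :: "'f set \<times> nat \<Rightarrow> 'f" and j
    assume c: "\<And>j. j \<in> ?I \<Longrightarrow> c j \<in> K"
      and s: "(\<Sum>j\<in>?I. c j * (case j of (P, i) \<Rightarrow> y P i)) \<in> (\<lambda>x. z * x) ` A" and j: "j \<in> ?I"
    obtain P k where j': "j = (P, k)" "P \<in> T" "k < ?d P" using j by auto
    have Pp: "P \<in> places K" using j' Tp by blast
    note ks = ksub_pw[OF Pp, of "?e P"]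
    have "(\<Sum>j\<in>?I. c j * (case j of (P, i) \<Rightarrow> y P i)) \<in> (\<lambda>x. z * x) ` VR P"
      using s j' unfolding A_def by blast
    hence s1: "(\<Sum>Q\<in>T. \<Sum>i<?d Q. c (Q, i) * y Q i) \<in> pw P (?e P)"
      using T(1) by (simp add: scaled_VR_eq_pw[OF Pp z] sum.Sigma split_def)
    \<comment> \<open>The approximation errors have order at least \<open>?e P\<close> at
      \<open>P\<close>; subtracting them leaves only the block of basis elements belonging to
      \<open>P\<close>.\<close>
    have s2: "(\<Sum>Q\<in>T. \<Sum>i<?d Q. c (Q, i) * (y Q i - (if P = Q then b Q i else 0))) \<in> pw P (?e P)"
      using c j' by (intro ksub_sum[OF ks] ksub_scale[OF ks] y') auto
    have "(\<Sum>Q\<in>T. \<Sum>i<?d Q. c (Q, i) * y Q i) -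
        (\<Sum>Q\<in>T. \<Sum>i<?d Q. c (Q, i) * (y Q i - (if P = Q then b Q i else 0)))
      = (\<Sum>Q\<in>T. if P = Q then \<Sum>i<?d Q. c (Q, i) * b Q i else 0)"
      unfolding sum_subtractf[symmetric]
      by (intro sum.cong refl) (auto simp: right_diff_distrib sum_subtractf)
    also have "\<dots> = (\<Sum>i<?d P. c (P, i) * b P i)" using T(1) j' by simp
    finally have "(\<Sum>i<?d P. c (P, i) * b P i) \<in> pw P (?e P)"
      using ksub_diff[OF ks s1 s2] by simp
    thus "c j = 0"
      using b[OF j'(2)] c j' indep_modD[of "pw P (?e P)" "?d P" "b P" "\<lambda>i. c (P, i)" k]
      by (auto simp: quotient_basis_iff)
  qed
  hence "card ?I \<le> zdim z" using T(1) by (intro zindep_le_zdim) auto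
  thus ?thesis using T(1) by (simp add: card_SigmaI)
qed

lemma finite_zeros:
  assumes "z \<noteq> 0"
  shows "finite {P \<in> places K. z \<in> P}"
proof (rule ccontr)
  assume "infinite {P \<in> places K. z \<in> P}"
  then obtain T where T: "finite T" "card T = Suc (zdim z)" "T \<subseteq> {P \<in> places K. z \<in> P}"
    using infinite_arbitrarily_large by metis
  have "card T = (\<Sum>P\<in>T. 1)" by simp
  also have "\<dots> \<le> (\<Sum>P\<in>T. nat (place_val K P z) * place_degree K P)"
  proof (rule sum_mono)
    fix P assume "P \<in> T"
    hence P: "P \<in> places K" "z \<in> P" using T by auto
    hence "nat (place_val K P z) * place_degree K P > 0"
      using place_val_pos_iff[OF P(1) assms] place_degree_pos[OF P(1)] by simp
    thus "1 \<le> nat (place_val K P z) * place_degree K P" by linarith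
  qed
  also have "\<dots> \<le> zdim z" by (rule sum_zeros_le_zdim[OF assms T(1,3)])
  finally show False using T(2) by simp
qed

section \<open>Divisors and Riemann's theorem\<close>

definition ddeg :: "('f set \<Rightarrow> int) \<Rightarrow> int" where
  "ddeg D = (\<Sum>P | D P \<noteq> 0. D P * int (place_degree K P))"

lemma divisorsI: "finite A \<Longrightarrow> A \<subseteq> places K \<Longrightarrow> (\<And>P. P \<notin> A \<Longrightarrow> D P = 0) \<Longrightarrow> D \<in> divisors K"
  unfolding divisors_def by (auto intro: finite_subset[of _ A])

lemma divisors_support: "D \<in> divisors K \<Longrightarrow> finite {P. D P \<noteq> 0}"
  and divisors_places: "D \<in> divisors K \<Longrightarrow> D P \<noteq> 0 \<Longrightarrow> P \<in> places K"
  unfolding divisors_def by auto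

lemma ddeg_eq_sum:
  assumes "finite A" "\<And>P. P \<notin> A \<Longrightarrow> D P = 0"
  shows "ddeg D = (\<Sum>P\<in>A. D P * int (place_degree K P))"
  unfolding ddeg_def using assms by (intro sum.mono_neutral_left) auto

lemma divisors_combine:
  assumes "D \<in> divisors K" "E \<in> divisors K" "h 0 0 = 0"
  shows "(\<lambda>P. h (D P) (E P)) \<in> divisors K"
  using assms divisors_support divisors_places
  by (intro divisorsI[of "{P. D P \<noteq> 0} \<union> {P. E P \<noteq> 0}"]) auto

lemma zero_divisor: "(\<lambda>_. 0) \<in> divisors K"
  by (simp add: divisors_def)

lemma ddeg_zero [simp]: "ddeg (\<lambda>_. 0) = 0"
  by (simp add: ddeg_def)

lemma divisors_add: "D \<in> divisors K \<Longrightarrow> E \<in> divisors K \<Longrightarrow> (\<lambda>P. D P + E P) \<in> divisors K"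
  and divisors_diff: "D \<in> divisors K \<Longrightarrow> E \<in> divisors K \<Longrightarrow> (\<lambda>P. D P - E P) \<in> divisors K"
  and divisors_scale: "D \<in> divisors K \<Longrightarrow> (\<lambda>P. n * D P) \<in> divisors K"
  and divisors_max: "D \<in> divisors K \<Longrightarrow> (\<lambda>P. max 0 (D P)) \<in> divisors K"
  using divisors_combine[of D E "(+)"] divisors_combine[of D E "(-)"]
    divisors_combine[of D D "\<lambda>x _. n * x"] divisors_combine[of D D "\<lambda>x _. max 0 x"] by auto

lemma divisors_sum: "(\<And>i. i \<in> I \<Longrightarrow> D i \<in> divisors K) \<Longrightarrow> (\<lambda>P. \<Sum>i\<in>I. D i P) \<in> divisors K"
  by (induction I rule: infinite_finite_induct) (auto intro: zero_divisor divisors_add)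

lemma ddeg_add:
  assumes "D \<in> divisors K" "E \<in> divisors K"
  shows "ddeg (\<lambda>P. D P + E P) = ddeg D + ddeg E"
proof -
  let ?A = "{P. D P \<noteq> 0} \<union> {P. E P \<noteq> 0}"
  have "finite ?A" using assms divisors_support by auto
  hence "ddeg D = (\<Sum>P\<in>?A. D P * int (place_degree K P))"
    "ddeg E = (\<Sum>P\<in>?A. E P * int (place_degree K P))"
    "ddeg (\<lambda>P. D P + E P) = (\<Sum>P\<in>?A. (D P + E P) * int (place_degree K P))"
    by (auto intro!: ddeg_eq_sum)
  thus ?thesis by (simp add: distrib_right sum.distrib)
qed

lemma ddeg_scale: "ddeg (\<lambda>P. n * D P) = n * ddeg D"
  unfolding ddeg_def by (cases "n = 0") (simp_all add: sum_distrib_left mult.assoc)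

lemma ddeg_diff:
  assumes "D \<in> divisors K" "E \<in> divisors K"
  shows "ddeg (\<lambda>P. D P - E P) = ddeg D - ddeg E"
  using ddeg_add[OF assms(1) divisors_scale[OF assms(2), of "-1"]] ddeg_scale[of "-1" E] by simp

lemma ddeg_nonneg: "(\<And>P. D P \<ge> 0) \<Longrightarrow> ddeg D \<ge> 0"
  unfolding ddeg_def by (intro sum_nonneg) auto

lemma ddeg_mono:
  assumes "D \<in> divisors K" "E \<in> divisors K" "D \<le> E"
  shows "ddeg D \<le> ddeg E"
  using ddeg_nonneg[of "\<lambda>P. E P - D P"] ddeg_diff[OF assms(2,1)] assms(3) by (auto simp: le_fun_def)

section \<open>Riemann-Roch spaces and principal divisors\<close>

abbreviation L :: "('f set \<Rightarrow> int) \<Rightarrow> 'f set" where "L D \<equiv> riemann_roch_space K D"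

lemma L_iff: "f \<in> L D \<longleftrightarrow> (\<forall>P\<in>places K. f \<in> pw P (- D P))"
  unfolding riemann_roch_space_def by (auto simp: pw_def)

lemma ksub_L: "ksub (L D)"
  unfolding ksub_def
proof (intro conjI ballI)
  show "0 \<in> L D" by (simp add: L_iff ksub_0[OF ksub_pw])
  show "x + y \<in> L D" if "x \<in> L D" "y \<in> L D" for x y
    using that by (simp add: L_iff ksub_add[OF ksub_pw])
  show "c * x \<in> L D" if "c \<in> K" "x \<in> L D" for c x
    using that by (simp add: L_iff ksub_scale[OF ksub_pw])
qed

lemma L_mono: "D \<le> E \<Longrightarrow> L D \<subseteq> L E"
  unfolding L_iff subset_iff using pw_antimono by (simp add: le_fun_def) (meson neg_le_iff_le subsetD)

definition pdiv :: "'f \<Rightarrow> 'f set \<Rightarrow> int" where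
  "pdiv z P = (if P \<in> places K then place_val K P z else 0)"

text \<open>The divisor of zeros of \<open>z\<close>; \<open>zdiv (inverse z)\<close> serves as its
  divisor of poles.\<close>

definition zdiv :: "'f \<Rightarrow> 'f set \<Rightarrow> int" where
  "zdiv z P = max 0 (pdiv z P)"

lemma pdiv_inverse: "z \<noteq> 0 \<Longrightarrow> pdiv (inverse z) P = - pdiv z P"
  by (simp add: pdiv_def place_val_inverse)

lemma pdiv_divisor:
  assumes "z \<noteq> 0" shows "pdiv z \<in> divisors K"
proof (rule divisorsI)
  show "finite ({P \<in> places K. z \<in> P} \<union> {P \<in> places K. inverse z \<in> P})"
    using finite_zeros assms by simp
  show "{P \<in> places K. z \<in> P} \<union> {P \<in> places K. inverse z \<in> P} \<subseteq> places K" by blast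
  fix P assume n: "P \<notin> {P \<in> places K. z \<in> P} \<union> {P \<in> places K. inverse z \<in> P}"
  show "pdiv z P = 0"
  proof (cases "P \<in> places K")
    case True
    hence "\<not> place_val K P z > 0" "\<not> place_val K P (inverse z) > 0"
      using n place_val_pos_iff assms by auto
    thus ?thesis using True assms by (simp add: pdiv_def place_val_inverse)
  qed (simp add: pdiv_def)
qed

lemma zdiv_divisor: "z \<noteq> 0 \<Longrightarrow> zdiv z \<in> divisors K"
  using divisors_max[OF pdiv_divisor] by (simp add: zdiv_def[abs_def])

lemma zdiv_nonneg: "zdiv z P \<ge> 0" by (simp add: zdiv_def)

lemma pdiv_eq_zdiv_diff: "z \<noteq> 0 \<Longrightarrow> pdiv z = (\<lambda>P. zdiv z P - zdiv (inverse z) P)"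
  by (auto simp: zdiv_def pdiv_inverse fun_eq_iff)

lemma ddeg_zdiv_le_zdim:
  assumes z: "z \<noteq> 0"
  shows "ddeg (zdiv z) \<le> int (zdim z)"
proof -
  let ?T = "{P \<in> places K. z \<in> P}"
  have "ddeg (zdiv z) = (\<Sum>P\<in>?T. zdiv z P * int (place_degree K P))"
  proof (rule ddeg_eq_sum[OF finite_zeros[OF z]])
    fix P assume "P \<notin> ?T"
    thus "zdiv z P = 0" using place_val_pos_iff[of P z] z by (auto simp: zdiv_def pdiv_def)
  qed
  also have "\<dots> = int (\<Sum>P\<in>?T. nat (place_val K P z) * place_degree K P)"
    unfolding of_nat_sum
    by (intro sum.cong refl) (auto simp: zdiv_def pdiv_def)
  also have "\<dots> \<le> int (zdim z)"
    by (intro of_nat_mono sum_zeros_le_zdim[OF z finite_zeros[OF z]] subset_refl)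
  finally show ?thesis .
qed

text \<open>A nonzero generator \<open>f i\<close> shows that the valuation ring obtained by
  extension is neither \<open>K\<close> nor the whole field: \<open>inverse (f i)\<close> in the
  ring would make 1 a combination of the generators.\<close>

lemma place_over_ideal:
  assumes R0: "is_subring R0" "K \<subseteq> R0" and f: "\<And>i. i < m \<Longrightarrow> f i \<in> R0" and nz: "i < m" "f i \<noteq> 0"
    and one: "1 \<notin> generated_ideal R0 m f"
  shows "\<exists>P\<in>places K. R0 \<subseteq> VR P \<and> (\<forall>i<m. f i \<in> P)"
proof -
  obtain R where R: "is_subring R" "R0 \<subseteq> R" "1 \<notin> generated_ideal R m f"
    "\<And>z. z \<in> R \<or> inverse z \<in> R"
    using valuation_ring_extension[OF R0(1) one f] by blast
  have ninv: "inverse (f j) \<notin> R" if "j < m" "f j \<noteq> 0" for j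
    using generated_ideal_mult[OF R(1) _ generated_ideal_generator[OF R(1) that(1)], of "inverse (f j)" f]
      that(2) R(3) by auto
  have "f i \<notin> K" using ninv[OF nz] K_inverse R0(2) R(2) by blast
  hence val: "valuation_ring K R"
    unfolding valuation_ring_def using R R0 f[OF nz(1)] ninv[OF nz] by blast
  let ?P = "R - units_in R"
  have "?P \<in> places K" unfolding places_def using val by blast
  moreover have "f j \<in> ?P" if "j < m" for j
    using ninv[OF that] f[OF that] R(2) unfolding units_in_def by auto
  ultimately show ?thesis using place_ring_eq[OF val] R(2) by (intro bexI[of _ ?P]) auto
qed

text \<open>For transcendental \<open>w\<close> the equation \<open>1 = h * w\<close> has no
  solution in \<open>K[w]\<close>, so \<open>w\<close> generates a proper ideal there.\<close>

lemma place_exists: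
  assumes w: "w \<notin> K"
  shows "\<exists>P\<in>places K. w \<in> P"
proof -
  let ?A = "{poly p w | p. \<forall>i. coeff p i \<in> K}"
  have sr: "is_subring K" using subfield_K by (simp add: is_subfield_def)
  have w0: "w \<noteq> 0" using w K_0 by blast
  have "1 \<notin> generated_ideal ?A 1 (\<lambda>_. w)"
  proof
    assume "1 \<in> generated_ideal ?A 1 (\<lambda>_. w)"
    then obtain h where "1 = h * w" "h \<in> ?A" unfolding generated_ideal_def by auto
    then obtain p where p: "1 = poly p w * w" "\<forall>i. coeff p i \<in> K" by blast
    have "poly (pCons (-1) p) w = 0" using p(1) by (simp add: mult.commute)
    moreover have "\<forall>i. coeff (pCons (-1) p) i \<in> K"
      using p(2) K_minus[OF K_1] by (auto simp: coeff_pCons split: nat.split)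
    moreover have "pCons (-1) p \<noteq> 0" by simp
    ultimately have "algebraic_over K w" unfolding algebraic_over_def by blast
    thus False using w algebraic_iff by blast
  qed
  from place_over_ideal[OF subring_adjoin(1,2)[OF sr] _ _ _ this, of 0]
  show ?thesis using subring_adjoin(3)[OF sr, of w] w0 by auto
qed

lemma L_zero: "L (\<lambda>_. 0) = K"
proof (intro equalityI subsetI)
  fix f assume f: "f \<in> L (\<lambda>_. 0)"
  show "f \<in> K"
  proof (rule ccontr)
    assume n: "f \<notin> K"
    hence "inverse f \<notin> K" using K_inverse[of "inverse f"] by auto
    then obtain P where P: "P \<in> places K" "inverse f \<in> P" using place_exists by blast
    have "f \<noteq> 0" using n K_0 by blast
    hence "f \<notin> VR P" using in_place_iff[OF P(1), of "inverse f"] P(2) by simp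
    thus False using f P(1) by (simp add: L_iff pw_0)
  qed
next
  fix f assume "f \<in> K"
  thus "f \<in> L (\<lambda>_. 0)" using K_subset_VR by (auto simp: L_iff pw_0)
qed

text \<open>The quotient of the larger space by \<open>L D\<close> embeds into a quotient of
  consecutive \<open>pw P\<close>, whose dimension is \<open>place_degree K P\<close>.\<close>

lemma card_L_step:
  assumes P: "P \<in> places K" and fin: "finite (L D)"
  shows "finite (L (D(P := D P + 1)))"
    and "card (L (D(P := D P + 1))) \<le> q ^ place_degree K P * card (L D)"
proof -
  let ?D = "D(P := D P + 1)" and ?n = "place_degree K P"
  obtain b where b: "quotient_basis K (pw P (- D P - 1)) (pw P (- D P)) ?n b"
    using pw_step_basis[OF P, of "- D P - 1"] by auto
  have "\<exists>c. c \<in> coefs ?n \<and> x - (\<Sum>i<?n. c i * b i) \<in> pw P (- D P)" if x: "x \<in> L ?D" for x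
  proof -
    have "x \<in> pw P (- D P - 1)" using bspec[OF x[unfolded L_iff] P] by simp
    from coefs_spanning[OF b this] show ?thesis by blast
  qed
  then obtain h where h: "\<And>x. x \<in> L ?D \<Longrightarrow> h x \<in> coefs ?n"
    "\<And>x. x \<in> L ?D \<Longrightarrow> x - (\<Sum>i<?n. h x i * b i) \<in> pw P (- D P)" by metis
  \<comment> \<open>One element is chosen for each coefficient vector that occurs. Any
    \<open>x\<close> is recovered from its vector and its difference to the chosen element, and this
    difference lies in \<open>L D\<close>.\<close>
  define r where "r c = (SOME x. x \<in> L ?D \<and> h x = c)" for c
  have r: "r (h x) \<in> L ?D" "h (r (h x)) = h x" if "x \<in> L ?D" for x
    using someI_ex[of "\<lambda>y. y \<in> L ?D \<and> h y = h x"] that unfolding r_def by blast+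
  let ?g = "\<lambda>x. (h x, x - r (h x))"
  have inj: "inj_on ?g (L ?D)" by (rule inj_onI) auto
  have img: "?g ` L ?D \<subseteq> coefs ?n \<times> L D"
  proof (rule image_subsetI)
    fix x assume x: "x \<in> L ?D"
    have "x - r (h x) \<in> pw Q (- D Q)" if Q: "Q \<in> places K" for Q
    proof (cases "Q = P")
      case True
      thus ?thesis
        using ksub_diff[OF ksub_pw[OF P] h(2)[OF x] h(2)[OF r(1)[OF x]]] r(2)[OF x] by simp
    next
      case False
      have "x \<in> pw Q (- ?D Q)" "r (h x) \<in> pw Q (- ?D Q)" using x r(1)[OF x] Q unfolding L_iff by blast+
      from ksub_diff[OF ksub_pw[OF Q] this] show ?thesis using False by simp
    qed
    hence "x - r (h x) \<in> L D" unfolding L_iff by blast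
    thus "?g x \<in> coefs ?n \<times> L D" using h(1)[OF x] by (intro SigmaI)
  qed
  have fin': "finite (coefs ?n \<times> L D)" by (intro finite_cartesian_product fin finite_coefs)
  show "finite (L ?D)" by (rule inj_on_finite[OF inj img fin'])
  have "card (L ?D) \<le> card (coefs ?n \<times> L D)" by (rule card_inj_on_le[OF inj img fin'])
  thus "card (L ?D) \<le> q ^ ?n * card (L D)" by (simp only: card_cartesian_product card_coefs)
qed

lemma card_L_le:
  assumes "D \<in> divisors K" "E \<in> divisors K" "D \<le> E" "finite (L D)"
  shows "finite (L E) \<and> card (L E) \<le> q ^ nat (ddeg E - ddeg D) * card (L D)"
  using assms
proof (induction "nat (ddeg E - ddeg D)" arbitrary: D rule: less_induct)
  case less
  show ?case
  proof (cases "D = E")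
    case False
    then obtain P where P: "D P < E P" using less.prems(3) by (auto simp: le_fun_def fun_eq_iff order_less_le)
    hence Pp: "P \<in> places K" using divisors_places less.prems(1,2) by (metis less_irrefl)
    let ?D = "D(P := D P + 1)"
    have pt: "(\<lambda>Q. if Q = P then 1 else 0) \<in> divisors K"
      using Pp by (intro divisorsI[of "{P}"]) auto
    have D': "?D = (\<lambda>Q. D Q + (if Q = P then 1 else 0))" by auto
    have Dd: "?D \<in> divisors K" unfolding D' by (rule divisors_add[OF less.prems(1) pt])
    have deg: "ddeg ?D = ddeg D + int (place_degree K P)"
      unfolding D' ddeg_add[OF less.prems(1) pt] by (subst (2) ddeg_eq_sum[of "{P}"]) auto
    have le: "?D \<le> E" using P less.prems(3) by (auto simp: le_fun_def)
    have leE: "ddeg ?D \<le> ddeg E" by (rule ddeg_mono[OF Dd less.prems(2) le])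
    have pos: "place_degree K P > 0" by (rule place_degree_pos[OF Pp])
    note step = card_L_step[OF Pp less.prems(4)]
    have IH: "finite (L E) \<and> card (L E) \<le> q ^ nat (ddeg E - ddeg ?D) * card (L ?D)"
      by (rule less.hyps[OF _ Dd less.prems(2) le step(1)]) (use deg leE pos in linarith)
    have "card (L E) \<le> q ^ nat (ddeg E - ddeg ?D) * (q ^ place_degree K P * card (L D))"
      using IH step(2) by (meson le_trans mult_le_mono2)
    also have "\<dots> = q ^ (nat (ddeg E - ddeg ?D) + place_degree K P) * card (L D)"
      by (simp add: power_add)
    also have "nat (ddeg E - ddeg ?D) + place_degree K P = nat (ddeg E - ddeg D)"
      using deg leE by linarith
    finally show ?thesis using IH by blast
  qed (use less.prems in simp)
qed

lemma finite_L:
  assumes "D \<in> divisors K" shows "finite (L D)"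
proof -
  have "finite (L (\<lambda>P. max 0 (D P)))"
    using card_L_le[OF zero_divisor divisors_max[OF assms]] L_zero finite_K by (simp add: le_fun_def)
  thus ?thesis using L_mono[of D "\<lambda>P. max 0 (D P)"] by (auto simp: le_fun_def intro: finite_subset)
qed

text \<open>Integer-valued, so that it can be subtracted from degrees.\<close>

definition ell :: "('f set \<Rightarrow> int) \<Rightarrow> int" where
  "ell D = int (quotient_dim K (L D) {0})"

lemma card_L: "D \<in> divisors K \<Longrightarrow> card (L D) = q ^ nat (ell D)"
  unfolding ell_def using card_finite_subspace[OF ksub_L finite_L] by simp

lemma ell_nonneg: "ell D \<ge> 0" by (simp add: ell_def)

lemma ell_eqI: "D \<in> divisors K \<Longrightarrow> card (L D) = q ^ n \<Longrightarrow> ell D = int n"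
  using card_L[of D] q_ge_2 ell_nonneg[of D] by simp

lemma ell_zero: "ell (\<lambda>_. 0) = 1"
  using ell_eqI[OF zero_divisor, of 1] L_zero by simp

lemma ell_le:
  assumes "D \<in> divisors K" "E \<in> divisors K" "D \<le> E"
  shows "ell E \<le> ell D + (ddeg E - ddeg D)"
proof -
  have "q ^ nat (ell E) \<le> q ^ (nat (ddeg E - ddeg D) + nat (ell D))"
    using card_L_le[OF assms finite_L[OF assms(1)]] card_L assms by (simp add: power_add)
  hence "nat (ell E) \<le> nat (ddeg E - ddeg D) + nat (ell D)" using q_ge_2 by simp
  thus ?thesis using ddeg_mono[OF assms] ell_nonneg[of D] by linarith
qed

text \<open>Multiplication by \<open>z\<close> maps \<open>L D\<close> bijectively onto the
  translated space.\<close>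

lemma ell_translate:
  assumes "D \<in> divisors K" "z \<noteq> 0"
  shows "ell (\<lambda>P. D P - pdiv z P) = ell D"
proof -
  have "L (\<lambda>P. D P - pdiv z P) = (\<lambda>x. z * x) ` L D"
  proof (intro equalityI subsetI)
    fix x assume x: "x \<in> L (\<lambda>P. D P - pdiv z P)"
    have "x / z \<in> pw P (- D P)" if P: "P \<in> places K" for P
    proof -
      have "z * (x / z) \<in> pw P (- (D P - place_val K P z))"
        using x P assms(2) by (auto simp: L_iff pdiv_def)
      thus ?thesis unfolding mult_in_pw_iff[OF P assms(2)] by simp
    qed
    hence "x / z \<in> L D" by (simp add: L_iff)
    thus "x \<in> (\<lambda>x. z * x) ` L D" using assms(2) by (intro image_eqI[of _ _ "x / z"]) auto
  next
    fix x assume "x \<in> (\<lambda>x. z * x) ` L D"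
    thus "x \<in> L (\<lambda>P. D P - pdiv z P)"
      using assms(2) by (auto simp: L_iff pdiv_def mult_in_pw_iff)
  qed
  moreover have "inj_on (\<lambda>x. z * x) (L D)" using assms(2) by (auto intro: inj_onI)
  ultimately have "card (L (\<lambda>P. D P - pdiv z P)) = q ^ nat (ell D)"
    using card_L[OF assms(1)] by (simp add: card_image)
  thus ?thesis using ell_eqI[OF divisors_diff[OF assms(1) pdiv_divisor[OF assms(2)]]] ell_nonneg by fastforce
qed

text \<open>\<open>C\<close> bounds the poles of a maximal family \<open>y\<close> that is
  independent over \<open>K(z)\<close>. The space then contains all \<open>z ^ j * y i\<close> with
  \<open>j \<le> l\<close>, which are \<open>zdim z * (l + 1)\<close> independent elements.\<close>

lemma ell_pole_multiples:
  assumes z: "z \<notin> K"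
  shows "\<exists>C\<in>divisors K. \<forall>l::nat. int (zdim z) * (int l + 1) \<le> ell (\<lambda>P. int l * zdiv (inverse z) P + C P)
    \<and> (\<forall>P. C P \<ge> 0)"
proof -
  have z0: "z \<noteq> 0" using z K_0 by blast
  let ?n = "zdim z" and ?B = "zdiv (inverse z)"
  have B: "?B \<in> divisors K" using zdiv_divisor z0 by simp
  obtain y where y: "zindep z {..<?n} y" using zdim_exists by blast
  have y0: "y i \<noteq> 0" if i: "i < ?n" for i
  proof
    assume "y i = 0"
    hence "(\<Sum>k<?n. \<Sum>j\<le>0. (if k = i then 1 else 0) * (z ^ j * y k)) = 0"
      by (intro sum.neutral) auto
    hence "(if i = i then 1 else 0 :: 'f) = 0"
      using i by (intro zindepD[OF y, of 0 "\<lambda>k _. if k = i then 1 else 0"]) auto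
    thus False by simp
  qed
  define C where "C P = (\<Sum>i<?n. zdiv (inverse (y i)) P)" for P
  have C: "C \<in> divisors K" unfolding C_def[abs_def] using y0 by (intro divisors_sum zdiv_divisor) auto
  have pole: "x \<in> pw P (- zdiv (inverse x) P)" if "x \<noteq> 0" "P \<in> places K" for x P
    using that by (auto simp: pw_def zdiv_def pdiv_def place_val_inverse)
  have "int ?n * (int l + 1) \<le> ell (\<lambda>P. int l * ?B P + C P)" for l :: nat
  proof -
    let ?D = "\<lambda>P. int l * ?B P + C P"
    have D: "?D \<in> divisors K" by (intro divisors_add divisors_scale B C)
    have "q ^ (card {..<?n} * Suc l) \<le> card (L ?D)"
    proof (rule zindep_card_le[OF y])
      fix i j assume i: "i \<in> {..<?n}" and j: "j \<le> l"
      have "z ^ j * y i \<in> pw P (- ?D P)" if P: "P \<in> places K" for P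
      proof -
        have "z ^ j * y i \<in> pw P (int j * (- ?B P) + - zdiv (inverse (y i)) P)"
          using i y0 z0 by (intro pw_mult[OF P] pw_power[OF P] pole P) auto
        moreover have "zdiv (inverse (y i)) P \<le> C P"
          unfolding C_def using i
          by (intro member_le_sum[of i _ "\<lambda>i. zdiv (inverse (y i)) P"]) (auto simp: zdiv_nonneg)
        moreover have "int j * ?B P \<le> int l * ?B P"
          using j by (intro mult_right_mono) (auto simp: zdiv_nonneg)
        ultimately show ?thesis
          using pw_antimono[OF P, of "- ?D P" "int j * (- ?B P) + - zdiv (inverse (y i)) P"] by auto
      qed
      thus "1 * (z ^ j * y i) \<in> L ?D" by (simp add: L_iff)
    qed (use ksub_L finite_L[OF D] in auto)
    hence "q ^ (?n * Suc l) \<le> q ^ nat (ell ?D)" using card_L[OF D] by simp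
    hence "?n * Suc l \<le> nat (ell ?D)" using q_ge_2 by simp
    hence "int (?n * Suc l) \<le> ell ?D" using ell_nonneg[of ?D] by linarith
    thus ?thesis by (simp add: algebra_simps)
  qed
  moreover have "\<forall>P. C P \<ge> 0" unfolding C_def by (auto intro: sum_nonneg zdiv_nonneg)
  ultimately show ?thesis using C by blast
qed

lemma zdim_le_ddeg_poles:
  assumes z: "z \<notin> K"
  shows "int (zdim z) \<le> ddeg (zdiv (inverse z))"
proof (rule ccontr)
  let ?B = "zdiv (inverse z)"
  assume "\<not> ?thesis"
  hence lt: "ddeg ?B + 1 \<le> int (zdim z)" by simp
  have z0: "z \<noteq> 0" using z K_0 by blast
  hence B: "?B \<in> divisors K" using zdiv_divisor by simp
  obtain C where C: "C \<in> divisors K" "\<And>P. C P \<ge> 0"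
    and ge: "\<And>l::nat. int (zdim z) * (int l + 1) \<le> ell (\<lambda>P. int l * ?B P + C P)"
    using ell_pole_multiples[OF z] by blast
  have C0: "ddeg C \<ge> 0" "ddeg ?B \<ge> 0" using ddeg_nonneg C zdiv_nonneg by auto
  \<comment> \<open>If \<open>ddeg ?B < zdim z\<close>, the two estimates of \<open>ell ?D\<close>
    combine to \<open>ddeg ?B + l \<le> ddeg C\<close>, which this \<open>l\<close>
    violates.\<close>
  define l where "l = nat (ddeg C) + 1"
  let ?D = "\<lambda>P. int l * ?B P + C P"
  have D: "?D \<in> divisors K" by (intro divisors_add divisors_scale B C)
  have "ell ?D \<le> 1 + ddeg ?D"
    using ell_le[OF zero_divisor D] ell_zero C(2) by (auto simp: le_fun_def zdiv_nonneg)
  also have "ddeg ?D = int l * ddeg ?B + ddeg C"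
    by (simp add: ddeg_add[OF divisors_scale[OF B] C(1)] ddeg_scale)
  finally have "(ddeg ?B + 1) * (int l + 1) \<le> 1 + (int l * ddeg ?B + ddeg C)"
    using ge[of l] mult_right_mono[OF lt, of "int l + 1"] by linarith
  thus False using C0 unfolding l_def by (simp add: algebra_simps)
qed

text \<open>The upper bound for zeros and the lower bound for poles, each applied to
  \<open>z\<close> and to \<open>inverse z\<close>, form a cycle of four inequalities, so all of
  them are equalities.\<close>

theorem ddeg_zdiv_eq:
  assumes "z \<notin> K"
  shows "ddeg (zdiv z) = int (zdim z)" "ddeg (zdiv (inverse z)) = int (zdim z)"
proof -
  have z: "z \<noteq> 0" "inverse z \<notin> K" using assms K_0 K_inverse[of "inverse z"] by auto
  show "ddeg (zdiv z) = int (zdim z)" "ddeg (zdiv (inverse z)) = int (zdim z)"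
    using zdim_le_ddeg_poles[OF assms] zdim_le_ddeg_poles[OF z(2)]
      ddeg_zdiv_le_zdim[of z] ddeg_zdiv_le_zdim[of "inverse z"] z(1) by auto
qed

theorem ddeg_pdiv:
  assumes z: "z \<noteq> 0"
  shows "ddeg (pdiv z) = 0"
proof (cases "z \<in> K")
  case True
  hence "pdiv z = (\<lambda>_. 0)" using z by (auto simp: pdiv_def place_val_constant)
  thus ?thesis by simp
next
  case False
  thus ?thesis using ddeg_zdiv_eq[OF False] z
    by (simp add: pdiv_eq_zdiv_diff[OF z] ddeg_diff[OF zdiv_divisor zdiv_divisor])
qed

text \<open>A nonzero element of \<open>L D\<close> exhibits an effective divisor linearly
  equivalent to \<open>D\<close>; linear equivalence preserves degree and dimension.\<close>

lemma L_nonzero_effective: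
  assumes D: "D \<in> divisors K" and z: "z \<in> L D" "z \<noteq> 0"
  shows "(\<lambda>P. D P + pdiv z P) \<in> divisors K" "D P + pdiv z P \<ge> 0"
    "ddeg (\<lambda>P. D P + pdiv z P) = ddeg D" "ell (\<lambda>P. D P + pdiv z P) = ell D"
proof -
  note pz = pdiv_divisor[OF z(2)]
  show "(\<lambda>P. D P + pdiv z P) \<in> divisors K" by (rule divisors_add[OF D pz])
  show "D P + pdiv z P \<ge> 0"
  proof (cases "P \<in> places K")
    case True thus ?thesis using z by (auto simp: pdiv_def L_iff pw_def)
  next
    case False thus ?thesis using divisors_places[OF D, of P] by (cases "D P = 0") (auto simp: pdiv_def)
  qed
  show "ddeg (\<lambda>P. D P + pdiv z P) = ddeg D" by (simp add: ddeg_add[OF D pz] ddeg_pdiv z)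
  show "ell (\<lambda>P. D P + pdiv z P) = ell D"
    using ell_translate[OF D, of "inverse z"] z by (simp add: pdiv_inverse)
qed

lemma ell_le_ddeg:
  assumes D: "D \<in> divisors K" and z: "z \<in> L D" "z \<noteq> 0"
  shows "ddeg D \<ge> 0" "ell D \<le> ddeg D + 1"
proof -
  note e = L_nonzero_effective[OF assms]
  show "ddeg D \<ge> 0" using ddeg_nonneg[of "\<lambda>P. D P + pdiv z P"] e by simp
  show "ell D \<le> ddeg D + 1"
    using ell_le[OF zero_divisor e(1)] e ell_zero by (simp add: le_fun_def)
qed

section \<open>Riemann's inequality and the genus\<close>

lemma ell_pos_imp: "D \<in> divisors K \<Longrightarrow> ell D > 0 \<Longrightarrow> \<exists>z\<in>L D. z \<noteq> 0"
proof (rule ccontr)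
  assume D: "D \<in> divisors K" "ell D > 0" and "\<not> (\<exists>z\<in>L D. z \<noteq> 0)"
  hence "L D = {0}" using ksub_0[OF ksub_L] by blast
  hence "ell D = 0" using ell_eqI[OF D(1), of 0] by simp
  thus False using D by simp
qed

text \<open>By \<open>ell_le\<close> the defect \<open>ddeg - ell\<close> is monotone, and it is
  invariant under linear equivalence. It is bounded on the multiples of one pole divisor, and every
  divisor, once its negative part is removed, is equivalent to one below such a multiple.\<close>

lemma riemann_inequality: "\<exists>\<gamma>. \<forall>A\<in>divisors K. ddeg A - ell A \<le> \<gamma>"
proof -
  obtain z where z: "z \<notin> K" using exists_nonconstant by blast
  let ?B = "zdiv (inverse z)"
  have z0: "z \<noteq> 0" using z K_0 by blast
  hence B: "?B \<in> divisors K" using zdiv_divisor by simp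
  have B1: "ddeg ?B \<ge> 1" using ddeg_zdiv_eq(2)[OF z] zdim_pos[OF z] by simp
  obtain C where C: "C \<in> divisors K" "\<And>P. C P \<ge> 0"
    and ge: "\<And>l::nat. int (zdim z) * (int l + 1) \<le> ell (\<lambda>P. int l * ?B P + C P)"
    using ell_pole_multiples[OF z] by blast
  have lB: "int l * ddeg ?B - ell (\<lambda>P. int l * ?B P) \<le> ddeg C" for l :: nat
  proof -
    have "ell (\<lambda>P. int l * ?B P + C P) \<le> ell (\<lambda>P. int l * ?B P) + ddeg C"
      using ell_le[OF divisors_scale[OF B] divisors_add[OF divisors_scale[OF B] C(1)], of "int l" "int l"]
      C(2) by (simp add: le_fun_def ddeg_add[OF divisors_scale[OF B] C(1)])
    moreover have "int l * ddeg ?B \<le> int (zdim z) * (int l + 1)"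
      using ddeg_zdiv_eq(2)[OF z] by (simp add: algebra_simps)
    ultimately show ?thesis using ge[of l] by linarith
  qed
  have "ddeg A - ell A \<le> ddeg C" if A: "A \<in> divisors K" for A
  proof -
    define A1 where "A1 = (\<lambda>P. max 0 (A P))"
    have A1: "A1 \<in> divisors K" unfolding A1_def by (rule divisors_max[OF A])
    have "ddeg A1 \<ge> 0" by (rule ddeg_nonneg) (simp add: A1_def)
    \<comment> \<open>Large enough to outweigh both the defect bound \<open>ddeg C\<close> and the
      degree of \<open>A1\<close>, so that \<open>L ?D\<close> has a nonzero element.\<close>
    define l where "l = nat (ddeg A1 + ddeg C + 1)"
    have l: "int l \<ge> ddeg A1 + ddeg C + 1" unfolding l_def by simp
    let ?D = "\<lambda>P. int l * ?B P - A1 P"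
    have D: "?D \<in> divisors K" by (intro divisors_diff divisors_scale B A1)
    have "ell (\<lambda>P. int l * ?B P) \<le> ell ?D + ddeg A1"
      using ell_le[OF D divisors_scale[OF B], of "int l"]
      by (simp add: le_fun_def A1_def ddeg_diff[OF divisors_scale[OF B] A1, unfolded A1_def])
    moreover have "int l * 1 \<le> int l * ddeg ?B" using B1 by (intro mult_left_mono) auto
    ultimately have "ell ?D > 0" using lB[of l] l by linarith
    then obtain w where w: "w \<in> L ?D" "w \<noteq> 0" using ell_pos_imp[OF D] by blast
    let ?E = "\<lambda>P. A1 P - pdiv w P"
    have E: "?E \<in> divisors K" by (rule divisors_diff[OF A1 pdiv_divisor[OF w(2)]])
    have "?E \<le> (\<lambda>P. int l * ?B P)"
      using L_nonzero_effective(2)[OF D w] by (simp add: le_fun_def algebra_simps)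
    from ell_le[OF E divisors_scale[OF B] this]
    have 1: "ell (\<lambda>P. int l * ?B P) \<le> ell ?E + (int l * ddeg ?B - ddeg ?E)" by (simp add: ddeg_scale)
    have 2: "ddeg ?E = ddeg A1" "ell ?E = ell A1"
      using ddeg_diff[OF A1 pdiv_divisor[OF w(2)]] ddeg_pdiv[OF w(2)] ell_translate[OF A1 w(2)] by auto
    have "ell A1 \<le> ell A + (ddeg A1 - ddeg A)"
      by (rule ell_le[OF A A1]) (simp add: A1_def le_fun_def)
    thus ?thesis using 1 2 lB[of l] by linarith
  qed
  thus ?thesis by blast
qed

text \<open>The genus is the largest value of \<open>ddeg A - ell A + 1\<close>. If \<open>A0\<close> attains it, then every divisor of
  large degree is linearly equivalent to one above \<open>A0\<close>, and \<open>ddeg - ell\<close> is monotone.\<close>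

theorem riemann:
  "\<exists>g c. (\<forall>A\<in>divisors K. ell A \<ge> ddeg A + 1 - g) \<and>
     (\<forall>A\<in>divisors K. ddeg A \<ge> c \<longrightarrow> ell A = ddeg A + 1 - g)"
proof -
  obtain \<gamma> where \<gamma>: "\<And>A. A \<in> divisors K \<Longrightarrow> ddeg A - ell A \<le> \<gamma>" using riemann_inequality by blast
  \<comment> \<open>The bound \<open>\<gamma>\<close> turns maximising \<open>ddeg A - ell A\<close>
    into minimising a natural number.\<close>
  obtain A0 where A0: "A0 \<in> divisors K"
    and min: "\<And>A. A \<in> divisors K \<Longrightarrow> nat (\<gamma> - (ddeg A0 - ell A0)) \<le> nat (\<gamma> - (ddeg A - ell A))"
    using ex_has_least_nat[of "\<lambda>A. A \<in> divisors K" _ "\<lambda>A. nat (\<gamma> - (ddeg A - ell A))"] zero_divisor by blast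
  define g where "g = ddeg A0 - ell A0 + 1"
  have ge: "ell A \<ge> ddeg A + 1 - g" if "A \<in> divisors K" for A
    using min[OF that] \<gamma>[OF that] \<gamma>[OF A0] unfolding g_def by linarith
  \<comment> \<open>From this threshold on, the lower bound gives \<open>ell ?D \<ge> 1\<close> for
    the difference of \<open>A\<close> and \<open>A0\<close>.\<close>
  have "ell A = ddeg A + 1 - g" if A: "A \<in> divisors K" and deg: "ddeg A \<ge> ddeg A0 + g" for A
  proof -
    let ?D = "\<lambda>P. A P - A0 P"
    have D: "?D \<in> divisors K" by (rule divisors_diff[OF A A0])
    have "ell ?D > 0" using ge[OF D] deg ddeg_diff[OF A A0] by simp
    then obtain w where w: "w \<in> L ?D" "w \<noteq> 0" using ell_pos_imp[OF D] by blast
    let ?E = "\<lambda>P. A P - pdiv (inverse w) P"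
    have w': "inverse w \<noteq> 0" using w by simp
    have E: "?E \<in> divisors K" by (rule divisors_diff[OF A pdiv_divisor[OF w']])
    have "A0 \<le> ?E" using L_nonzero_effective(2)[OF D w] w(2) by (simp add: le_fun_def pdiv_inverse algebra_simps)
    from ell_le[OF A0 E this] have "ell ?E \<le> ell A0 + (ddeg ?E - ddeg A0)" .
    moreover have "ell ?E = ell A" by (rule ell_translate[OF A w'])
    moreover have "ddeg ?E = ddeg A" using ddeg_diff[OF A pdiv_divisor[OF w']] ddeg_pdiv[OF w'] by simp
    ultimately show ?thesis using ge[OF A] unfolding g_def by linarith
  qed
  thus ?thesis using ge by blast
qed

section \<open>Holomorphy rings and the number of places\<close>

definition point :: "'f set \<Rightarrow> int \<Rightarrow> 'f set \<Rightarrow> int" where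
  "point Q n P = (if P = Q then n else 0)"

lemma point_divisor: "Q \<in> places K \<Longrightarrow> point Q n \<in> divisors K"
  by (intro divisorsI[of "{Q}"]) (auto simp: point_def)

lemma ddeg_point: "ddeg (point Q n) = n * int (place_degree K Q)"
  by (subst ddeg_eq_sum[of "{Q}"]) (auto simp: point_def)

lemma diff_point_divisor: "D \<in> divisors K \<Longrightarrow> P \<in> places K \<Longrightarrow> (\<lambda>Q. D Q - point P 1 Q) \<in> divisors K"
  by (rule divisors_diff[OF _ point_divisor])

lemma ddeg_diff_point:
  "D \<in> divisors K \<Longrightarrow> P \<in> places K \<Longrightarrow> ddeg (\<lambda>Q. D Q - point P 1 Q) = ddeg D - int (place_degree K P)"
  by (simp add: ddeg_diff point_divisor ddeg_point)

text \<open>A large multiple of \<open>Q\<close> has \<open>ell > 1\<close>, so its space contains a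
  nonconstant element. That element must have a pole, and only \<open>Q\<close> is allowed.\<close>

lemma exists_single_pole:
  assumes Q: "Q \<in> places K"
  shows "\<exists>h. h \<notin> VR Q \<and> (\<forall>P\<in>places K - {Q}. h \<in> VR P)"
proof -
  obtain g where g: "\<forall>A\<in>divisors K. ell A \<ge> ddeg A + 1 - g" using riemann by blast
  define n where "n = \<bar>g\<bar> + 1"
  let ?D = "point Q n"
  have "n * 1 \<le> n * int (place_degree K Q)"
    using place_degree_pos[OF Q] by (intro mult_left_mono) (auto simp: n_def)
  moreover have "n \<ge> g + 1" unfolding n_def by simp
  ultimately have "ell ?D > 1"
    using bspec[OF g point_divisor[OF Q, of n]] ddeg_point[of Q n] by linarith
  hence "q ^ 1 < q ^ nat (ell ?D)" using q_ge_2 by (intro power_strict_increasing) auto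
  hence "card K < card (L ?D)" using card_L[OF point_divisor[OF Q]] by simp
  hence "\<not> L ?D \<subseteq> K" using card_mono[OF finite_K] by (metis not_le)
  then obtain h where h: "h \<in> L ?D" "h \<notin> K" by blast
  have reg: "h \<in> VR P" if "P \<in> places K" "P \<noteq> Q" for P
  proof -
    have "h \<in> pw P (- ?D P)" using h(1) that(1) unfolding L_iff by blast
    thus ?thesis using that pw_0[OF that(1)] by (simp add: point_def)
  qed
  have "h \<notin> L (\<lambda>_. 0)" using h(2) by (simp add: L_zero)
  then obtain P where "P \<in> places K" "h \<notin> VR P"
    unfolding L_iff by (auto simp: pw_0)
  thus ?thesis using reg by blast
qed

lemma subring_INT: "(\<And>P. P \<in> S \<Longrightarrow> is_subring (R P)) \<Longrightarrow> is_subring (\<Inter>P\<in>S. R P)"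
  by (simp add: is_subring_def)

lemma unimodular_iff:
  assumes S: "S \<subseteq> places K" "S \<noteq> {}" and f: "\<And>i. i < m \<Longrightarrow> f i \<in> holomorphy_ring K S"
  shows "generated_ideal (holomorphy_ring K S) m f = holomorphy_ring K S \<longleftrightarrow> (\<forall>P\<in>S. \<exists>i<m. f i \<notin> P)"
proof -
  let ?H = "holomorphy_ring K S"
  have H: "is_subring ?H"
    unfolding holomorphy_ring_def
    by (rule subring_INT) (use S VR_subring in blast)
  have KH: "K \<subseteq> ?H" unfolding holomorphy_ring_def using S K_subset_VR by blast
  show ?thesis
  proof
    assume eq: "generated_ideal ?H m f = ?H"
    have "1 \<in> generated_ideal ?H m f" unfolding eq by (rule subring_1[OF H])
    then obtain h where h: "1 = (\<Sum>i<m. h i * f i)" "\<forall>i<m. h i \<in> ?H"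
      unfolding generated_ideal_def by blast
    show "\<forall>P\<in>S. \<exists>i<m. f i \<notin> P"
    proof (rule ballI, rule ccontr)
      fix P assume P: "P \<in> S" and n: "\<not> (\<exists>i<m. f i \<notin> P)"
      have Pp: "P \<in> places K" using P S by blast
      have "(\<Sum>i<m. h i * f i) \<in> P"
        using n h(2) P by (intro ksub_sum[OF ksub_place[OF Pp]] place_mult[OF Pp])
          (auto simp: holomorphy_ring_def)
      thus False using h(1) one_notin_place[OF Pp] by simp
    qed
  next
    assume nv: "\<forall>P\<in>S. \<exists>i<m. f i \<notin> P"
    have "1 \<in> generated_ideal ?H m f"
    proof (rule ccontr)
      assume one: "1 \<notin> generated_ideal ?H m f"
      \<comment> \<open>The extension to a place asks for a nonzero generator; since 0 lies in every
        place, nonvanishing at one place of \<open>S\<close> provides it.\<close>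
      obtain P0 where "P0 \<in> S" using S by blast
      then obtain i where i: "i < m" "f i \<noteq> 0" using nv zero_in_place S by (metis subsetD)
      obtain P where P: "P \<in> places K" "?H \<subseteq> VR P" "\<forall>i<m. f i \<in> P"
        using place_over_ideal[OF H KH f i one] by blast
      have "P \<notin> S" using nv P(3) by blast
      moreover obtain h where h: "h \<notin> VR P" "\<forall>R\<in>places K - {P}. h \<in> VR R"
        using exists_single_pole[OF P(1)] by blast
      ultimately have "h \<in> ?H" unfolding holomorphy_ring_def using S by blast
      thus False using P(2) h(1) by blast
    qed
    hence "h \<in> generated_ideal ?H m f" if "h \<in> ?H" for h
      using generated_ideal_mult[OF H that, of 1 m f] by simp
    thus "generated_ideal ?H m f = ?H" using generated_ideal_subset[OF H, of m f] f by blast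
  qed
qed

text \<open>Where \<open>D P = 0\<close> the space only demands regularity, and lowering the
  coefficient by one demands vanishing. Thus tuples over \<open>L D\<close> that vanish at
  \<open>P\<close> are exactly the tuples over \<open>L(D - P)\<close>.\<close>

lemma L_diff_point_iff:
  assumes D: "D P = 0" and P: "P \<in> places K"
  shows "x \<in> L (\<lambda>Q. D Q - point P 1 Q) \<longleftrightarrow> x \<in> L D \<and> x \<in> P"
proof -
  have "x \<in> pw Q (- (D Q - point P 1 Q)) \<longleftrightarrow> x \<in> pw Q (- D Q) \<and> (Q = P \<longrightarrow> x \<in> P)"
    if "Q \<in> places K" for Q
    using D pw_0[OF P] pw_1[OF P] place_subset_VR[OF P] by (cases "Q = P") (auto simp: point_def)
  thus ?thesis unfolding L_iff using P by blast
qed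

text \<open>These places form the support of the effective divisor \<open>D + pdiv z\<close>, whose
  degree is \<open>ddeg D\<close>; each contributes at least 1.\<close>

lemma card_zeros_le:
  assumes D: "D \<in> divisors K" and z: "z \<in> L D" "z \<noteq> 0"
  shows "finite {P \<in> places K. D P + pdiv z P \<ge> 1}"
    and "int (card {P \<in> places K. D P + pdiv z P \<ge> 1}) \<le> ddeg D"
proof -
  let ?A = "\<lambda>P. D P + pdiv z P"
  note e = L_nonzero_effective[OF assms]
  show fin: "finite {P \<in> places K. ?A P \<ge> 1}"
    by (rule finite_subset[OF _ divisors_support[OF e(1)]]) auto
  have "int (card {P \<in> places K. ?A P \<ge> 1}) = (\<Sum>P\<in>{P \<in> places K. ?A P \<ge> 1}. 1)" by simp
  also have "\<dots> \<le> (\<Sum>P\<in>{P \<in> places K. ?A P \<ge> 1}. ?A P * int (place_degree K P))"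
  proof (rule sum_mono)
    fix P assume P: "P \<in> {P \<in> places K. ?A P \<ge> 1}"
    have "1 * 1 \<le> ?A P * int (place_degree K P)"
      using P place_degree_pos[of P] by (intro mult_mono) auto
    thus "1 \<le> ?A P * int (place_degree K P)" by simp
  qed
  also have "\<dots> = ddeg ?A"
  proof (rule ddeg_eq_sum[OF fin, symmetric])
    fix P assume n: "P \<notin> {P \<in> places K. ?A P \<ge> 1}"
    show "?A P = 0"
    proof (rule ccontr)
      assume nz: "?A P \<noteq> 0"
      hence "?A P \<ge> 1" using e(2)[of P] by linarith
      thus False using n divisors_places[OF e(1) nz] by blast
    qed
  qed
  finally show "int (card {P \<in> places K. ?A P \<ge> 1}) \<le> ddeg D" using e(3) by simp
qed

text \<open>For a fixed place \<open>Q\<close> and a suitable multiple of it, each place of degree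
  at most \<open>d\<close> is a zero, in the sense of \<open>card_zeros_le\<close>, of some nonzero
  element of \<open>L ?D\<close>. The bound is the number of such elements times the number of zeros
  of each.\<close>

lemma card_places_degree_le:
  "\<exists>c. \<forall>d. finite {P \<in> places K. place_degree K P \<le> d} \<and>
     card {P \<in> places K. place_degree K P \<le> d} \<le> (d + c) * q ^ (d + c + 1)"
proof -
  obtain w where "w \<notin> K" using exists_nonconstant by blast
  then obtain Q where Q: "Q \<in> places K" using place_exists by blast
  obtain g where g: "\<forall>A\<in>divisors K. ell A \<ge> ddeg A + 1 - g" using riemann by blast
  let ?e = "place_degree K Q"
  have e: "?e > 0" by (rule place_degree_pos[OF Q])
  define c where "c = nat \<bar>g\<bar> + ?e"
  have "finite {P \<in> places K. place_degree K P \<le> d} \<and>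
     card {P \<in> places K. place_degree K P \<le> d} \<le> (d + c) * q ^ (d + c + 1)" for d
  proof -
    \<comment> \<open>Chosen so that \<open>n * ?e\<close> lies between
      \<open>d + nat \<bar>g\<bar>\<close>, which makes \<open>ell ?E\<close> positive below, and
      \<open>d + c\<close>.\<close>
    define n where "n = (d + nat \<bar>g\<bar>) div ?e + 1"
    have n1: "n * ?e \<le> d + c" unfolding n_def c_def by simp
    have n2: "d + nat \<bar>g\<bar> \<le> n * ?e"
    proof -
      have "d + nat \<bar>g\<bar> = (d + nat \<bar>g\<bar>) div ?e * ?e + (d + nat \<bar>g\<bar>) mod ?e" by (rule div_mult_mod_eq[symmetric])
      also have "\<dots> \<le> (d + nat \<bar>g\<bar>) div ?e * ?e + ?e"
        using mod_less_divisor[OF e, of "d + nat \<bar>g\<bar>"] by linarith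
      finally show ?thesis by (simp add: n_def)
    qed
    let ?D = "point Q (int n)"
    have D: "?D \<in> divisors K" by (rule point_divisor[OF Q])
    have degD: "ddeg ?D = int (n * ?e)" by (simp add: ddeg_point)
    let ?Z = "\<lambda>z. {P \<in> places K. ?D P + pdiv z P \<ge> 1}"
    have sub: "{P \<in> places K. place_degree K P \<le> d} \<subseteq> (\<Union>z\<in>L ?D - {0}. ?Z z)"
    proof
      fix P assume "P \<in> {P \<in> places K. place_degree K P \<le> d}"
      hence P: "P \<in> places K" "place_degree K P \<le> d" by auto
      let ?E = "\<lambda>R. ?D R - point P 1 R"
      have "ell ?E > 0"
        using bspec[OF g diff_point_divisor[OF D P(1)]] ddeg_diff_point[OF D P(1)] degD n2 P(2) by linarith
      then obtain z where z: "z \<in> L ?E" "z \<noteq> 0" using ell_pos_imp[OF diff_point_divisor[OF D P(1)]] by blast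
      have "?E P + pdiv z P \<ge> 0" by (rule L_nonzero_effective(2)[OF diff_point_divisor[OF D P(1)] z])
      hence "P \<in> ?Z z" using P by (simp add: point_def)
      moreover have "z \<in> L ?D" 
      proof -
        have "?E \<le> ?D" by (simp add: le_fun_def point_def)
        from L_mono[OF this] show ?thesis using z(1) by blast
      qed
      ultimately show "P \<in> (\<Union>z\<in>L ?D - {0}. ?Z z)" using z(2) by blast
    qed
    have fin: "finite (\<Union>z\<in>L ?D - {0}. ?Z z)"
      using finite_L[OF D] card_zeros_le(1)[OF D] by auto
    have "card {P \<in> places K. place_degree K P \<le> d} \<le> card (\<Union>z\<in>L ?D - {0}. ?Z z)"
      by (rule card_mono[OF fin sub])
    also have "\<dots> \<le> (\<Sum>z\<in>L ?D - {0}. card (?Z z))"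
      using finite_L[OF D] by (intro card_UN_le) auto
    also have "\<dots> \<le> (\<Sum>z\<in>L ?D - {0}. n * ?e)"
    proof (rule sum_mono)
      fix z assume "z \<in> L ?D - {0}"
      hence "int (card (?Z z)) \<le> int (n * ?e)" using card_zeros_le(2)[OF D, of z] degD by simp
      thus "card (?Z z) \<le> n * ?e" by (simp only: of_nat_le_iff)
    qed
    also have "\<dots> \<le> n * ?e * card (L ?D)"
      using finite_L[OF D] card_mono[of "L ?D" "L ?D - {0}"] by simp
    also have "\<dots> \<le> (d + c) * q ^ (d + c + 1)"
    proof (rule mult_mono[OF n1])
      have "1 \<in> L ?D" using K_subset_VR subring_1[OF VR_subring] pw_antimono[of _ "- ?D _" 0]
        unfolding L_iff by (auto simp: point_def pw_def place_val_constant)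
      hence "ell ?D \<le> int (n * ?e) + 1" using ell_le_ddeg(2)[OF D, of 1] degD by simp
      hence "nat (ell ?D) \<le> d + c + 1" using n1 by linarith
      thus "card (L ?D) \<le> q ^ (d + c + 1)"
        unfolding card_L[OF D] using q_ge_2 by (intro power_increasing) auto
    qed auto
    finally show ?thesis using finite_subset[OF sub fin] by blast
  qed
  thus ?thesis by blast
qed

end

section \<open>Nets and infinite products\<close>

lemma eventually_net_filterI:
  assumes "D0 \<in> A" "\<And>E. E \<in> A \<Longrightarrow> D0 \<le> E \<Longrightarrow> Q E"
  shows "eventually Q (net_filter A)"
proof -
  have "net_filter A \<le> principal {E \<in> A. D0 \<le> E}"
    unfolding net_filter_def by (rule INF_lower[OF assms(1)])
  moreover have "eventually Q (principal {E \<in> A. D0 \<le> E})"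
    using assms(2) by (simp add: eventually_principal)
  ultimately show ?thesis by (rule filter_leD)
qed

text \<open>For a directed index set the members of the filter contain tails, and tails are
  nonempty. Nontriviality is what lets a limit determine both \<open>Limsup\<close> and
  \<open>Liminf\<close>.\<close>

lemma net_filter_neq_bot:
  assumes "A \<noteq> {}" "\<And>D E. D \<in> A \<Longrightarrow> E \<in> A \<Longrightarrow> \<exists>F\<in>A. D \<le> F \<and> E \<le> F"
  shows "net_filter A \<noteq> bot"
proof
  assume "net_filter A = bot"
  hence "eventually (\<lambda>_. False) (net_filter A)" by simp
  hence "\<exists>D\<in>A. eventually (\<lambda>_. False) (principal {E \<in> A. D \<le> E})"
    unfolding net_filter_def
  proof (subst (asm) eventually_INF_base)
    fix D E assume "D \<in> A" "E \<in> A"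
    then obtain F where "F \<in> A" "D \<le> F" "E \<le> F" using assms(2) by blast
    thus "\<exists>x\<in>A. principal {E \<in> A. x \<le> E} \<le> inf (principal {E \<in> A. D \<le> E}) (principal {Ea \<in> A. E \<le> Ea})"
      by (intro bexI[of _ F]) auto
  qed (use assms(1) in auto)
  thus False by (auto simp: eventually_principal)
qed

lemma has_density_if_tendsto:
  assumes "net_filter (effective_divisors_off K S) \<noteq> bot"
    and "(rr_proportion K m U \<longlongrightarrow> d) (net_filter (effective_divisors_off K S))"
  shows "has_density K S m U d"
proof -
  have "((\<lambda>D. ereal (rr_proportion K m U D)) \<longlongrightarrow> ereal d) (net_filter (effective_divisors_off K S))"
    using assms(2) by (rule tendsto_ereal)
  thus ?thesis
    unfolding has_density_def upper_density_def lower_density_def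
    using lim_imp_Limsup[OF assms(1)] lim_imp_Liminf[OF assms(1)] by blast
qed

section \<open>Unordered infinite products\<close>

lemma infprod_eqI:
  assumes "has_infprod f A p" shows "infprod f A = p"
  using assms unfolding has_infprod_def infprod_def by (intro tendsto_Lim) auto

text \<open>Logarithms reduce products to sums: \<open>0 \<le> - ln (1 - a x) \<le> 2 * a x\<close>
  for \<open>a x \<le> 1 / 2\<close>, so the logarithms are summable, and \<open>z\<close> is the
  exponential of their sum.\<close>

lemma has_infprod_inverse_one_minus:
  fixes a :: "'i \<Rightarrow> real"
  assumes a: "a summable_on A" "\<And>x. x \<in> A \<Longrightarrow> 0 \<le> a x" "\<And>x. x \<in> A \<Longrightarrow> a x \<le> 1 / 2"
  obtains z where "z > 0" "has_infprod (\<lambda>x. inverse (1 - a x)) A z"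
    "has_infprod (\<lambda>x. 1 - a x) A (1 / z)"
proof -
  have le: "- ln (1 - a x) \<le> 2 * a x" "0 \<le> - ln (1 - a x)" if "x \<in> A" for x
  proof -
    have "- ln (1 - a x) = ln (1 + a x / (1 - a x))"
      using a(2,3)[OF that] by (subst ln_inverse[symmetric]) (auto simp: field_simps)
    also have "\<dots> \<le> a x / (1 - a x)"
      using a(2,3)[OF that] by (intro ln_add_one_self_le_self) auto
    also have "\<dots> \<le> a x / (1 / 2)"
      using a(2,3)[OF that] by (intro divide_left_mono) auto
    finally show "- ln (1 - a x) \<le> 2 * a x" by simp
    show "0 \<le> - ln (1 - a x)" using a(2,3)[OF that] by simp
  qed
  have "(\<lambda>x. 2 * a x) summable_on A" using a(1) by (rule summable_on_cmult_right)
  hence "(\<lambda>x. - ln (1 - a x)) summable_on A"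
    by (rule summable_on_comparison_test) (rule le, assumption)+
  then obtain s where s: "((\<lambda>x. - ln (1 - a x)) has_sum s) A" unfolding summable_on_def by blast
  hence "((\<lambda>F. exp (\<Sum>x\<in>F. - ln (1 - a x))) \<longlongrightarrow> exp s) (finite_subsets_at_top A)"
    unfolding has_sum_def by (rule tendsto_exp)
  moreover have "\<forall>\<^sub>F F in finite_subsets_at_top A.
      exp (\<Sum>x\<in>F. - ln (1 - a x)) = (\<Prod>x\<in>F. inverse (1 - a x))"
  proof (rule eventually_finite_subsets_at_top_weakI)
    fix F assume F: "finite F" "F \<subseteq> A"
    show "exp (\<Sum>x\<in>F. - ln (1 - a x)) = (\<Prod>x\<in>F. inverse (1 - a x))"
      unfolding exp_sum[OF F(1)]
    proof (rule prod.cong[OF refl])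
      fix x assume "x \<in> F"
      hence "1 - a x > 0" using a(3)[of x] F by force
      thus "exp (- ln (1 - a x)) = inverse (1 - a x)" by (simp add: exp_minus)
    qed
  qed
  ultimately have 1: "has_infprod (\<lambda>x. inverse (1 - a x)) A (exp s)"
    unfolding has_infprod_def by (rule Lim_transform_eventually)
  hence "((\<lambda>F. inverse (\<Prod>x\<in>F. inverse (1 - a x))) \<longlongrightarrow> inverse (exp s)) (finite_subsets_at_top A)"
    unfolding has_infprod_def by (rule tendsto_inverse) simp
  moreover have "inverse (\<Prod>x\<in>F. inverse (1 - a x)) = (\<Prod>x\<in>F. 1 - a x)" for F
    by (simp add: prod_inversef[symmetric] comp_def)
  ultimately have 2: "has_infprod (\<lambda>x. 1 - a x) A (1 / exp s)"
    unfolding has_infprod_def by (simp add: inverse_eq_divide)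
  show ?thesis by (rule that[OF _ 1 2]) simp
qed

section \<open>The density of unimodular tuples\<close>

context function_field
begin

text \<open>The term \<open>T ^ deg P\<close> of the Euler factor at \<open>T = q ^ (- m)\<close>;
  also the proportion of the zero tuple among the \<open>m\<close>-tuples over the residue field of
  \<open>P\<close>.\<close>

definition norm_weight :: "nat \<Rightarrow> 'f set \<Rightarrow> real" where
  "norm_weight m P = 1 / real q ^ (m * place_degree K P)"

lemma norm_weight_pos: "norm_weight m P > 0"
  using q_ge_2 by (simp add: norm_weight_def)

lemma norm_weight_le_half:
  assumes "P \<in> places K" "m \<ge> 2" shows "norm_weight m P \<le> 1 / 2"
proof -
  have q2: "real q \<ge> 2" using q_ge_2 by simp
  also have "real q = real q ^ 1" by simp
  also have "\<dots> \<le> real q ^ (m * place_degree K P)"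
    using q_ge_2 place_degree_pos[OF assms(1)] assms(2) by (intro power_increasing) (auto simp: Suc_leI)
  finally show ?thesis unfolding norm_weight_def by (intro frac_le) auto
qed

lemma zeta_factor_eq: "zeta_factor K (real q powi (- int m)) P = inverse (1 - norm_weight m P)"
  by (simp add: zeta_factor_def norm_weight_def power_int_minus power_mult power_inverse inverse_eq_divide power_one_over)

text \<open>Places are grouped by degree. The number of places of degree \<open>d\<close> grows at
  most like \<open>d * q ^ d\<close>, so for \<open>m \<ge> 2\<close> their total weight is at most
  a linear factor times \<open>q ^ (- d)\<close>.\<close>

lemma norm_weight_summable:
  assumes m: "m \<ge> 2"
  shows "norm_weight m summable_on places K"
proof (rule nonneg_bdd_above_summable_on)
  obtain c where c: "\<And>d. finite {P \<in> places K. place_degree K P \<le> d}"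
    "\<And>d. card {P \<in> places K. place_degree K P \<le> d} \<le> (d + c) * q ^ (d + c + 1)"
    using card_places_degree_le by metis
  define B where "B = 2 * (1 + real c) * real q ^ (c + 1)"
  have q2: "real q \<ge> 2" using q_ge_2 by simp
  have weight_le: "real (card {P \<in> places K. place_degree K P = d}) * (1 / real q ^ (m * d)) \<le> B * (3 / 4) ^ d" for d
  proof -
    have "card {P \<in> places K. place_degree K P = d} \<le> card {P \<in> places K. place_degree K P \<le> d}"
      by (rule card_mono[OF c(1)]) auto
    also note c(2)
    finally have "real (card {P \<in> places K. place_degree K P = d}) \<le> real ((d + c) * q ^ (d + c + 1))"
      by (rule of_nat_mono)
    also have "\<dots> = (real d + real c) * (real q ^ d * real q ^ (c + 1))" by (simp add: power_add mult_ac)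
    finally have card: "real (card {P \<in> places K. place_degree K P = d})
        \<le> (real d + real c) * (real q ^ d * real q ^ (c + 1))" .
    have "real q ^ (2 * d) \<le> real q ^ (m * d)" using m q2 by (intro power_increasing) auto
    hence "1 / real q ^ (m * d) \<le> 1 / real q ^ (2 * d)" using q2 by (intro divide_left_mono) auto
    hence "real (card {P \<in> places K. place_degree K P = d}) * (1 / real q ^ (m * d))
        \<le> (real d + real c) * (real q ^ d * real q ^ (c + 1)) * (1 / real q ^ (2 * d))"
      by (intro mult_mono[OF card]) auto
    also have "\<dots> = (real d + real c) * real q ^ (c + 1) * (1 / real q) ^ d"
      using q2 by (simp add: power_mult power2_eq_square power_divide field_simps power_mult_distrib)
    also have "\<dots> \<le> (2 * (1 + real c) * (3 / 2) ^ d) * real q ^ (c + 1) * (1 / 2) ^ d"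
    proof (intro mult_mono power_mono)
      \<comment> \<open>Bernoulli's inequality absorbs the linear factor into
        \<open>(3 / 2) ^ d\<close>, which against \<open>(1 / 2) ^ d\<close> leaves the ratio
        \<open>3 / 4\<close>.\<close>
      have "1 + real d * (1 / 2) \<le> (1 + 1 / 2) ^ d" by (rule Bernoulli_inequality) simp
      hence "2 + real d \<le> 2 * (3 / 2) ^ d" by simp
      hence "(1 + real c) * (2 + real d) \<le> (1 + real c) * (2 * (3 / 2) ^ d)" by (intro mult_left_mono) auto
      also have "\<dots> = 2 * (1 + real c) * (3 / 2) ^ d" by (simp only: mult_ac)
      finally show "real d + real c \<le> 2 * (1 + real c) * (3 / 2) ^ d"
        by (rule order.trans[rotated]) (simp add: algebra_simps)
    qed (use q2 in \<open>auto simp: frac_le\<close>)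
    also have "\<dots> = B * (3 / 4) ^ d"
      unfolding B_def by (simp add: power_divide power_mult_distrib[symmetric])
    finally show ?thesis .
  qed
  have "sum (norm_weight m) F \<le> 4 * B" if F: "finite F" "F \<subseteq> places K" for F
  proof -
    define M where "M = Suc (\<Sum>P\<in>F. place_degree K P)"
    have M: "place_degree K P < M" if "P \<in> F" for P
      unfolding M_def using member_le_sum[of P F "place_degree K"] F that by simp
    have "sum (norm_weight m) F = (\<Sum>d<M. \<Sum>P\<in>{P \<in> F. place_degree K P = d}. norm_weight m P)"
      using M F by (intro sum.group[symmetric]) auto
    also have "\<dots> = (\<Sum>d<M. real (card {P \<in> F. place_degree K P = d}) * (1 / real q ^ (m * d)))"
      by (intro sum.cong refl) (simp add: norm_weight_def)
    also have "\<dots> \<le> (\<Sum>d<M. B * (3 / 4) ^ d)"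
    proof (rule sum_mono)
      fix d
      have "card {P \<in> F. place_degree K P = d} \<le> card {P \<in> places K. place_degree K P = d}"
        using F by (intro card_mono finite_subset[OF _ c(1)[of d]]) auto
      hence "real (card {P \<in> F. place_degree K P = d}) * (1 / real q ^ (m * d)) \<le>
          real (card {P \<in> places K. place_degree K P = d}) * (1 / real q ^ (m * d))"
        by (intro mult_right_mono) auto
      also note weight_le
      finally show "real (card {P \<in> F. place_degree K P = d}) * (1 / real q ^ (m * d)) \<le> B * (3 / 4) ^ d" .
    qed
    also have "\<dots> = B * (\<Sum>d<M. (3 / 4) ^ d)" by (simp add: sum_distrib_left)
    also have "(\<Sum>d<M. (3 / 4) ^ d) = 4 * (1 - (3 / 4 :: real) ^ M)"
      by (subst sum_gp_strict) simp
    also have "B * (4 * (1 - (3 / 4) ^ M)) \<le> B * (4 * 1)"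
      unfolding B_def by (intro mult_left_mono) auto
    finally show ?thesis by simp
  qed
  thus "bdd_above (sum (norm_weight m) ` {F. F \<subseteq> places K \<and> finite F})"
    by (intro bdd_aboveI2[of _ _ "4 * B"]) auto
qed (use norm_weight_pos in \<open>auto simp: less_imp_le\<close>)

section \<open>Counting tuples by their common zeros\<close>

definition nonvanishing :: "nat \<Rightarrow> 'f set set \<Rightarrow> ('f set \<Rightarrow> int) \<Rightarrow> (nat \<Rightarrow> 'f) set" where
  "nonvanishing m T D = {f \<in> {..<m} \<rightarrow>\<^sub>E L D. \<forall>P\<in>T. \<exists>i<m. f i \<notin> P}"

lemma finite_tuples: "D \<in> divisors K \<Longrightarrow> finite ({..<m::nat} \<rightarrow>\<^sub>E L D)"
  by (intro finite_PiE) (auto simp: finite_L)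

lemma card_tuples: "card ({..<m::nat} \<rightarrow>\<^sub>E L D) = card (L D) ^ m"
  by (simp add: card_PiE)

text \<open>Induction on \<open>T\<close>: among the tuples nonvanishing on \<open>T\<close>, those
  vanishing at \<open>P\<close> are the tuples over \<open>L(D - P)\<close> nonvanishing on
  \<open>T\<close>, and the induction hypothesis counts both.\<close>

lemma card_nonvanishing:
  assumes c: "\<And>A. A \<in> divisors K \<Longrightarrow> ddeg A \<ge> c \<Longrightarrow> ell A = ddeg A + 1 - g"
    and T: "finite T" "T \<subseteq> places K" and D: "D \<in> divisors K" "\<And>P. P \<in> T \<Longrightarrow> D P = 0"
    and deg: "ddeg D \<ge> c + int (\<Sum>P\<in>T. place_degree K P)"
  shows "real (card (nonvanishing m T D)) = real (card (L D)) ^ m * (\<Prod>P\<in>T. 1 - norm_weight m P)"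
  using T D deg
proof (induction T arbitrary: D)
  case empty
  have "nonvanishing m {} D = {..<m} \<rightarrow>\<^sub>E L D" by (auto simp: nonvanishing_def)
  thus ?case by (simp add: card_tuples)
next
  case (insert P T)
  have P: "P \<in> places K" using insert.prems by blast
  let ?E = "\<lambda>Q. D Q - point P 1 Q"
  have E: "?E \<in> divisors K" by (rule diff_point_divisor[OF insert.prems(2) P])
  have DP: "D P = 0" using insert.prems(3) by simp
  have degE: "ddeg ?E = ddeg D - int (place_degree K P)" by (rule ddeg_diff_point[OF insert.prems(2) P])
  \<comment> \<open>The share of \<open>P\<close> in the reserved degree pays for the passage to
    \<open>?E\<close>, so both divisors stay above the threshold \<open>c\<close>.\<close>
  have deg: "ddeg D \<ge> c + int (place_degree K P) + int (\<Sum>P\<in>T. place_degree K P)"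
    using insert.prems(4) insert.hyps by simp
  have in_PiE: "f \<in> {..<m} \<rightarrow>\<^sub>E L ?E \<longleftrightarrow> f \<in> {..<m} \<rightarrow>\<^sub>E L D \<and> (\<forall>i<m. f i \<in> P)" for f
    using L_diff_point_iff[of D P, OF DP P] by (auto simp: PiE_iff)
  define A where "A = {..<m} \<rightarrow>\<^sub>E L D"
  define V where "V P f \<longleftrightarrow> (\<exists>i<m. f i \<notin> P)" for P and f :: "nat \<Rightarrow> 'f"
  have nvD: "nonvanishing m X D = {f \<in> A. \<forall>P\<in>X. V P f}" for X
    by (simp add: nonvanishing_def A_def V_def)
  have nvE: "nonvanishing m T ?E = {f \<in> A. \<not> V P f \<and> (\<forall>P\<in>T. V P f)}"
    by (simp add: nonvanishing_def in_PiE A_def V_def)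
  have eq: "nonvanishing m (insert P T) D = nonvanishing m T D - nonvanishing m T ?E"
    unfolding nvD nvE by blast
  have sub: "nonvanishing m T ?E \<subseteq> nonvanishing m T D"
    unfolding nvD nvE by blast
  have fin: "finite (nonvanishing m T D)"
    unfolding nonvanishing_def using finite_tuples[OF insert.prems(2)] by simp
  have "real (card (nonvanishing m (insert P T) D)) =
      real (card (nonvanishing m T D)) - real (card (nonvanishing m T ?E))"
    unfolding eq using card_Diff_subset[OF finite_subset[OF sub fin] sub] card_mono[OF fin sub]
    by (simp add: of_nat_diff)
  also have "real (card (nonvanishing m T D)) = real (card (L D)) ^ m * (\<Prod>P\<in>T. 1 - norm_weight m P)"
    using insert.prems deg by (intro insert.IH) auto
  also have "real (card (nonvanishing m T ?E)) = real (card (L ?E)) ^ m * (\<Prod>P\<in>T. 1 - norm_weight m P)"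
    using insert.prems insert.hyps deg degE E by (intro insert.IH) (auto simp: point_def)
  also have "real (card (L ?E)) ^ m = real (card (L D)) ^ m * norm_weight m P"
  proof -
    have "ell ?E = ell D - int (place_degree K P)"
      using c[OF insert.prems(2)] c[OF E] degE deg by simp
    hence "nat (ell D) = nat (ell ?E) + place_degree K P" using ell_nonneg[of ?E] by linarith
    hence "real (card (L D)) = real (card (L ?E)) * real q ^ place_degree K P"
      by (simp add: card_L[OF insert.prems(2)] card_L[OF E] power_add)
    thus ?thesis using q_ge_2
      by (simp add: norm_weight_def power_mult_distrib mult.commute[of m] power_mult)
  qed
  finally show ?case using insert.hyps by (simp add: algebra_simps)
qed

text \<open>The summand 1 is the zero tuple. For other tuples \<open>ell_le_ddeg\<close> applies to
  \<open>?E P\<close> in every degree, and comparison with the lower bound for \<open>ell D\<close>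
  loses at most a factor \<open>q ^ nat \<bar>g\<bar>\<close> per coordinate.\<close>

lemma card_vanishing_le:
  assumes g: "\<And>A. A \<in> divisors K \<Longrightarrow> ell A \<ge> ddeg A + 1 - g"
    and T: "T \<subseteq> places K" and D: "D \<in> divisors K" "\<And>P. P \<in> T \<Longrightarrow> D P = 0"
    and summ: "norm_weight m summable_on T"
  shows "real (card (({..<m} \<rightarrow>\<^sub>E L D) - nonvanishing m T D)) \<le>
    1 + real (card (L D)) ^ m * (real q ^ (m * nat \<bar>g\<bar>) * infsum (norm_weight m) T)"
proof -
  let ?G = "nat \<bar>g\<bar>"
  \<comment> \<open>Only zeros of nonzero elements of the finite set \<open>L D\<close> can occur,
    so the union runs over a finite \<open>F\<close> even when \<open>T\<close> is infinite.\<close>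
  define F where "F = (\<Union>z\<in>L D - {0}. {P \<in> T. z \<in> P})"
  let ?E = "\<lambda>P Q. D Q - point P 1 Q"
  have finF: "finite F"
    unfolding F_def using finite_L[OF D(1)] T
    by (intro finite_UN_I) (auto intro: finite_subset[OF _ finite_zeros])
  have FT: "F \<subseteq> T" unfolding F_def by blast
  have sub: "({..<m} \<rightarrow>\<^sub>E L D) - nonvanishing m T D \<subseteq>
      insert (\<lambda>i\<in>{..<m}. 0) (\<Union>P\<in>F. {..<m} \<rightarrow>\<^sub>E L (?E P))"
  proof
    fix f assume f: "f \<in> ({..<m} \<rightarrow>\<^sub>E L D) - nonvanishing m T D"
    then obtain P where P: "P \<in> T" "\<forall>i<m. f i \<in> P" unfolding nonvanishing_def by blast
    have fD: "f \<in> {..<m} \<rightarrow>\<^sub>E L D" using f by blast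
    show "f \<in> insert (\<lambda>i\<in>{..<m}. 0) (\<Union>P\<in>F. {..<m} \<rightarrow>\<^sub>E L (?E P))"
    proof (cases "\<forall>i<m. f i = 0")
      case True
      hence "f = (\<lambda>i\<in>{..<m}. 0)" by (intro PiE_ext[OF fD]) (auto simp: ksub_0[OF ksub_L])
      thus ?thesis by blast
    next
      case False
      then obtain i where i: "i < m" "f i \<noteq> 0" by blast
      hence "f i \<in> L D - {0}" using fD by auto
      hence "P \<in> F" unfolding F_def using P i by blast
      moreover have "f \<in> {..<m} \<rightarrow>\<^sub>E L (?E P)"
        using fD P L_diff_point_iff[of D P, OF D(2)[OF P(1)]] T by (auto simp: PiE_iff)
      ultimately show ?thesis by blast
    qed
  qed
  have Ediv: "?E P \<in> divisors K" if "P \<in> F" for P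
    using that FT T by (intro diff_point_divisor[OF D(1)]) auto
  have fin: "finite (\<Union>P\<in>F. {..<m} \<rightarrow>\<^sub>E L (?E P))"
    using finF Ediv finite_tuples by blast
  have "card (({..<m} \<rightarrow>\<^sub>E L D) - nonvanishing m T D) \<le>
      card (insert (\<lambda>i\<in>{..<m}. 0) (\<Union>P\<in>F. {..<m} \<rightarrow>\<^sub>E L (?E P)))"
    using fin by (intro card_mono[OF _ sub]) auto
  also have "\<dots> \<le> Suc (card (\<Union>P\<in>F. {..<m} \<rightarrow>\<^sub>E L (?E P)))" by (rule card_insert_le_m1) auto
  also have "card (\<Union>P\<in>F. {..<m} \<rightarrow>\<^sub>E L (?E P)) \<le> (\<Sum>P\<in>F. card (L (?E P)) ^ m)"
    using card_UN_le[OF finF, of "\<lambda>P. {..<m} \<rightarrow>\<^sub>E L (?E P)"] by (simp add: card_tuples)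
  finally have "real (card (({..<m} \<rightarrow>\<^sub>E L D) - nonvanishing m T D)) \<le> real (Suc (\<Sum>P\<in>F. card (L (?E P)) ^ m))"
    by (simp only: of_nat_mono Suc_le_mono)
  also have "\<dots> = 1 + (\<Sum>P\<in>F. real (card (L (?E P))) ^ m)" by simp
  also have "(\<Sum>P\<in>F. real (card (L (?E P))) ^ m) \<le>
      (\<Sum>P\<in>F. real (card (L D)) ^ m * (real q ^ (m * ?G) * norm_weight m P))"
  proof (rule sum_mono)
    fix P assume PF: "P \<in> F"
    hence P: "P \<in> places K" "P \<in> T" using FT T by auto
    obtain z where z: "z \<in> L D" "z \<noteq> 0" "z \<in> P" using PF unfolding F_def by blast
    have "z \<in> L (?E P)" using L_diff_point_iff[of D P] D(2) P z by simp
    from ell_le_ddeg(2)[OF Ediv[OF PF] this z(2)]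
    have "ell (?E P) \<le> ell D + g - int (place_degree K P)"
      using ddeg_diff_point[OF D(1) P(1)] g[OF D(1)] by linarith
    hence "nat (ell (?E P)) + place_degree K P \<le> nat (ell D) + ?G"
      using ell_nonneg[of D] ell_nonneg[of "?E P"] by linarith
    hence "q ^ (nat (ell (?E P)) + place_degree K P) \<le> q ^ (nat (ell D) + ?G)"
      using q_ge_2 by (intro power_increasing) auto
    hence "real (card (L (?E P)) * q ^ place_degree K P) \<le> real (card (L D) * q ^ ?G)"
      unfolding card_L[OF D(1)] card_L[OF Ediv[OF PF]] power_add by (rule of_nat_mono)
    hence "(real (card (L (?E P))) * real q ^ place_degree K P) ^ m \<le> (real (card (L D)) * real q ^ ?G) ^ m"
      by (intro power_mono) auto
    hence "real (card (L (?E P))) ^ m * real q ^ (m * place_degree K P) \<le>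
        real (card (L D)) ^ m * real q ^ (m * ?G)"
      by (simp only: power_mult_distrib power_mult[symmetric] mult.commute[of "place_degree K P" m]
          mult.commute[of ?G m])
    moreover have "real q ^ (m * place_degree K P) > 0" using q_ge_2 by simp
    ultimately show "real (card (L (?E P))) ^ m \<le> real (card (L D)) ^ m * (real q ^ (m * ?G) * norm_weight m P)"
      unfolding norm_weight_def by (simp only: pos_le_divide_eq times_divide_eq_right mult_1_right)
  qed
  also have "\<dots> = real (card (L D)) ^ m * (real q ^ (m * ?G) * sum (norm_weight m) F)"
    by (simp add: sum_distrib_left)
  also have "\<dots> \<le> real (card (L D)) ^ m * (real q ^ (m * ?G) * infsum (norm_weight m) T)"
    using norm_weight_pos
    by (intro mult_left_mono finite_sum_le_infsum[OF summ finF FT]) (auto simp: less_imp_le)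
  finally show ?thesis by simp
qed

text \<open>Nonvanishing on \<open>S\<close> implies nonvanishing on \<open>T\<close>, which gives
  the upper bound; the tuples lost in passing from \<open>T\<close> to \<open>S\<close> vanish
  somewhere on \<open>S - T\<close>, which gives the lower one.\<close>

lemma rr_proportion_bounds:
  assumes S: "S \<noteq> {}" "S \<subseteq> places K" and m: "m \<ge> 2" and T: "finite T" "T \<subseteq> S"
    and D: "D \<in> effective_divisors_off K S"
    and g: "\<And>A. A \<in> divisors K \<Longrightarrow> ell A \<ge> ddeg A + 1 - g"
    and c: "\<And>A. A \<in> divisors K \<Longrightarrow> ddeg A \<ge> c \<Longrightarrow> ell A = ddeg A + 1 - g"
    and deg: "ddeg D \<ge> c + int (\<Sum>P\<in>T. place_degree K P)"
  defines "p \<equiv> rr_proportion K m (unimodular_tuples (holomorphy_ring K S) m) D"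
  shows "p \<le> (\<Prod>P\<in>T. 1 - norm_weight m P)"
    and "(\<Prod>P\<in>T. 1 - norm_weight m P) - 1 / real (card (L D)) -
      real q ^ (m * nat \<bar>g\<bar>) * infsum (norm_weight m) (S - T) \<le> p"
proof -
  have Dd: "D \<in> divisors K" and D0: "\<And>P. P \<in> S \<Longrightarrow> D P = 0"
    using D unfolding effective_divisors_off_def by auto
  let ?H = "holomorphy_ring K S" and ?N = "real (card (L D)) ^ m"
  have LH: "L D \<subseteq> ?H"
    using S(2) D0 pw_0 unfolding holomorphy_ring_def L_iff subset_iff by (auto dest!: bspec)
  have N1: "real (card (L D)) \<ge> 1"
    using finite_L[OF Dd] ksub_0[OF ksub_L, of D] by (auto simp: Suc_le_eq card_gt_0_iff)
  have Npos: "?N > 0" using N1 by simp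
  have "unimodular_tuples ?H m \<inter> ({..<m} \<rightarrow>\<^sub>E L D) = nonvanishing m S D"
  proof (rule set_eqI)
    fix f
    show "f \<in> unimodular_tuples ?H m \<inter> ({..<m} \<rightarrow>\<^sub>E L D) \<longleftrightarrow> f \<in> nonvanishing m S D"
    proof (cases "f \<in> {..<m} \<rightarrow>\<^sub>E L D")
      case True
      hence fH: "f \<in> {..<m} \<rightarrow>\<^sub>E ?H" using LH by (auto simp: PiE_iff)
      hence "f i \<in> ?H" if "i < m" for i using that by auto
      from unimodular_iff[OF S(2,1), of m f, OF this] fH True show ?thesis
        by (simp add: unimodular_tuples_def nonvanishing_def)
    qed (simp add: nonvanishing_def)
  qed
  hence p: "p = real (card (nonvanishing m S D)) / ?N"
    unfolding p_def rr_proportion_def by (simp add: card_tuples)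
  have fin: "finite (nonvanishing m X D)" for X
    unfolding nonvanishing_def using finite_tuples[OF Dd] by simp
  have cnt: "real (card (nonvanishing m T D)) = ?N * (\<Prod>P\<in>T. 1 - norm_weight m P)"
    using T S D0 by (intro card_nonvanishing[OF c T(1) _ Dd _ deg]) auto
  have "card (nonvanishing m S D) \<le> card (nonvanishing m T D)"
    using T by (intro card_mono fin) (auto simp: nonvanishing_def)
  hence "p \<le> real (card (nonvanishing m T D)) / ?N"
    unfolding p using Npos by (intro divide_right_mono) auto
  also have "\<dots> = (\<Prod>P\<in>T. 1 - norm_weight m P)"
    unfolding cnt using Npos by (intro nonzero_mult_div_cancel_left) simp
  finally show "p \<le> (\<Prod>P\<in>T. 1 - norm_weight m P)" .
  have "nonvanishing m T D \<subseteq> nonvanishing m S D \<union> (({..<m} \<rightarrow>\<^sub>E L D) - nonvanishing m (S - T) D)"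
  proof
    fix f assume f: "f \<in> nonvanishing m T D"
    hence "f \<in> {..<m} \<rightarrow>\<^sub>E L D" by (simp add: nonvanishing_def)
    moreover have "f \<in> nonvanishing m S D" if "f \<in> nonvanishing m (S - T) D"
      using f that T(2) by (auto simp: nonvanishing_def)
    ultimately show "f \<in> nonvanishing m S D \<union> (({..<m} \<rightarrow>\<^sub>E L D) - nonvanishing m (S - T) D)"
      by (simp only: Un_iff Diff_iff) argo
  qed
  hence "card (nonvanishing m T D) \<le>
      card (nonvanishing m S D \<union> (({..<m} \<rightarrow>\<^sub>E L D) - nonvanishing m (S - T) D))"
    by (intro card_mono) (auto simp: fin finite_tuples[OF Dd])
  also have "\<dots> \<le> card (nonvanishing m S D) + card (({..<m} \<rightarrow>\<^sub>E L D) - nonvanishing m (S - T) D)"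
    by (rule card_Un_le)
  finally have "real (card (nonvanishing m T D)) \<le> real (card (nonvanishing m S D)) +
      real (card (({..<m} \<rightarrow>\<^sub>E L D) - nonvanishing m (S - T) D))"
    by (metis of_nat_add of_nat_mono)
  moreover have "real (card (({..<m} \<rightarrow>\<^sub>E L D) - nonvanishing m (S - T) D)) \<le>
      1 + ?N * (real q ^ (m * nat \<bar>g\<bar>) * infsum (norm_weight m) (S - T))"
    using m S D0
    by (intro card_vanishing_le[OF g _ Dd] summable_on_subset_banach[OF norm_weight_summable[OF m]]) auto
  ultimately have "?N * (\<Prod>P\<in>T. 1 - norm_weight m P) \<le>
      p * ?N + 1 + ?N * (real q ^ (m * nat \<bar>g\<bar>) * infsum (norm_weight m) (S - T))"
    using cnt Npos unfolding p by simp
  hence "?N * ((\<Prod>P\<in>T. 1 - norm_weight m P) -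
      real q ^ (m * nat \<bar>g\<bar>) * infsum (norm_weight m) (S - T) - p) \<le> 1"
    by (simp add: algebra_simps)
  hence "(\<Prod>P\<in>T. 1 - norm_weight m P) -
      real q ^ (m * nat \<bar>g\<bar>) * infsum (norm_weight m) (S - T) - p \<le> 1 / ?N"
    using Npos by (simp add: field_simps)
  also have "1 / ?N \<le> 1 / real (card (L D))"
    using N1 m self_le_power[of "real (card (L D))" m] by (intro divide_left_mono) auto
  finally show "(\<Prod>P\<in>T. 1 - norm_weight m P) - 1 / real (card (L D)) -
      real q ^ (m * nat \<bar>g\<bar>) * infsum (norm_weight m) (S - T) \<le> p" by simp
qed

section \<open>Passage to the limit along the net\<close>

lemma net_effective_divisors_neq_bot: "net_filter (effective_divisors_off K S) \<noteq> bot"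
proof (rule net_filter_neq_bot)
  have "(\<lambda>_. 0) \<in> effective_divisors_off K S"
    by (simp add: effective_divisors_off_def zero_divisor)
  thus "effective_divisors_off K S \<noteq> {}" by blast
  fix D E assume DE: "D \<in> effective_divisors_off K S" "E \<in> effective_divisors_off K S"
  let ?F = "\<lambda>P. D P + E P"
  have "?F \<in> divisors K" using DE by (intro divisors_add) (auto simp: effective_divisors_off_def)
  moreover have "{P. ?F P \<noteq> 0} \<subseteq> {P. D P \<noteq> 0} \<union> {P. E P \<noteq> 0}" by auto
  ultimately have "?F \<in> effective_divisors_off K S" using DE unfolding effective_divisors_off_def by fastforce
  moreover have "D \<le> ?F" "E \<le> ?F" using DE by (auto simp: le_fun_def effective_divisors_off_def)
  ultimately show "\<exists>F\<in>effective_divisors_off K S. D \<le> F \<and> E \<le> F" by blast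
qed

text \<open>Here \<open>S\<close> being a proper subset enters: a large multiple of a place outside
  \<open>S\<close> is an admissible index, and the degree is monotone above it.\<close>

lemma eventually_ddeg_ge:
  assumes "S \<subset> places K"
  shows "\<forall>\<^sub>F D in net_filter (effective_divisors_off K S). ddeg D \<ge> n"
proof -
  obtain Q where Q: "Q \<in> places K" "Q \<notin> S" using assms by blast
  let ?D0 = "point Q \<bar>n\<bar>"
  show ?thesis
  proof (rule eventually_net_filterI)
    show "?D0 \<in> effective_divisors_off K S"
      using Q point_divisor[OF Q(1)] by (auto simp: effective_divisors_off_def point_def)
    fix D assume "D \<in> effective_divisors_off K S" "?D0 \<le> D"
    hence "ddeg ?D0 \<le> ddeg D"
      by (intro ddeg_mono point_divisor[OF Q(1)]) (auto simp: effective_divisors_off_def)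
    moreover have "\<bar>n\<bar> * 1 \<le> \<bar>n\<bar> * int (place_degree K Q)"
      using place_degree_pos[OF Q(1)] by (intro mult_left_mono) auto
    ultimately show "n \<le> ddeg D" by (simp add: ddeg_point)
  qed
qed

lemma eventually_card_L_large:
  assumes "S \<subset> places K" "\<epsilon> > 0"
  shows "\<forall>\<^sub>F D in net_filter (effective_divisors_off K S). 1 / real (card (L D)) < \<epsilon>"
proof -
  obtain g where g: "\<forall>A\<in>divisors K. ell A \<ge> ddeg A + 1 - g" using riemann by blast
  obtain k :: nat where k: "1 / \<epsilon> < real k" using reals_Archimedean2 by blast
  have off: "\<forall>\<^sub>F D in net_filter (effective_divisors_off K S). D \<in> effective_divisors_off K S"
    by (rule eventually_net_filterI[of "\<lambda>_. 0"]) (simp_all add: effective_divisors_off_def zero_divisor)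
  from eventually_ddeg_ge[OF assms(1), of "int k + g"] off show ?thesis
  proof eventually_elim
    case (elim D)
    hence D: "D \<in> divisors K" by (simp add: effective_divisors_off_def)
    have "k \<le> nat (ell D)" using bspec[OF g D] elim(1) by linarith
    also have "nat (ell D) < card (L D)"
      unfolding card_L[OF D] using q_ge_2 by (intro power_gt_expt) simp
    finally have "real k < real (card (L D))" by simp
    hence "1 / \<epsilon> < real (card (L D))" using k by simp
    moreover have "real (card (L D)) > 0" using \<open>real k < real (card (L D))\<close> by linarith
    ultimately show ?case using assms(2) by (simp add: field_simps)
  qed
qed

text \<open>The error is split into thirds: the partial product over \<open>T\<close>, the tail over
  \<open>S - T\<close>, and the zero tuple. \<open>T\<close> is fixed before \<open>D\<close>,
  because the degree that the exact count demands of \<open>D\<close> depends on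
  \<open>T\<close>.\<close>

theorem density_unimodular:
  assumes S: "S \<noteq> {}" "S \<subset> places K" and m: "m \<ge> 2"
    and z: "has_infprod (\<lambda>P. 1 - norm_weight m P) S d"
  shows "has_density K S m (unimodular_tuples (holomorphy_ring K S) m) d"
proof (rule has_density_if_tendsto[OF net_effective_divisors_neq_bot], rule tendstoI)
  let ?A = "effective_divisors_off K S" and ?p = "rr_proportion K m (unimodular_tuples (holomorphy_ring K S) m)"
  fix \<epsilon> :: real assume \<epsilon>: "\<epsilon> > 0"
  have Sp: "S \<subseteq> places K" using S by blast
  obtain g c where g: "\<And>A. A \<in> divisors K \<Longrightarrow> ell A \<ge> ddeg A + 1 - g"
    and c: "\<And>A. A \<in> divisors K \<Longrightarrow> ddeg A \<ge> c \<Longrightarrow> ell A = ddeg A + 1 - g"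
    using riemann by metis
  define C where "C = real q ^ (m * nat \<bar>g\<bar>)"
  have C: "C > 0" unfolding C_def using q_ge_2 by simp
  have summ: "norm_weight m summable_on S"
    by (rule summable_on_subset_banach[OF norm_weight_summable[OF m] Sp])
  have 1: "\<forall>\<^sub>F T in finite_subsets_at_top S. dist (\<Prod>P\<in>T. 1 - norm_weight m P) d < \<epsilon> / 3"
    using z \<epsilon> unfolding has_infprod_def by (intro tendstoD) auto
  have 2: "\<forall>\<^sub>F T in finite_subsets_at_top S. dist (sum (norm_weight m) T) (infsum (norm_weight m) S) < \<epsilon> / 3 / C"
    using infsum_tendsto[OF summ] \<epsilon> C by (intro tendstoD) auto
  have 3: "\<forall>\<^sub>F T in finite_subsets_at_top S. finite T \<and> T \<subseteq> S"
    by (rule eventually_finite_subsets_at_top_weakI) simp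
  from eventually_happens'[OF _ eventually_conj[OF 1 eventually_conj[OF 2 3]]]
  obtain T where T: "finite T" "T \<subseteq> S" and T1: "dist (\<Prod>P\<in>T. 1 - norm_weight m P) d < \<epsilon> / 3"
    and T2: "dist (sum (norm_weight m) T) (infsum (norm_weight m) S) < \<epsilon> / 3 / C"
    by auto
  have "infsum (norm_weight m) (S - T) = infsum (norm_weight m) S - sum (norm_weight m) T"
    using T infsum_Diff[OF summ _ T(2)] by simp
  hence "infsum (norm_weight m) (S - T) < \<epsilon> / 3 / C" using T2 by (simp add: dist_real_def)
  hence tail: "C * infsum (norm_weight m) (S - T) < \<epsilon> / 3" using C by (simp add: field_simps)
  have off: "\<forall>\<^sub>F D in net_filter ?A. D \<in> ?A"
    by (rule eventually_net_filterI[of "\<lambda>_. 0"]) (simp_all add: effective_divisors_off_def zero_divisor)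
  have small: "\<forall>\<^sub>F D in net_filter ?A. 1 / real (card (L D)) < \<epsilon> / 3"
    using \<epsilon> by (intro eventually_card_L_large[OF S(2)]) simp
  from off small eventually_ddeg_ge[OF S(2), of "c + int (\<Sum>P\<in>T. place_degree K P)"]
  show "\<forall>\<^sub>F D in net_filter ?A. dist (?p D) d < \<epsilon>"
  proof eventually_elim
    case (elim D)
    note b = rr_proportion_bounds[OF S(1) Sp m T elim(1) g c elim(3)]
    show ?case
      using b[folded C_def] elim(2) tail T1 unfolding dist_real_def abs_less_iff by linarith
  qed
qed

end

text \<open>Convergence of the product is part of the conclusion because \<open>infprod\<close> is a
  \<open>Lim\<close>, whose value carries information only if the limit exists.\<close>

theorem theorem2p1:
  fixes K :: "'f::field set" and S :: "'f set set" and m :: nat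
  assumes "finite K"
    and "function_field_over K"
    and "full_constant_field K"
    and "S \<noteq> {}"
    and "S \<subset> places K"
    and "m \<ge> 2"
  shows "has_infprod (zeta_factor K (real (card K) powi (- int m))) S
           (holomorphy_zeta K S (real (card K) powi (- int m))) \<and>
         has_density K S m (unimodular_tuples (holomorphy_ring K S) m)
           (1 / holomorphy_zeta K S (real (card K) powi (- int m)))"
proof -
  have "is_subfield K" using assms(2) by (simp add: function_field_over_def)
  then interpret function_field K using assms by unfold_locales
  have Sp: "S \<subseteq> places K" using assms(5) by blast
  have zf: "zeta_factor K (real (card K) powi (- int m)) = (\<lambda>P. inverse (1 - norm_weight m P))"
    by (simp add: fun_eq_iff zeta_factor_eq)
  obtain z where z: "has_infprod (\<lambda>P. inverse (1 - norm_weight m P)) S z"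
    "has_infprod (\<lambda>P. 1 - norm_weight m P) S (1 / z)"
  proof (rule has_infprod_inverse_one_minus)
    show "norm_weight m summable_on S"
      by (rule summable_on_subset_banach[OF norm_weight_summable[OF assms(6)] Sp])
  qed (use norm_weight_pos[of m] norm_weight_le_half[OF _ assms(6)] Sp in \<open>auto simp: less_imp_le\<close>)
  have "holomorphy_zeta K S (real (card K) powi (- int m)) = z"
    unfolding holomorphy_zeta_def zf by (rule infprod_eqI[OF z(1)])
  thus ?thesis using z(1) density_unimodular[OF assms(4,5,6) z(2)] by (simp add: zf)
qed

end
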